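(* Let $V_h$ consist of the continuous piecewise linear functions on $\mathcal T$ vanishing on $\partial\Omega$ and let $A$ be the corresponding $d^3$-weighted stiffness matrix, which is symmetric and positive definite. Let $\gamma>0$ and, for a subset $\mathcal A$ of the nodes with complement $\mathcal I$, consider the frozen system $$\begin{bmatrix}A+\gamma^{-1}D_{\mathcal A}&-D_{\mathcal A}\\-D_{\mathcal A}&-\gamma D_{\mathcal I}\end{bmatrix}\begin{bmatrix}P\\\lambda\end{bmatrix}=\begin{bmatrix}F\\0\end{bmatrix}.$$ Then: (i) for every choice of $\mathcal A$ the matrix is nonsingular; (ii) the solution satisfies $P_i=0$ on $\mathcal A$ and $\lambda_i=0$ off $\mathcal A$, so that $\lambda_iP_i=0$ at every node, for every $\mathcal A$; (iii) the test argument $\gamma\lambda_i-P_i$ equals $\gamma\lambda_i$ on $\mathcal A$ and $-P_i$ on $\mathcal I$; (iv) at a fixed point, i.e. if $\mathcal A=\{i:\gamma\lambda_i-P_i\ge0\}$, one has $\lambda_i\ge0$ on $\mathcal A$ and $P_i>0$ on $\mathcal I$; (v) neither the frozen solutions nor the fixed point depend on $\gamma$, and a fixed point satisfies the discrete Kuhn--Tucker conditions exactly (that is, $AP-D\lambda=F$ and $P_i\ge0$, $\lambda_i\ge0$, $\lambda_iP_i=0$ at every node, with $D=\mathrm{diag}(m_i)$); (vi) the function $P_h\in V_h$ with nodal values $P_i$ at a fixed point is the unique minimiser of $\frac12a(v_h,v_h)-(f,v_h)_\Omega$ over $K_h:=\{v_h\in V_h:v_h\ge0\text{ in }\Omega\}$,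 and $K_h\subset K:=\{v\in H^1_0(\Omega):v\ge0\text{ a.e. in }\Omega\}$.
   Context: $\Omega\subset\mathbb R^2$ is a bounded polygonal domain with a conforming triangulation $\mathcal T$; $d^3\in L_\infty(\Omega)$ with $d^3\ge d_0^3>0$; $f\in L_2(\Omega)$; $a(v,w)=(d^3\nabla v,\nabla w)_\Omega$. With $\varphi_i$ the nodal (hat) basis functions of $V_h$, indexed by the interior nodes: $A_{ij}=a(\varphi_j,\varphi_i)$, $F_i=(f,\varphi_i)_\Omega$, $m_i=\int_\Omega\varphi_i\,\mathrm d\Omega$, $D_{\mathcal A}=\mathrm{diag}(m_i\mathbf 1_{i\in\mathcal A})$, $D_{\mathcal I}=\mathrm{diag}(m_i\mathbf 1_{i\in\mathcal I})$. $P=(P_i)$ and $\lambda=(\lambda_i)$ are nodal vectors. The active-set iteration solves the frozen system for the current $\mathcal A$ and replaces $\mathcal A$ by $\{i:\gamma\lambda_i-P_i\ge0\}$ (ties are assigned to $\mathcal A$); a fixed point is an $\mathcal A$, with its frozen solution, left unchanged by this update. *)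

theory Defs
  imports "HOL-Analysis.Analysis" "Jordan_Normal_Form.Matrix"
begin

text \<open>Elements of the function spaces are represented by functions on the whole plane; only their
  values on \<open>\<Omega>\<close> matter, and equality in the spaces is equality almost everywhere.\<close>

definition L2 :: "(real^2) set \<Rightarrow> ((real^2) \<Rightarrow> real) set" where
  "L2 \<Omega> = {u. u \<in> borel_measurable (lebesgue_on \<Omega>) \<and> integrable (lebesgue_on \<Omega>) (\<lambda>x. (u x)^2)}"

definition Linf :: "(real^2) set \<Rightarrow> ((real^2) \<Rightarrow> real) set" where
  "Linf \<Omega> = {u. u \<in> borel_measurable (lebesgue_on \<Omega>) \<and> (\<exists>C. AE x in lebesgue_on \<Omega>. \<bar>u x\<bar> \<le> C)}"

definition L2_prod :: "(real^2) set \<Rightarrow> ((real^2) \<Rightarrow> real) \<Rightarrow> ((real^2) \<Rightarrow> real) \<Rightarrow> real" where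
  "L2_prod \<Omega> u v = (\<integral>x. u x * v x \<partial>lebesgue_on \<Omega>)"

primrec Ck :: "nat \<Rightarrow> ((real^2) \<Rightarrow> real) \<Rightarrow> bool" where
  "Ck 0 u \<longleftrightarrow> continuous_on UNIV u"
| "Ck (Suc k) u \<longleftrightarrow> (\<forall>x. u differentiable at x) \<and>
     (\<forall>b\<in>Basis. Ck k (\<lambda>x. frechet_derivative u (at x) b))"

definition test_functions :: "(real^2) set \<Rightarrow> ((real^2) \<Rightarrow> real) set" where
  "test_functions \<Omega> = {\<phi>. (\<forall>k. Ck k \<phi>) \<and> compact (closure {x. \<phi> x \<noteq> 0}) \<and> closure {x. \<phi> x \<noteq> 0} \<subseteq> \<Omega>}"

definition has_weak_gradient ::
    "(real^2) set \<Rightarrow> ((real^2) \<Rightarrow> real) \<Rightarrow> ((real^2) \<Rightarrow> real^2) \<Rightarrow> bool" where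
  "has_weak_gradient \<Omega> u g \<longleftrightarrow> (\<forall>b\<in>Basis. (\<lambda>x. inner (g x) b) \<in> L2 \<Omega> \<and>
     (\<forall>\<phi>\<in>test_functions \<Omega>.
        L2_prod \<Omega> u (\<lambda>x. frechet_derivative \<phi> (at x) b) = - L2_prod \<Omega> (\<lambda>x. inner (g x) b) \<phi>))"

definition H1 :: "(real^2) set \<Rightarrow> ((real^2) \<Rightarrow> real) set" where
  "H1 \<Omega> = {u \<in> L2 \<Omega>. \<exists>g. has_weak_gradient \<Omega> u g}"

text \<open>The weak gradient is unique up to a null set, so the choice does not affect any of the
  integrals below.\<close>

definition weak_gradient :: "(real^2) set \<Rightarrow> ((real^2) \<Rightarrow> real) \<Rightarrow> (real^2) \<Rightarrow> real^2" where
  "weak_gradient \<Omega> u = (SOME g. has_weak_gradient \<Omega> u g)"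

definition H1_norm :: "(real^2) set \<Rightarrow> ((real^2) \<Rightarrow> real) \<Rightarrow> real" where
  "H1_norm \<Omega> u = sqrt ((\<integral>x. (u x)^2 \<partial>lebesgue_on \<Omega>) + (\<integral>x. (norm (weak_gradient \<Omega> u x))^2 \<partial>lebesgue_on \<Omega>))"

definition H10 :: "(real^2) set \<Rightarrow> ((real^2) \<Rightarrow> real) set" where
  "H10 \<Omega> = {u \<in> H1 \<Omega>. \<forall>\<epsilon>>0. \<exists>\<phi>\<in>test_functions \<Omega>. H1_norm \<Omega> (\<lambda>x. u x - \<phi> x) < \<epsilon>}"

definition energy_form ::
    "(real^2) set \<Rightarrow> ((real^2) \<Rightarrow> real) \<Rightarrow> ((real^2) \<Rightarrow> real) \<Rightarrow> ((real^2) \<Rightarrow> real) \<Rightarrow> real" where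
  "energy_form \<Omega> d v w =
     (\<integral>x. (d x)^3 * inner (weak_gradient \<Omega> v x) (weak_gradient \<Omega> w x) \<partial>lebesgue_on \<Omega>)"

definition energy ::
    "(real^2) set \<Rightarrow> ((real^2) \<Rightarrow> real) \<Rightarrow> ((real^2) \<Rightarrow> real) \<Rightarrow> ((real^2) \<Rightarrow> real) \<Rightarrow> real" where
  "energy \<Omega> d f v = 1/2 * energy_form \<Omega> d v v - L2_prod \<Omega> f v"


definition polygonal_domain :: "(real^2) set \<Rightarrow> bool" where
  "polygonal_domain \<Omega> \<longleftrightarrow> open \<Omega> \<and> connected \<Omega> \<and> \<Omega> \<noteq> {} \<and>
     (\<exists>S. finite S \<and> (\<forall>s\<in>S. \<exists>p q. p \<noteq> q \<and> s = closed_segment p q) \<and> frontier \<Omega> = \<Union>S)"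

text \<open>The predicate \<^const>\<open>triangulation\<close> contains finiteness and conformity (two simplices meet in
  a common face, possibly empty). The last clause says that the boundary is resolved by the mesh;
  it follows from the other ones if \<open>\<Omega>\<close> is the interior of its closure, and otherwise it makes
  sure that slits of \<open>\<Omega>\<close> run along edges.\<close>

definition conforming_triangulation :: "(real^2) set \<Rightarrow> (real^2) set set \<Rightarrow> bool" where
  "conforming_triangulation \<Omega> \<T> \<longleftrightarrow> triangulation \<T> \<and> (\<forall>t\<in>\<T>. 2 simplex t) \<and> \<Union>\<T> = closure \<Omega> \<and>
     (\<exists>E. (\<forall>e\<in>E. \<exists>t\<in>\<T>. e edge_of t) \<and> frontier \<Omega> = \<Union>E)"

definition interior_nodes :: "(real^2) set \<Rightarrow> (real^2) set set \<Rightarrow> (real^2) set" where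
  "interior_nodes \<Omega> \<T> = {z \<in> \<Omega>. \<exists>t\<in>\<T>. z extreme_point_of t}"

text \<open>Finite element functions live on the closure of \<open>\<Omega>\<close>. They are extended by zero to the plane,
  so that they are determined by their values on \<open>\<Omega>\<close>; as \<open>\<Omega>\<close> is open, the last clause contains the
  boundary condition.\<close>

definition Vh :: "(real^2) set \<Rightarrow> (real^2) set set \<Rightarrow> ((real^2) \<Rightarrow> real) set" where
  "Vh \<Omega> \<T> = {v. continuous_on (closure \<Omega>) v \<and> (\<forall>t\<in>\<T>. \<exists>g c. \<forall>x\<in>t. v x = inner g x + c) \<and>
     (\<forall>x. x \<notin> \<Omega> \<longrightarrow> v x = 0)}"

definition hat :: "(real^2) set \<Rightarrow> (real^2) set set \<Rightarrow> real^2 \<Rightarrow> (real^2) \<Rightarrow> real" where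
  "hat \<Omega> \<T> z = (THE v. v \<in> Vh \<Omega> \<T> \<and> (\<forall>y\<in>interior_nodes \<Omega> \<T>. v y = (if y = z then 1 else 0)))"

definition Kh :: "(real^2) set \<Rightarrow> (real^2) set set \<Rightarrow> ((real^2) \<Rightarrow> real) set" where
  "Kh \<Omega> \<T> = {v \<in> Vh \<Omega> \<T>. \<forall>x\<in>\<Omega>. v x \<ge> 0}"

definition K_cone :: "(real^2) set \<Rightarrow> ((real^2) \<Rightarrow> real) set" where
  "K_cone \<Omega> = {v \<in> H10 \<Omega>. AE x in lebesgue_on \<Omega>. v x \<ge> 0}"

text \<open>In the following the interior nodes are numbered as \<open>z 0, \<dots>, z (n - 1)\<close>.\<close>

definition stiffness ::
    "(real^2) set \<Rightarrow> (real^2) set set \<Rightarrow> ((real^2) \<Rightarrow> real) \<Rightarrow> nat \<Rightarrow> (nat \<Rightarrow> real^2) \<Rightarrow> real mat" where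
  "stiffness \<Omega> \<T> d n z = mat n n (\<lambda>(i,j). energy_form \<Omega> d (hat \<Omega> \<T> (z j)) (hat \<Omega> \<T> (z i)))"

definition load ::
    "(real^2) set \<Rightarrow> (real^2) set set \<Rightarrow> ((real^2) \<Rightarrow> real) \<Rightarrow> nat \<Rightarrow> (nat \<Rightarrow> real^2) \<Rightarrow> real Matrix.vec" where
  "load \<Omega> \<T> f n z = Matrix.vec n (\<lambda>i. L2_prod \<Omega> f (hat \<Omega> \<T> (z i)))"

definition mass :: "(real^2) set \<Rightarrow> (real^2) set set \<Rightarrow> real^2 \<Rightarrow> real" where
  "mass \<Omega> \<T> y = (\<integral>x. hat \<Omega> \<T> y x \<partial>lebesgue_on \<Omega>)"

definition mass_diag ::
    "(real^2) set \<Rightarrow> (real^2) set set \<Rightarrow> nat \<Rightarrow> (nat \<Rightarrow> real^2) \<Rightarrow> nat set \<Rightarrow> real mat" where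
  "mass_diag \<Omega> \<T> n z S = mat n n (\<lambda>(i,j). if i = j \<and> i \<in> S then mass \<Omega> \<T> (z i) else 0)"


text \<open>Here \<open>D S\<close> stands for the diagonal matrix with entries \<open>m\<^sub>i\<close> for \<open>i\<close> in \<open>S\<close> and \<open>0\<close> otherwise.\<close>

definition frozen_matrix ::
    "nat \<Rightarrow> real mat \<Rightarrow> (nat set \<Rightarrow> real mat) \<Rightarrow> real \<Rightarrow> nat set \<Rightarrow> real mat" where
  "frozen_matrix n A D \<gamma> \<A> = four_block_mat
     (A + inverse \<gamma> \<cdot>\<^sub>m D \<A>) (- D \<A>)
     (- D \<A>)                 (- (\<gamma> \<cdot>\<^sub>m D ({..<n} - \<A>)))"

definition frozen_solution ::
    "nat \<Rightarrow> real mat \<Rightarrow> (nat set \<Rightarrow> real mat) \<Rightarrow> real Matrix.vec \<Rightarrow> real \<Rightarrow> nat set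
     \<Rightarrow> real Matrix.vec \<Rightarrow> real Matrix.vec \<Rightarrow> bool" where
  "frozen_solution n A D F \<gamma> \<A> P l \<longleftrightarrow> P \<in> carrier_vec n \<and> l \<in> carrier_vec n \<and>
     frozen_matrix n A D \<gamma> \<A> *\<^sub>v (P @\<^sub>v l) = F @\<^sub>v 0\<^sub>v n"

definition fixed_point ::
    "nat \<Rightarrow> real mat \<Rightarrow> (nat set \<Rightarrow> real mat) \<Rightarrow> real Matrix.vec \<Rightarrow> real \<Rightarrow> nat set
     \<Rightarrow> real Matrix.vec \<Rightarrow> real Matrix.vec \<Rightarrow> bool" where
  "fixed_point n A D F \<gamma> \<A> P l \<longleftrightarrow> frozen_solution n A D F \<gamma> \<A> P l \<and>
     \<A> = {i\<in>{..<n}. \<gamma> * vec_index l i - vec_index P i \<ge> 0}"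

end

(* Functions in V_h, extended by zero, are Lipschitz on the plane and affine near almost every
   point. Difference quotients and dominated convergence therefore show that their weak gradient is
   the classical one. For v in K_h, mollifying max (v - 1/k) 0 produces test functions whose gradient
   at almost every point is eventually equal to that of v, so that K_h lies in H^1_0. If the energy of
   v vanishes, all its affine pieces are constant, so v is Lipschitz with constant 0 and hence zero:
   the stiffness matrix is positive definite.
   Since the masses are positive, the frozen system decouples into P = 0 on the active set,
   lambda = 0 off it and A P - D lambda = F, independently of gamma. A kernel vector satisfies
   P^T A P = 0. At a fixed point the discrete Kuhn-Tucker conditions make the energy increase
   strictly from P_h to every other element of K_h. *)

theory Submission
  imports Defs "Jordan_Normal_Form.Determinant"
begin

section \<open>Smooth bump functions\<close>

text \<open>\<open>weak_gradient\<close> is picked by \<open>SOME\<close>, so no energy can be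
  evaluated before weak gradients are known to agree almost everywhere. This is what the bump
  functions are for: they approximate indicators of boxes and thereby separate integrable functions.
  Integration by parts triangle by triangle would leave edge terms whose cancellation has to be
  tracked; shifting difference quotients treats all Lipschitz functions alike. Extension by zero
  makes elements of \<open>Vh\<close> Lipschitz on the whole plane: where a segment leaves \<Omega>
  and returns, the outer stretch is one more piece, of slope zero. Cutting off at a positive level
  before mollifying pulls the support into a compact subset of \<Omega>, whatever corners or slits
  the boundary has; the cut-off function is close to \<open>v\<close> because
  \<open>v \<ge> 0\<close>. At a point where \<open>v\<close> is locally affine, nonnegativity
  leaves two cases, \<open>v\<close> zero nearby or \<open>v\<close> bounded away from zero nearby,
  and a small cut-off level changes the gradient in neither.\<close>

lemma Ck_SucI:
  assumes "\<And>x. (u has_derivative u' x) (at x)" and "\<And>b. b \<in> Basis \<Longrightarrow> Ck k (\<lambda>x. u' x b)"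
  shows "Ck (Suc k) u"
proof -
  have "frechet_derivative u (at x) = u' x" for x
    using assms(1) frechet_derivative_at by metis
  then show ?thesis
    using assms by (auto simp: differentiable_def)
qed

lemma Ck_SucD:
  assumes "Ck (Suc k) u"
  shows "(u has_derivative frechet_derivative u (at x)) (at x)"
    and "b \<in> Basis \<Longrightarrow> Ck k (\<lambda>x. frechet_derivative u (at x) b)"
  using assms by (auto simp: frechet_derivative_works[symmetric])

lemma Ck_imp_continuous:
  assumes "Ck k u"
  shows "continuous_on UNIV u"
proof (cases k)
  case (Suc j)
  then have "u differentiable (at x)" for x
    using assms by simp
  then show ?thesis
    by (simp add: continuous_at_imp_continuous_on differentiable_imp_continuous_within)
qed (use assms in simp)

lemma Ck_Suc_imp_Ck: "Ck (Suc k) u \<Longrightarrow> Ck k u"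
proof (induction k arbitrary: u)
  case 0
  then show ?case
    using Ck_imp_continuous by fastforce
next
  case (Suc k)
  then show ?case
    by (metis Ck.simps(2))
qed

lemma Ck_const: "Ck k (\<lambda>x. c)"
proof (induction k arbitrary: c)
  case (Suc k)
  then show ?case
    by (intro Ck_SucI[where u'="\<lambda>_ _. 0"]) auto
qed simp

lemma Ck_add: "Ck k u \<Longrightarrow> Ck k v \<Longrightarrow> Ck k (\<lambda>x. u x + v x)"
proof (induction k arbitrary: u v)
  case (Suc k)
  show ?case
  proof (rule Ck_SucI)
    show "((\<lambda>x. u x + v x) has_derivative
      (\<lambda>h. frechet_derivative u (at x) h + frechet_derivative v (at x) h)) (at x)" for x
      by (intro derivative_intros Ck_SucD(1)[of k] Suc.prems)
    show "Ck k (\<lambda>x. frechet_derivative u (at x) b + frechet_derivative v (at x) b)"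
      if "b \<in> Basis" for b
      using that by (intro Suc.IH Ck_SucD(2) Suc.prems)
  qed
qed (auto intro: continuous_intros)

lemma Ck_mult: "Ck k u \<Longrightarrow> Ck k v \<Longrightarrow> Ck k (\<lambda>x. u x * v x)"
proof (induction k arbitrary: u v)
  case (Suc k)
  show ?case
  proof (rule Ck_SucI)
    show "((\<lambda>x. u x * v x) has_derivative
      (\<lambda>h. u x * frechet_derivative v (at x) h + frechet_derivative u (at x) h * v x)) (at x)" for x
      by (intro derivative_intros Ck_SucD(1)[of k] Suc.prems)
    show "Ck k (\<lambda>x. u x * frechet_derivative v (at x) b + frechet_derivative u (at x) b * v x)"
      if "b \<in> Basis" for b
      using Suc.IH[OF Ck_Suc_imp_Ck[OF Suc.prems(1)] Ck_SucD(2)[OF Suc.prems(2) that]]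
        Suc.IH[OF Ck_SucD(2)[OF Suc.prems(1) that] Ck_Suc_imp_Ck[OF Suc.prems(2)]]
      by (rule Ck_add)
  qed
qed (auto intro: continuous_intros)

lemma Ck_prod: "finite I \<Longrightarrow> (\<And>i. i \<in> I \<Longrightarrow> Ck k (u i)) \<Longrightarrow> Ck k (\<lambda>x. \<Prod>i\<in>I. u i x)"
  by (induction I rule: finite_induct) (auto intro: Ck_const Ck_mult)

text \<open>Dividing \<open>exp (- 1 / x)\<close> by powers of \<open>x\<close> makes the family closed under differentiation.\<close>

definition flat :: "nat \<Rightarrow> real \<Rightarrow> real" where
  "flat m x = (if x > 0 then exp (- 1 / x) / x ^ m else 0)"

text \<open>The substitution \<open>y = inverse x\<close> turns this into the fact that the
  exponential beats every power at infinity.\<close>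

lemma flat_at_right_0: "(flat m \<longlongrightarrow> 0) (at_right 0)"
proof -
  have "((\<lambda>y::real. y ^ m / exp y) \<longlongrightarrow> 0) at_top"
    by (rule tendsto_power_div_exp_0)
  then have "((\<lambda>x::real. inverse x ^ m / exp (inverse x)) \<longlongrightarrow> 0) (at_right 0)"
    by (rule filterlim_compose) (rule filterlim_inverse_at_top_right)
  moreover have "\<forall>\<^sub>F x in at_right 0. inverse x ^ m / exp (inverse x) = flat m x"
    unfolding eventually_at_right_field
    by (intro exI[of _ 1]) (auto simp: flat_def exp_minus divide_inverse power_inverse)
  ultimately show ?thesis
    by (rule Lim_transform_eventually)
qed

lemma has_derivative_flat:
  "(flat m has_real_derivative flat (m + 2) x - real m * flat (m + 1) x) (at x)"
proof -
  consider "x > 0" | "x < 0" | "x = 0" by linarith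
  then show ?thesis
  proof cases
    case 1
    have "((\<lambda>x. inverse x ^ m) has_real_derivative - real m * inverse x ^ (m + 1)) (at x)"
      by (rule DERIV_cong, rule DERIV_power, rule DERIV_inverse)
        (use 1 in simp, cases m, auto simp: algebra_simps)
    moreover have "((\<lambda>x. exp (- inverse x)) has_real_derivative
        exp (- inverse x) * inverse x ^ 2) (at x)"
      using 1 by (auto intro!: derivative_eq_intros simp: power2_eq_square)
    ultimately have "((\<lambda>x. exp (- inverse x) * inverse x ^ m) has_real_derivative
        (exp (- inverse x) * inverse x ^ 2) * inverse x ^ m
        + (- real m * inverse x ^ (m + 1)) * exp (- inverse x)) (at x)"
      by (intro DERIV_mult)
    moreover have "(exp (- inverse x) * inverse x ^ 2) * inverse x ^ m
        + (- real m * inverse x ^ (m + 1)) * exp (- inverse x) =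
        flat (m + 2) x - real m * flat (m + 1) x"
      using 1 by (simp add: flat_def divide_inverse power_add power_inverse power2_eq_square)
    ultimately have "((\<lambda>x. exp (- inverse x) * inverse x ^ m) has_real_derivative
        flat (m + 2) x - real m * flat (m + 1) x) (at x)"
      by simp
    then show ?thesis
      by (rule has_field_derivative_transform_within_open[where S="{0<..}"])
        (use 1 in \<open>auto simp: flat_def divide_inverse power_inverse\<close>)
  next
    case 2
    have "((\<lambda>x. 0) has_real_derivative flat (m + 2) x - real m * flat (m + 1) x) (at x)"
      using 2 by (auto simp: flat_def)
    then show ?thesis
      by (rule has_field_derivative_transform_within_open[where S="{..<0}"])
        (use 2 in \<open>auto simp: flat_def\<close>)
  next
    case 3
    \<comment> \<open>To the right of \<open>0\<close> the difference quotient of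
      \<open>flat m\<close> is \<open>flat (m + 1)\<close>, so the family itself supplies the
      limit.\<close>
    have "((\<lambda>y. flat m y / y) \<longlongrightarrow> 0) (at_right 0)"
    proof (rule Lim_transform_eventually[OF flat_at_right_0[of "m + 1"]])
      show "\<forall>\<^sub>F y in at_right 0. flat (m + 1) y = flat m y / y"
        by (rule eventually_mono[OF eventually_at_right_less]) (auto simp: flat_def)
    qed
    moreover have "((\<lambda>y. flat m y / y) \<longlongrightarrow> 0) (at_left 0)"
      by (rule Lim_transform_eventually[OF tendsto_const])
        (rule eventually_mono[OF eventually_at_left_real[of "-1" 0]], auto simp: flat_def)
    ultimately have "((\<lambda>y. flat m y / y) \<longlongrightarrow> 0) (at 0)"
      by (simp add: filterlim_at_split)
    then show ?thesis
      using 3 by (simp add: has_field_derivative_iff flat_def)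
  qed
qed

text \<open>Differentiation only raises \<open>m\<close> and brings out constant factors; the affine
  argument stays the same, so the induction runs with \<open>m\<close> arbitrary.\<close>

lemma Ck_flat: "Ck k (\<lambda>x. flat m (\<alpha> * inner x b + \<beta>))"
proof (induction k arbitrary: m)
  case 0
  have "continuous_on UNIV (flat m)"
    by (intro continuous_at_imp_continuous_on ballI DERIV_isCont[OF has_derivative_flat])
  then have "continuous_on UNIV (\<lambda>x. flat m (\<alpha> * inner x b + \<beta>))"
    by (rule continuous_on_compose2) (auto intro!: continuous_intros)
  then show ?case
    by simp
next
  case (Suc k)
  define v where "v x = (flat (m + 2) (\<alpha> * inner x b + \<beta>)
      + (- real m) * flat (m + 1) (\<alpha> * inner x b + \<beta>)) * \<alpha>" for x
  show ?case
  proof (rule Ck_SucI)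
    show "((\<lambda>x. flat m (\<alpha> * inner x b + \<beta>)) has_derivative (\<lambda>h. v x * inner h b)) (at x)" for x
    proof -
      have "((\<lambda>x. \<alpha> * inner x b + \<beta>) has_derivative (\<lambda>h. \<alpha> * inner h b)) (at x)"
        by (auto intro!: derivative_eq_intros)
      from has_derivative_compose[OF this has_derivative_flat[unfolded has_field_derivative_def]]
      show ?thesis
        by (simp add: v_def algebra_simps)
    qed
    show "Ck k (\<lambda>x. v x * inner b' b)" for b'
      unfolding v_def
      by (rule Ck_mult[OF Ck_mult[OF Ck_add[OF Suc.IH
            Ck_mult[OF Ck_const[of k "- real m"] Suc.IH]] Ck_const] Ck_const])
  qed
qed

text \<open>A product of one-dimensional factors that is positive exactly on \<open>box a c\<close>
  when \<open>k > 0\<close>. The parameter \<open>k\<close> leaves this set unchanged and only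
  steepens the flanks.\<close>

definition bump :: "real^2 \<Rightarrow> real^2 \<Rightarrow> real \<Rightarrow> real^2 \<Rightarrow> real" where
  "bump a c k x = (\<Prod>b\<in>Basis. flat 0 (k * (inner x b - inner a b)) * flat 0 (k * (inner c b - inner x b)))"

lemma Ck_bump: "Ck j (bump a c k)"
proof -
  have "Ck j (\<lambda>x. \<Prod>b\<in>Basis. flat 0 (k * inner x b + (- k * inner a b)) *
      flat 0 ((- k) * inner x b + k * inner c b))"
    by (intro Ck_prod Ck_mult Ck_flat) auto
  then show ?thesis
    by (simp add: bump_def[abs_def] algebra_simps)
qed

lemma flat_bounds: "0 \<le> flat 0 x" "flat 0 x \<le> 1"
  by (auto simp: flat_def)

lemma bump_nonneg: "0 \<le> bump a c k x"
  unfolding bump_def by (intro prod_nonneg mult_nonneg_nonneg flat_bounds ballI)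

lemma bump_le_1: "bump a c k x \<le> 1"
  unfolding bump_def by (intro prod_le_1 conjI mult_nonneg_nonneg mult_le_one flat_bounds)

lemma bump_eq_0: "k > 0 \<Longrightarrow> x \<notin> box a c \<Longrightarrow> bump a c k x = 0"
  by (fastforce simp: bump_def mem_box flat_def zero_less_mult_iff)

lemma bump_pos: "k > 0 \<Longrightarrow> x \<in> box a c \<Longrightarrow> bump a c k x > 0"
  unfolding bump_def by (auto intro!: prod_pos simp: mem_box flat_def zero_less_mult_iff)

text \<open>Inside the box every factor has the form \<open>exp (- 1 / (k * y))\<close> with
  \<open>y > 0\<close> and tends to one; outside, the product is zero for every \<open>k\<close>.
  Box integrals thus become limits of integrals against test functions.\<close>

lemma bump_tendsto_indicator: "(\<lambda>k. bump a c (real (Suc k)) x) \<longlonglongrightarrow> indicator (box a c) x"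
proof (cases "x \<in> box a c")
  case True
  have *: "(\<lambda>k. flat 0 (real (Suc k) * y)) \<longlonglongrightarrow> 1" if "y > 0" for y
  proof -
    have "(\<lambda>k. exp (- (inverse (real (Suc k)) * inverse y))) \<longlonglongrightarrow> exp (- (0 * inverse y))"
      by (intro tendsto_intros LIMSEQ_inverse_real_of_nat)
    then show ?thesis
      using that by (simp add: flat_def divide_simps zero_less_mult_iff)
  qed
  have "(\<lambda>k. bump a c (real (Suc k)) x) \<longlonglongrightarrow> (\<Prod>b\<in>(Basis :: (real^2) set). 1 * 1)"
    unfolding bump_def by (intro tendsto_prod tendsto_mult *) (use True in \<open>auto simp: mem_box\<close>)
  then show ?thesis
    using True by simp
qed (simp add: bump_eq_0)

lemma bump_in_test_functions:
  assumes "k > 0" "cbox a c \<subseteq> \<Omega>"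
  shows "bump a c k \<in> test_functions \<Omega>"
proof -
  have "{x. bump a c k x \<noteq> 0} \<subseteq> cbox a c"
    using bump_eq_0[OF assms(1)] box_subset_cbox by blast
  then have *: "closure {x. bump a c k x \<noteq> 0} \<subseteq> cbox a c"
    by (intro closure_minimal closed_cbox)
  then have "compact (closure {x. bump a c k x \<noteq> 0})"
    by (meson bounded_cbox bounded_subset closed_closure compact_eq_bounded_closed)
  then show ?thesis
    using * assms(2) Ck_bump by (auto simp: test_functions_def)
qed

section \<open>Uniqueness of weak gradients\<close>

lemma AE_lebesgue_onI:
  assumes "\<Omega> \<in> sets lebesgue" "negligible N" "\<And>x. x \<in> \<Omega> \<Longrightarrow> x \<notin> N \<Longrightarrow> P x"
  shows "AE x in lebesgue_on \<Omega>. P x"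
proof -
  have "AE x in lebesgue. x \<in> \<Omega> \<longrightarrow> P x"
    by (rule AE_I'[where N=N]) (use assms negligible_iff_null_sets in auto)
  then show ?thesis
    using assms(1) by (simp add: AE_restrict_space_iff)
qed

lemma open_bounded_lmeasurable:
  fixes \<Omega> :: "'a::euclidean_space set"
  assumes "open \<Omega>" "bounded \<Omega>"
  shows "\<Omega> \<in> lmeasurable" "\<Omega> \<in> sets lebesgue"
  using assms by (auto simp: lmeasurable_open)

lemma integrable_lebesgue_on_bounded:
  fixes u :: "'a::euclidean_space \<Rightarrow> real"
  assumes "\<Omega> \<in> lmeasurable" "u \<in> borel_measurable (lebesgue_on \<Omega>)"
    "AE x in lebesgue_on \<Omega>. \<bar>u x\<bar> \<le> C"
  shows "integrable (lebesgue_on \<Omega>) u"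
  using assms by (intro finite_measure.integrable_const_bound[OF finite_measure_lebesgue_on]) auto

lemma L2_bounded:
  assumes "\<Omega> \<in> lmeasurable" "u \<in> borel_measurable (lebesgue_on \<Omega>)"
    "AE x in lebesgue_on \<Omega>. \<bar>u x\<bar> \<le> C"
  shows "u \<in> L2 \<Omega>"
proof -
  have "AE x in lebesgue_on \<Omega>. \<bar>(u x)\<^sup>2\<bar> \<le> C\<^sup>2"
    using assms(3)
    by (rule AE_mp) (auto intro!: AE_I2 simp: abs_le_square_iff[symmetric])
  then have "integrable (lebesgue_on \<Omega>) (\<lambda>x. (u x)\<^sup>2)"
    using assms by (intro integrable_lebesgue_on_bounded) auto
  then show ?thesis
    using assms(2) by (simp add: L2_def)
qed

lemma L2_imp_integrable:
  assumes "\<Omega> \<in> lmeasurable" "u \<in> L2 \<Omega>"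
  shows "integrable (lebesgue_on \<Omega>) u"
proof (rule Bochner_Integration.integrable_bound)
  interpret finite_measure "lebesgue_on \<Omega>"
    by (rule finite_measure_lebesgue_on) fact
  show "integrable (lebesgue_on \<Omega>) (\<lambda>x. 1 + (u x)\<^sup>2)"
    using assms(2) by (auto simp: L2_def)
  have "\<bar>t\<bar> \<le> 1 + t\<^sup>2" for t :: real
  proof -
    have "0 \<le> (\<bar>t\<bar> - 1)\<^sup>2" by simp
    then show ?thesis by (simp add: power2_diff)
  qed
  then show "AE x in lebesgue_on \<Omega>. norm (u x) \<le> norm (1 + (u x)\<^sup>2)"
    by simp
qed (use assms in \<open>auto simp: L2_def\<close>)

lemma borel_measurable_lebesgue_on:
  "u \<in> borel_measurable borel \<Longrightarrow> u \<in> borel_measurable (lebesgue_on \<Omega>)"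
  by (metis measurable_completion measurable_lborel2 measurable_restrict_space1)

lemma integrable_L2_mult_bounded:
  assumes "\<Omega> \<in> lmeasurable" "u \<in> L2 \<Omega>" "w \<in> borel_measurable (lebesgue_on \<Omega>)"
    "AE x in lebesgue_on \<Omega>. \<bar>w x\<bar> \<le> C"
  shows "integrable (lebesgue_on \<Omega>) (\<lambda>x. u x * w x)"
proof (rule Bochner_Integration.integrable_bound)
  show "integrable (lebesgue_on \<Omega>) (\<lambda>x. C * u x)"
    using L2_imp_integrable[OF assms(1,2)] by simp
  show "AE x in lebesgue_on \<Omega>. norm (u x * w x) \<le> norm (C * u x)"
    using assms(4) by (rule AE_mp) (auto intro!: AE_I2 mult_mono simp: abs_mult mult.commute[of C])
qed (use assms in \<open>auto simp: L2_def\<close>)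

lemma bounded_if_compact_support:
  fixes w :: "'a::metric_space \<Rightarrow> real"
  assumes "continuous_on UNIV w" "compact K" "\<And>x. x \<notin> K \<Longrightarrow> w x = 0"
  shows "\<exists>B\<ge>0. \<forall>x. \<bar>w x\<bar> \<le> B"
proof -
  have "compact (w ` K)"
    using assms(1,2) compact_continuous_image continuous_on_subset by blast
  then obtain B where B: "\<And>x. x \<in> K \<Longrightarrow> \<bar>w x\<bar> \<le> B" "B > 0"
    by (metis bounded_pos compact_imp_bounded imageI real_norm_def)
  then have "\<bar>w x\<bar> \<le> B" for x
    using assms(3)[of x] by (cases "x \<in> K") auto
  then show ?thesis
    using B(2) by (intro exI[of _ B]) auto
qed

section \<open>Support and boundedness of test functions\<close>

lemma test_functions_Ck: "\<phi> \<in> test_functions \<Omega> \<Longrightarrow> Ck k \<phi>"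
  by (simp add: test_functions_def)

text \<open>One compact set serves the function and its derivatives, because the complement of the
  closed support is open and the function is locally constant there.\<close>

lemma test_functions_compact_support:
  assumes "\<phi> \<in> test_functions \<Omega>"
  shows "\<exists>K. compact K \<and> K \<subseteq> \<Omega> \<and>
    (\<forall>x. x \<notin> K \<longrightarrow> \<phi> x = 0 \<and> (\<forall>b. frechet_derivative \<phi> (at x) b = 0))"
proof -
  define K where "K = closure {x. \<phi> x \<noteq> 0}"
  have zero: "\<phi> x = 0" if "x \<notin> K" for x
    using that closure_subset[of "{x. \<phi> x \<noteq> 0}"] by (auto simp: K_def)
  have "frechet_derivative \<phi> (at x) b = 0" if "x \<notin> K" for x b
  proof -
    have "(\<phi> has_derivative (\<lambda>_. 0)) (at x)"
    proof (rule has_derivative_transform_within_open)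
      show "((\<lambda>_. 0) has_derivative (\<lambda>_. 0)) (at x)" by simp
      show "open (- K)" by (simp add: K_def open_Compl)
    qed (use that zero in auto)
    from frechet_derivative_at[OF this, symmetric] show ?thesis
      by simp
  qed
  moreover have "compact K" "K \<subseteq> \<Omega>"
    using assms by (auto simp: test_functions_def K_def)
  ultimately show ?thesis
    using zero by blast
qed

lemma test_functions_deriv:
  assumes "\<phi> \<in> test_functions \<Omega>"
  shows "(\<phi> has_derivative frechet_derivative \<phi> (at x)) (at x)"
    and "continuous_on UNIV \<phi>"
    and "b \<in> Basis \<Longrightarrow> continuous_on UNIV (\<lambda>x. frechet_derivative \<phi> (at x) b)"
  using Ck_SucD[OF test_functions_Ck[OF assms, of "Suc 0"]]
    Ck_imp_continuous[OF test_functions_Ck[OF assms, of 0]] by auto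

lemma test_functions_bounded:
  assumes "\<phi> \<in> test_functions \<Omega>"
  shows "\<exists>B\<ge>0. \<forall>x. \<bar>\<phi> x\<bar> \<le> B"
proof -
  obtain K where K: "compact K" "\<forall>x. x \<notin> K \<longrightarrow> \<phi> x = 0"
    using test_functions_compact_support[OF assms] by blast
  show ?thesis
    by (rule bounded_if_compact_support[OF test_functions_deriv(2)[OF assms] K(1)]) (simp add: K(2))
qed

text \<open>Testing with bumps that tend to the indicator of a box shows that \<open>g\<close> has
  integral zero over every closed box inside \<Omega>. Lebesgue differentiation recovers
  \<open>g\<close> at almost every point from integrals over shrinking boxes.\<close>

lemma fundamental_lemma_calculus_of_variations:
  assumes "open \<Omega>" "integrable (lebesgue_on \<Omega>) g"
    "\<And>\<phi>. \<phi> \<in> test_functions \<Omega> \<Longrightarrow> (\<integral>x. g x * \<phi> x \<partial>lebesgue_on \<Omega>) = 0"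
  shows "AE x in lebesgue_on \<Omega>. g x = 0"
proof -
  \<comment> \<open>Extension by zero makes box integrals available in the whole plane, as the
    differentiation theorem requires.\<close>
  define G where "G x = (if x \<in> \<Omega> then g x else 0)" for x
  have [measurable]: "\<Omega> \<in> sets lebesgue"
    using assms(1) by auto
  have G: "integrable lebesgue G"
    using assms(2) unfolding G_def by (simp add: Lebesgue_Measure.integrable_restrict_UNIV)
  then have GM[measurable]: "G \<in> borel_measurable lebesgue"
    by auto
  have "G integrable_on UNIV"
    using G by (rule integrable_on_lebesgue)
  then have Gi: "G integrable_on cbox a c" for a c
    by (rule integrable_on_subcbox) simp
  have zero: "integral (cbox a c) G = 0" if "cbox a c \<subseteq> \<Omega>" for a c
  proof -
    have [measurable]: "box a c \<in> sets lebesgue"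
      by simp
    have "(\<lambda>k. \<integral>x. G x * bump a c (real (Suc k)) x \<partial>lebesgue) \<longlonglongrightarrow>
        (\<integral>x. G x * indicator (box a c) x \<partial>lebesgue)"
    proof (rule integral_dominated_convergence[where w="\<lambda>x. \<bar>G x\<bar>"])
      have "bump a c k \<in> borel_measurable borel" for k
        using Ck_imp_continuous[OF Ck_bump[of 0]] by (rule borel_measurable_continuous_onI)
      then have [measurable]: "bump a c k \<in> borel_measurable lebesgue" for k
        by (metis measurable_completion measurable_lborel2)
      show "(\<lambda>x. G x * bump a c (real (Suc k)) x) \<in> borel_measurable lebesgue" for k
        by measurable
      show "AE x in lebesgue. norm (G x * bump a c (real (Suc k)) x) \<le> \<bar>G x\<bar>" for k
        using bump_nonneg[of a c "real (Suc k)"] bump_le_1[of a c "real (Suc k)"]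
        by (intro AE_I2) (simp add: abs_mult mult_left_le del: of_nat_Suc)
      show "AE x in lebesgue. (\<lambda>k. G x * bump a c (real (Suc k)) x) \<longlonglongrightarrow> G x * indicator (box a c) x"
        by (intro AE_I2 tendsto_intros bump_tendsto_indicator)
      show "(\<lambda>x. G x * indicator (box a c) x) \<in> borel_measurable lebesgue"
        by measurable
      show "integrable lebesgue (\<lambda>x. \<bar>G x\<bar>)"
        using G by (rule integrable_abs)
    qed
    moreover have "(\<integral>x. G x * bump a c (real (Suc k)) x \<partial>lebesgue) = 0" for k
    proof -
      have "(\<integral>x. G x * bump a c (real (Suc k)) x \<partial>lebesgue) =
          (\<integral>x. (if x \<in> \<Omega> then g x * bump a c (real (Suc k)) x else 0) \<partial>lebesgue)"
        by (rule Bochner_Integration.integral_cong) (auto simp: G_def)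
      also have "\<dots> = 0"
        using assms(3)[OF bump_in_test_functions[OF _ that, of "real (Suc k)"]]
        by (simp add: Lebesgue_Measure.integral_restrict_UNIV)
      finally show ?thesis .
    qed
    ultimately have "(\<integral>x. G x * indicator (box a c) x \<partial>lebesgue) = 0"
      by (simp add: LIMSEQ_const_iff)
    moreover have "(\<integral>x. G x * indicator (box a c) x \<partial>lebesgue) =
        (\<integral>x. (if x \<in> box a c then G x else 0) \<partial>lebesgue)"
      by (rule Bochner_Integration.integral_cong) auto
    moreover have "integrable lebesgue (\<lambda>x. indicator (box a c) x *\<^sub>R G x)"
      by (intro Bochner_Integration.integrable_mult_indicator G) simp
    then have "integrable (lebesgue_on (box a c)) G"
      by (simp add: integrable_restrict_space)
    ultimately have "integral (box a c) G = 0"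
      using lebesgue_integral_eq_integral[of "box a c" G]
      by (simp add: Lebesgue_Measure.integral_restrict_UNIV)
    then show ?thesis
      by (simp add: integral_open_interval)
  qed
  \<comment> \<open>Lebesgue differentiation in a corner form: the shrinking boxes have
    \<open>x\<close> as their lower vertex.\<close>
  obtain N where N: "negligible N" "\<And>x e. \<lbrakk>x \<notin> N; 0 < e\<rbrakk> \<Longrightarrow> \<exists>d>0. \<forall>h. 0 < h \<and> h < d \<longrightarrow>
      norm (integral (cbox x (x + h *\<^sub>R One)) G /\<^sub>R h ^ DIM(real^2) - G x) < e"
    using integrable_ccontinuous_explicit[OF Gi] by metis
  show ?thesis
  proof (rule AE_lebesgue_onI[OF _ N(1)])
    fix x assume x: "x \<in> \<Omega>" "x \<notin> N"
    show "g x = 0"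
    proof (rule ccontr)
      assume "g x \<noteq> 0"
      then obtain d where d: "d > 0" "\<And>h. 0 < h \<and> h < d \<Longrightarrow>
          norm (integral (cbox x (x + h *\<^sub>R One)) G /\<^sub>R h ^ DIM(real^2) - G x) < \<bar>g x\<bar>"
        using N(2)[OF x(2), of "\<bar>g x\<bar>"] by auto
      obtain e where e: "e > 0" "cball x e \<subseteq> \<Omega>"
        using assms(1) x(1) open_contains_cball by blast
      \<comment> \<open>The diagonal of the box of side \<open>h\<close> is
        \<open>h * norm One\<close>: the second bound keeps the box in \<open>cball x e\<close>, the
        first one makes \<open>h < d\<close>.\<close>
      define h where "h = min (d / 2) (e / norm (One :: real^2))"
      have One: "norm (One :: real^2) > 0"
        using One_non_0 by (simp add: zero_less_norm_iff del: One_non_0)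
      have h: "0 < h" "h < d" "h * norm (One :: real^2) \<le> e"
        using d(1) e(1) One by (auto simp: h_def min_le_iff_disj pos_le_divide_eq[symmetric])
      have "cbox x (x + h *\<^sub>R One) \<subseteq> cball x e"
      proof
        fix y assume y: "y \<in> cbox x (x + h *\<^sub>R One)"
        then have "norm (y - x) \<le> norm (h *\<^sub>R One :: real^2)"
          by (intro norm_le_componentwise) (auto simp: mem_box inner_simps)
        then show "y \<in> cball x e"
          using h by (simp add: dist_norm norm_minus_commute)
      qed
      then have "integral (cbox x (x + h *\<^sub>R One)) G = 0"
        using e(2) zero by blast
      then show False
        using d(2)[of h] h x(1) by (simp add: G_def)
    qed
  qed simp
qed

lemma weak_gradient_unique:
  assumes "open \<Omega>" "bounded \<Omega>" "has_weak_gradient \<Omega> u g" "has_weak_gradient \<Omega> u g'"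
  shows "AE x in lebesgue_on \<Omega>. g x = g' x"
proof -
  note \<Omega> = open_bounded_lmeasurable[OF assms(1,2)]
  have "AE x in lebesgue_on \<Omega>. inner (g x) b - inner (g' x) b = 0" if b: "b \<in> Basis" for b
  proof (rule fundamental_lemma_calculus_of_variations[OF assms(1)])
    have L2: "(\<lambda>x. inner (g x) b) \<in> L2 \<Omega>" "(\<lambda>x. inner (g' x) b) \<in> L2 \<Omega>"
      using assms(3,4) b by (auto simp: has_weak_gradient_def)
    then show "integrable (lebesgue_on \<Omega>) (\<lambda>x. inner (g x) b - inner (g' x) b)"
      using L2_imp_integrable[OF \<Omega>(1)] by auto
    fix \<phi> assume \<phi>: "\<phi> \<in> test_functions \<Omega>"
    obtain B where B: "\<forall>x. \<bar>\<phi> x\<bar> \<le> B"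
      using test_functions_bounded[OF \<phi>] by blast
    have "\<phi> \<in> borel_measurable (lebesgue_on \<Omega>)"
      using test_functions_deriv(2)[OF \<phi>]
      by (intro borel_measurable_lebesgue_on borel_measurable_continuous_onI)
    note * = integrable_L2_mult_bounded[OF \<Omega>(1) _ this AE_I2, of _ B]
    have "integrable (lebesgue_on \<Omega>) (\<lambda>x. inner (g x) b * \<phi> x)"
      "integrable (lebesgue_on \<Omega>) (\<lambda>x. inner (g' x) b * \<phi> x)"
      using B by (auto intro: *[OF L2(1)] *[OF L2(2)])
    moreover have "L2_prod \<Omega> u (\<lambda>x. frechet_derivative \<phi> (at x) b) = - L2_prod \<Omega> (\<lambda>x. inner (g x) b) \<phi>"
      "L2_prod \<Omega> u (\<lambda>x. frechet_derivative \<phi> (at x) b) = - L2_prod \<Omega> (\<lambda>x. inner (g' x) b) \<phi>"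
      using assms(3,4) b \<phi> by (auto simp: has_weak_gradient_def)
    ultimately show "(\<integral>x. (inner (g x) b - inner (g' x) b) * \<phi> x \<partial>lebesgue_on \<Omega>) = 0"
      by (simp add: L2_prod_def left_diff_distrib)
  qed
  then have "AE x in lebesgue_on \<Omega>. \<forall>b\<in>Basis. inner (g x) b - inner (g' x) b = 0"
    by (subst AE_finite_all) auto
  then show ?thesis
    by (rule eventually_mono) (simp add: euclidean_eq_iff[where 'a="real^2"])
qed

text \<open>Lets integrals over the arbitrarily chosen \<open>weak_gradient\<close> be computed with
  any weak gradient that is known explicitly.\<close>

lemma weak_gradient_AE_eq:
  assumes "open \<Omega>" "bounded \<Omega>" "has_weak_gradient \<Omega> u g"
  shows "AE x in lebesgue_on \<Omega>. weak_gradient \<Omega> u x = g x"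
    and "has_weak_gradient \<Omega> u (weak_gradient \<Omega> u)"
proof -
  show "has_weak_gradient \<Omega> u (weak_gradient \<Omega> u)"
    unfolding weak_gradient_def by (rule someI[of "has_weak_gradient \<Omega> u", OF assms(3)])
  then show "AE x in lebesgue_on \<Omega>. weak_gradient \<Omega> u x = g x"
    using weak_gradient_unique assms by blast
qed

section \<open>Weak gradients of Lipschitz functions\<close>

text \<open>The limit of difference quotients is Borel measurable for every continuous \<open>u\<close>; it is a junk value
  where \<open>u\<close> is not differentiable.\<close>

definition grad :: "(real^2 \<Rightarrow> real) \<Rightarrow> real^2 \<Rightarrow> real^2" where
  "grad u x = (\<Sum>b\<in>Basis. lim (\<lambda>n. real (Suc n) * (u (x + b /\<^sub>R real (Suc n)) - u x)) *\<^sub>R b)"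

lemma inner_grad:
  assumes "b \<in> Basis"
  shows "inner (grad u x) b = lim (\<lambda>n. real (Suc n) * (u (x + b /\<^sub>R real (Suc n)) - u x))"
  using assms by (simp add: grad_def inner_sum_left_Basis)

lemma difference_quotient_tendsto:
  fixes u :: "'a::real_normed_vector \<Rightarrow> real"
  assumes "(u has_derivative u') (at x)"
  shows "(\<lambda>n. real (Suc n) * (u (x + v /\<^sub>R real (Suc n)) - u x)) \<longlonglongrightarrow> u' v"
proof -
  have lin: "bounded_linear u'"
    using assms by (rule has_derivative_bounded_linear)
  have "((\<lambda>t. x + t *\<^sub>R v) has_derivative (\<lambda>t. t *\<^sub>R v)) (at 0)"
    by (auto intro!: derivative_eq_intros)
  moreover have "(u has_derivative u') (at (x + 0 *\<^sub>R v))"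
    using assms by simp
  ultimately have "((\<lambda>t. u (x + t *\<^sub>R v)) has_derivative (\<lambda>t. u' (t *\<^sub>R v))) (at (0::real))"
    by (rule has_derivative_compose)
  then have "((\<lambda>t. u (x + t *\<^sub>R v)) has_real_derivative u' v) (at 0)"
    by (rule has_derivative_imp_has_field_derivative)
      (simp add: linear_scale[OF bounded_linear.linear[OF lin]])
  then have "(\<lambda>h. (u (x + (0 + h) *\<^sub>R v) - u (x + 0 *\<^sub>R v)) / h) \<midarrow>0\<rightarrow> u' v"
    by (simp add: DERIV_def)
  moreover have "filterlim (\<lambda>n. inverse (real (Suc n))) (at 0) sequentially"
    by (intro filterlim_atI LIMSEQ_inverse_real_of_nat) auto
  ultimately have "(\<lambda>n. (u (x + (0 + inverse (real (Suc n))) *\<^sub>R v) - u (x + 0 *\<^sub>R v)) / inverse (real (Suc n))) \<longlonglongrightarrow> u' v"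
    by (rule filterlim_compose)
  then show ?thesis
    by (simp add: divide_inverse mult.commute del: of_nat_Suc)
qed

lemma inner_grad_eq:
  assumes "(u has_derivative u') (at x)" "b \<in> Basis"
  shows "inner (grad u x) b = u' b"
  unfolding inner_grad[OF assms(2)] using difference_quotient_tendsto[OF assms(1)] by (rule limI)

lemma grad_eqI:
  assumes "(u has_derivative (\<lambda>h. inner g h)) (at x)"
  shows "grad u x = g"
  by (rule euclidean_eqI) (simp add: inner_grad_eq[OF assms])

lemma lipschitz_imp_borel_measurable:
  "L-lipschitz_on UNIV u \<Longrightarrow> u \<in> borel_measurable borel"
  by (intro borel_measurable_continuous_onI lipschitz_on_continuous_on)

lemma grad_measurable:
  assumes "L-lipschitz_on UNIV u" "b \<in> Basis"
  shows "(\<lambda>x. inner (grad u x) b) \<in> borel_measurable borel"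
proof -
  note [measurable] = lipschitz_imp_borel_measurable[OF assms(1)]
  show ?thesis
    unfolding inner_grad[OF assms(2)] by measurable
qed

lemma lipschitz_difference_quotient_bound:
  assumes "L-lipschitz_on UNIV (u :: 'a::real_normed_vector \<Rightarrow> real)" "t > 0"
  shows "\<bar>t * (u (x + v /\<^sub>R t) - u x)\<bar> \<le> L * norm v"
proof -
  have "\<bar>u (x + v /\<^sub>R t) - u x\<bar> \<le> L * (norm v / t)"
    using lipschitz_onD[OF assms(1), of "x + v /\<^sub>R t" x] assms(2)
    by (simp add: dist_norm divide_inverse mult.commute)
  then have "t * \<bar>u (x + v /\<^sub>R t) - u x\<bar> \<le> t * (L * (norm v / t))"
    using assms(2) by (intro mult_left_mono) auto
  then show ?thesis
    using assms(2) by (simp add: abs_mult)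
qed

lemma inner_grad_bound:
  assumes "L-lipschitz_on UNIV u" "u differentiable (at x)" "b \<in> Basis"
  shows "\<bar>inner (grad u x) b\<bar> \<le> L"
proof -
  obtain u' where u': "(u has_derivative u') (at x)"
    using assms(2) by (auto simp: differentiable_def)
  have "(\<lambda>n. \<bar>real (Suc n) * (u (x + b /\<^sub>R real (Suc n)) - u x)\<bar>) \<longlonglongrightarrow> \<bar>u' b\<bar>"
    by (intro tendsto_rabs difference_quotient_tendsto u')
  moreover have "\<bar>real (Suc n) * (u (x + b /\<^sub>R real (Suc n)) - u x)\<bar> \<le> L" for n
    using lipschitz_difference_quotient_bound[OF assms(1), of "real (Suc n)" x b] assms(3) by simp
  ultimately have "\<bar>u' b\<bar> \<le> L"
    by (intro LIMSEQ_le_const2) auto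
  then show ?thesis
    using inner_grad_eq[OF u' assms(3)] by simp
qed

lemma integral_lborel_translation:
  fixes u :: "'a::euclidean_space \<Rightarrow> real"
  assumes "u \<in> borel_measurable borel"
  shows "(\<integral>x. u (x + c) \<partial>lborel) = (\<integral>x. u x \<partial>lborel)"
proof -
  have "(\<integral>x. u x \<partial>distr lborel borel ((+) c)) = (\<integral>x. u (c + x) \<partial>lborel)"
    by (rule integral_distr) (use assms in auto)
  then show ?thesis
    by (simp add: lborel_distr_plus add.commute)
qed

lemma integral_lebesgue_on_eq_lborel:
  fixes u :: "'a::euclidean_space \<Rightarrow> real"
  assumes "\<Omega> \<in> sets lebesgue" "u \<in> borel_measurable borel" "\<And>x. x \<notin> \<Omega> \<Longrightarrow> u x = 0"
  shows "(\<integral>x. u x \<partial>lebesgue_on \<Omega>) = (\<integral>x. u x \<partial>lborel)"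
proof -
  have "(\<integral>x. u x \<partial>lebesgue_on \<Omega>) = (\<integral>x. (if x \<in> \<Omega> then u x else 0) \<partial>lebesgue)"
    using assms(1) by (simp add: Lebesgue_Measure.integral_restrict_UNIV)
  also have "\<dots> = (\<integral>x. u x \<partial>lebesgue)"
    using assms(3) by (intro Bochner_Integration.integral_cong) auto
  also have "\<dots> = (\<integral>x. u x \<partial>lborel)"
    using assms(2) by (intro integral_completion) simp
  finally show ?thesis .
qed

lemma integrable_lborel_compact_support:
  fixes u :: "'a::euclidean_space \<Rightarrow> real"
  assumes "continuous_on UNIV u" "compact K" "\<And>x. x \<notin> K \<Longrightarrow> u x = 0"
  shows "integrable lborel u"
proof -
  have "integrable lborel (\<lambda>x. indicator K x *\<^sub>R u x)"
    using assms(1,2) continuous_on_subset by (intro borel_integrable_compact) blast+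
  moreover have "(\<lambda>x. indicator K x *\<^sub>R u x) = u"
    using assms(3) by (auto simp: indicator_def fun_eq_iff)
  ultimately show ?thesis
    by simp
qed

text \<open>The mean value theorem along the direction \<open>v\<close>. It bounds the backward
  difference quotients of a test function uniformly, which provides the dominating function
  below.\<close>

lemma directional_lipschitz:
  fixes u :: "'a::real_normed_vector \<Rightarrow> real"
  assumes "\<And>x. (u has_derivative u' x) (at x)" "\<And>x. \<bar>u' x v\<bar> \<le> B" "t > 0"
  shows "\<bar>u x - u (x - v /\<^sub>R t)\<bar> \<le> B / t"
proof -
  have "((\<lambda>s. u (x - v /\<^sub>R t + s *\<^sub>R v)) has_real_derivative u' (x - v /\<^sub>R t + s *\<^sub>R v) v) (at s)" for s :: real
  proof -
    have "((\<lambda>s. x - v /\<^sub>R t + s *\<^sub>R v) has_derivative (\<lambda>h. h *\<^sub>R v)) (at s)"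
      by (auto intro!: derivative_eq_intros)
    from has_derivative_compose[OF this assms(1)] show ?thesis
      by (rule has_derivative_imp_has_field_derivative)
        (simp add: linear_scale[OF has_derivative_linear[OF assms(1)]])
  qed
  then obtain z where "u (x - v /\<^sub>R t + (1 / t) *\<^sub>R v) - u (x - v /\<^sub>R t + 0 *\<^sub>R v) =
      (1 / t - 0) * u' (x - v /\<^sub>R t + z *\<^sub>R v) v"
    using MVT2[of 0 "1 / t" "\<lambda>s. u (x - v /\<^sub>R t + s *\<^sub>R v)" "\<lambda>s. u' (x - v /\<^sub>R t + s *\<^sub>R v) v"] assms(3)
    by auto
  then have "\<bar>u x - u (x - v /\<^sub>R t)\<bar> = \<bar>u' (x - v /\<^sub>R t + z *\<^sub>R v) v\<bar> / t"
    using assms(3) by (simp add: divide_inverse abs_mult mult.commute)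
  then show ?thesis
    using assms(2,3) by (simp add: divide_right_mono)
qed

text \<open>Integration by parts for Lipschitz functions: move the difference quotient from \<open>u\<close> to the
  test function by translation invariance, and pass to the limit on both sides.\<close>

lemma lipschitz_has_weak_gradient:
  assumes \<Omega>: "open \<Omega>" "bounded \<Omega>"
    and u: "L-lipschitz_on UNIV u" "negligible N" "\<And>x. x \<notin> N \<Longrightarrow> u differentiable (at x)"
  shows "has_weak_gradient \<Omega> u (grad u)"
  unfolding has_weak_gradient_def
proof (intro ballI conjI)
  fix b :: "real^2" assume b: "b \<in> Basis"
  note L = open_bounded_lmeasurable[OF \<Omega>]
  note grad_measurable[OF u(1) b, measurable]
  note lipschitz_imp_borel_measurable[OF u(1), measurable]
  have "AE x in lebesgue_on \<Omega>. \<bar>inner (grad u x) b\<bar> \<le> L"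
    using inner_grad_bound[OF u(1) u(3) b] by (intro AE_lebesgue_onI[OF L(2) u(2)])
  then show "(\<lambda>x. inner (grad u x) b) \<in> L2 \<Omega>"
    by (intro L2_bounded[OF L(1)] borel_measurable_lebesgue_on) auto
  fix \<phi> assume \<phi>: "\<phi> \<in> test_functions \<Omega>"
  define \<psi> where "\<psi> x = frechet_derivative \<phi> (at x) b" for x
  have \<phi>C: "continuous_on UNIV \<phi>" and \<psi>C: "continuous_on UNIV \<psi>"
    using test_functions_deriv(2,3)[OF \<phi>] b by (auto simp: \<psi>_def[abs_def])
  then have [measurable]: "\<phi> \<in> borel_measurable borel" "\<psi> \<in> borel_measurable borel"
    by (auto intro: borel_measurable_continuous_onI)
  have uC: "continuous_on UNIV u"
    by (rule lipschitz_on_continuous_on[OF u(1)])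
  obtain K where K: "compact K" "K \<subseteq> \<Omega>" "\<forall>x. x \<notin> K \<longrightarrow> \<phi> x = 0" "\<forall>x. x \<notin> K \<longrightarrow> \<psi> x = 0"
    using test_functions_compact_support[OF \<phi>] unfolding \<psi>_def by blast
  obtain R where R: "\<forall>x\<in>K. norm x \<le> R"
    using K(1) compact_imp_bounded bounded_iff by blast
  \<comment> \<open>The shifts \<open>b /\<^sub>R real (Suc n)\<close> have length at most one, so
    the margin \<open>1\<close> makes the test function and all of its shifts vanish off
    \<open>Q\<close>.\<close>
  define Q :: "(real^2) set" where "Q = cball 0 (R + 1)"
  have Q: "compact Q"
    by (simp add: Q_def)
  have KQ: "\<phi> x = 0" "\<phi> (x - b /\<^sub>R real (Suc n)) = 0" "\<psi> x = 0" if "x \<notin> Q" for x n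
  proof -
    have "norm (x - b /\<^sub>R real (Suc n)) \<ge> norm x - norm (b /\<^sub>R real (Suc n))"
      by (rule norm_triangle_ineq2)
    moreover have "norm (b /\<^sub>R real (Suc n)) \<le> 1"
      using b by (simp add: divide_simps)
    ultimately have "x \<notin> K" "x - b /\<^sub>R real (Suc n) \<notin> K"
      using that R by (force simp: Q_def)+
    then show "\<phi> x = 0" "\<phi> (x - b /\<^sub>R real (Suc n)) = 0" "\<psi> x = 0"
      using K by auto
  qed
  obtain B where B: "B \<ge> 0" "\<forall>x. \<bar>\<phi> x\<bar> \<le> B"
    using test_functions_bounded[OF \<phi>] by blast
  obtain B' where B': "B' \<ge> 0" "\<forall>x. \<bar>\<psi> x\<bar> \<le> B'"
    using bounded_if_compact_support[OF \<psi>C Q KQ(3)] by blast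
  have "compact (u ` Q)"
    using uC Q compact_continuous_image continuous_on_subset by blast
  then obtain M where M: "\<forall>x\<in>Q. \<bar>u x\<bar> \<le> M"
    by (metis bounded_pos compact_imp_bounded imageI real_norm_def)
  have L0: "L \<ge> 0"
    using u(1) by (rule lipschitz_on_nonneg)
  have indQ: "integrable lborel (\<lambda>x. c * indicator Q x :: real)" for c
    using Q by (intro integrable_mult_right integrable_real_indicator)
      (auto simp: compact_imp_closed emeasure_compact_finite[unfolded infinity_ennreal_def])
  define q where "q n x = real (Suc n) * (u (x + b /\<^sub>R real (Suc n)) - u x)" for n x
  \<comment> \<open>A backward quotient: translating the integral moves the forward quotient of
    \<open>u\<close> onto the test function as a backward one, with the opposite sign.\<close>
  define p where "p n x = real (Suc n) * (\<phi> x - \<phi> (x - b /\<^sub>R real (Suc n)))" for n x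
  have [measurable]: "q n \<in> borel_measurable borel" "p n \<in> borel_measurable borel" for n
    unfolding q_def[abs_def] p_def[abs_def] by measurable
  have lim1: "(\<lambda>n. \<integral>x. q n x * \<phi> x \<partial>lborel) \<longlonglongrightarrow> (\<integral>x. inner (grad u x) b * \<phi> x \<partial>lborel)"
  proof (rule integral_dominated_convergence[where w="\<lambda>x. (L * B) * indicator Q x"])
    show "AE x in lborel. (\<lambda>n. q n x * \<phi> x) \<longlonglongrightarrow> inner (grad u x) b * \<phi> x"
    proof -
      have "AE x in lebesgue. (\<lambda>n. q n x * \<phi> x) \<longlonglongrightarrow> inner (grad u x) b * \<phi> x"
      proof (rule AE_I'[where N=N])
        show "{x \<in> space lebesgue. \<not> (\<lambda>n. q n x * \<phi> x) \<longlonglongrightarrow> inner (grad u x) b * \<phi> x} \<subseteq> N"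
        proof clarify
          fix x assume nl: "\<not> (\<lambda>n. q n x * \<phi> x) \<longlonglongrightarrow> inner (grad u x) b * \<phi> x"
          show "x \<in> N"
          proof (rule ccontr)
            assume "x \<notin> N"
            then obtain u' where u': "(u has_derivative u') (at x)"
              using u(3) by (auto simp: differentiable_def)
            then have "(\<lambda>n. q n x * \<phi> x) \<longlonglongrightarrow> u' b * \<phi> x"
              unfolding q_def by (intro tendsto_intros difference_quotient_tendsto)
            then show False
              using nl inner_grad_eq[OF u' b] by simp
          qed
        qed
      qed (use u(2) negligible_iff_null_sets in auto)
      then show ?thesis
        by (simp add: AE_completion_iff)
    qed
    show "AE x in lborel. norm (q n x * \<phi> x) \<le> (L * B) * indicator Q x" for n
    proof (rule AE_I2)
      fix x
      have "\<bar>q n x\<bar> \<le> L"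
        using lipschitz_difference_quotient_bound[OF u(1), of "real (Suc n)" x b] b by (simp add: q_def)
      then show "norm (q n x * \<phi> x) \<le> (L * B) * indicator Q x"
        using B L0 KQ(1)[of x] by (cases "x \<in> Q") (auto simp: abs_mult intro!: mult_mono)
    qed
  qed (use indQ in auto)
  have lim2: "(\<lambda>n. \<integral>x. u x * p n x \<partial>lborel) \<longlonglongrightarrow> (\<integral>x. u x * \<psi> x \<partial>lborel)"
  proof (rule integral_dominated_convergence[where w="\<lambda>x. (M * B') * indicator Q x"])
    show "AE x in lborel. (\<lambda>n. u x * p n x) \<longlonglongrightarrow> u x * \<psi> x"
    proof (intro AE_I2 tendsto_intros)
      fix x
      have lin: "linear (frechet_derivative \<phi> (at x))"
        using test_functions_deriv(1)[OF \<phi>] has_derivative_linear by blast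
      have "(\<lambda>n. - (real (Suc n) * (\<phi> (x + (- b) /\<^sub>R real (Suc n)) - \<phi> x))) \<longlonglongrightarrow>
          - frechet_derivative \<phi> (at x) (- b)"
        by (intro tendsto_minus difference_quotient_tendsto test_functions_deriv(1)[OF \<phi>])
      then show "(\<lambda>n. p n x) \<longlonglongrightarrow> \<psi> x"
        by (simp add: p_def \<psi>_def linear_neg[OF lin] algebra_simps del: of_nat_Suc)
    qed
    show "AE x in lborel. norm (u x * p n x) \<le> (M * B') * indicator Q x" for n
    proof (rule AE_I2)
      fix x
      have "\<bar>\<phi> x - \<phi> (x - b /\<^sub>R real (Suc n))\<bar> \<le> B' / real (Suc n)"
        using test_functions_deriv(1)[OF \<phi>] B'(2) unfolding \<psi>_def
        by (intro directional_lipschitz) auto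
      then have "\<bar>p n x\<bar> \<le> B'"
        unfolding p_def by (simp add: abs_mult pos_le_divide_eq mult.commute del: of_nat_Suc)
      then show "norm (u x * p n x) \<le> (M * B') * indicator Q x"
      proof (cases "x \<in> Q")
        case True
        then have "\<bar>u x\<bar> \<le> M"
          using M by simp
        then have "\<bar>u x\<bar> * \<bar>p n x\<bar> \<le> M * B'"
          using \<open>\<bar>p n x\<bar> \<le> B'\<close> by (intro mult_mono) auto
        then show ?thesis
          using True by (simp add: abs_mult)
      next
        case False
        then have "p n x = 0"
          using KQ(1,2)[OF False] by (simp add: p_def)
        then show ?thesis
          using False by simp
      qed
    qed
  qed (use indQ in auto)
  have "(\<integral>x. q n x * \<phi> x \<partial>lborel) = - (\<integral>x. u x * p n x \<partial>lborel)" for n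
  proof -
    define h where "h = b /\<^sub>R real (Suc n)"
    have KQh: "\<phi> (x - h) = 0" if "x \<notin> Q" for x
      using KQ(2)[OF that] by (simp add: h_def)
    have i1: "integrable lborel (\<lambda>x. u (x + h) * \<phi> x)"
      by (rule integrable_lborel_compact_support[OF _ Q])
        (use KQ(1) in \<open>auto intro!: continuous_intros \<phi>C continuous_on_compose2[OF uC]\<close>)
    have i2: "integrable lborel (\<lambda>x. u x * \<phi> x)"
      by (rule integrable_lborel_compact_support[OF _ Q])
        (use KQ(1) in \<open>auto intro!: continuous_intros \<phi>C uC\<close>)
    have i3: "integrable lborel (\<lambda>x. u x * \<phi> (x - h))"
      by (rule integrable_lborel_compact_support[OF _ Q])
        (use KQh in \<open>auto intro!: continuous_intros uC continuous_on_compose2[OF \<phi>C]\<close>)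
    have "(\<integral>x. u (x + h) * \<phi> x \<partial>lborel) = (\<integral>x. u x * \<phi> (x - h) \<partial>lborel)"
      using integral_lborel_translation[of "\<lambda>x. u x * \<phi> (x - h)" h] by simp
    moreover have "(\<integral>x. q n x * \<phi> x \<partial>lborel) =
        real (Suc n) * ((\<integral>x. u (x + h) * \<phi> x \<partial>lborel) - (\<integral>x. u x * \<phi> x \<partial>lborel))"
      unfolding Bochner_Integration.integral_diff[OF i1 i2, symmetric]
        Bochner_Integration.integral_mult_right_zero[symmetric]
      by (rule Bochner_Integration.integral_cong) (auto simp: q_def h_def algebra_simps)
    moreover have "(\<integral>x. u x * p n x \<partial>lborel) =
        real (Suc n) * ((\<integral>x. u x * \<phi> x \<partial>lborel) - (\<integral>x. u x * \<phi> (x - h) \<partial>lborel))"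
      unfolding Bochner_Integration.integral_diff[OF i2 i3, symmetric]
        Bochner_Integration.integral_mult_right_zero[symmetric]
      by (rule Bochner_Integration.integral_cong) (auto simp: p_def h_def algebra_simps)
    ultimately show ?thesis
      by (simp add: algebra_simps)
  qed
  then have "(\<lambda>n. \<integral>x. q n x * \<phi> x \<partial>lborel) \<longlonglongrightarrow> - (\<integral>x. u x * \<psi> x \<partial>lborel)"
    using tendsto_minus[OF lim2] by simp
  then have eq: "(\<integral>x. inner (grad u x) b * \<phi> x \<partial>lborel) = - (\<integral>x. u x * \<psi> x \<partial>lborel)"
    using lim1 LIMSEQ_unique by blast
  have "(\<integral>x. inner (grad u x) b * \<phi> x \<partial>lebesgue_on \<Omega>) = (\<integral>x. inner (grad u x) b * \<phi> x \<partial>lborel)"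
    using K by (intro integral_lebesgue_on_eq_lborel L) auto
  moreover have "(\<integral>x. u x * \<psi> x \<partial>lebesgue_on \<Omega>) = (\<integral>x. u x * \<psi> x \<partial>lborel)"
    using K by (intro integral_lebesgue_on_eq_lborel L) auto
  ultimately show "L2_prod \<Omega> u (\<lambda>x. frechet_derivative \<phi> (at x) b) = - L2_prod \<Omega> (\<lambda>x. inner (grad u x) b) \<phi>"
    using eq by (simp add: L2_prod_def \<psi>_def)
qed

section \<open>Mollification\<close>

lemma linear_sum_Basis:
  assumes "linear (f :: 'a::euclidean_space \<Rightarrow> real)"
  shows "f h = (\<Sum>b\<in>Basis. inner h b * f b)"
proof -
  have "f h = f (\<Sum>b\<in>Basis. inner h b *\<^sub>R b)"
    by (simp add: euclidean_representation)
  also have "\<dots> = (\<Sum>b\<in>Basis. inner h b * f b)"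
    by (simp add: linear_sum[OF assms] linear_scale[OF assms])
  finally show ?thesis .
qed

text \<open>The variable \<open>x\<close> sits in the smooth kernel only, so differentiation under
  the integral yields a convolution of the same \<open>w\<close> with a derivative of the kernel.
  Hence the induction is over an arbitrary \<open>\<rho>\<close>, and continuity of \<open>w\<close>
  suffices.\<close>

lemma Ck_convolution:
  assumes "Ck k \<rho>" "continuous_on UNIV w"
  shows "Ck k (\<lambda>x. integral (cbox a c) (\<lambda>t. \<rho> (t - x) * w t))"
  using assms(1)
proof (induction k arbitrary: \<rho>)
  case 0
  then have c: "continuous_on UNIV \<rho>"
    by simp
  have "continuous_on (UNIV \<times> cbox a c) (\<lambda>(x, t). \<rho> (t - x) * w t)"
    unfolding case_prod_unfold
    by (intro continuous_intros continuous_on_compose2[OF c] continuous_on_compose2[OF assms(2)]) auto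
  then show ?case
    by (simp add: integral_continuous_on_param)
next
  case (Suc k)
  \<comment> \<open>The factor \<open>- 1\<close> is the inner derivative of \<open>t - x\<close> in
    \<open>x\<close>; as an explicit product it falls under \<open>Ck_mult\<close>.\<close>
  define \<rho>' where "\<rho>' b y = - 1 * frechet_derivative \<rho> (at y) b" for b y
  have \<rho>C: "continuous_on UNIV \<rho>"
    using Ck_imp_continuous Suc.prems by blast
  have \<rho>'k: "Ck k (\<rho>' b)" if "b \<in> Basis" for b
    unfolding \<rho>'_def[abs_def] by (rule Ck_mult[OF Ck_const Ck_SucD(2)[OF Suc.prems that]])
  then have \<rho>'C: "continuous_on UNIV (\<rho>' b)" if "b \<in> Basis" for b
    using that Ck_imp_continuous by blast
  \<comment> \<open>\<open>leibniz_rule\<close> takes the derivative as a bounded linear map that is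
    jointly continuous in \<open>x\<close> and \<open>t\<close>, so it is assembled from the partial
    derivatives.\<close>
  define F :: "real^2 \<Rightarrow> real^2 \<Rightarrow> (real^2) \<Rightarrow>\<^sub>L real" where
    "F x t = (\<Sum>b\<in>Basis. (\<rho>' b (t - x) * w t) *\<^sub>R blinfun_inner_left b)" for x t
  have FC: "continuous_on (UNIV \<times> cbox a c) (\<lambda>(x, t). F x t)"
    unfolding F_def case_prod_unfold
    by (intro continuous_intros continuous_on_compose2[OF \<rho>'C] continuous_on_compose2[OF assms(2)]) auto
  have Fi: "F x integrable_on cbox a c" for x
    unfolding F_def
    by (intro integrable_continuous continuous_intros continuous_on_compose2[OF \<rho>'C]
        continuous_on_compose2[OF assms(2)]) auto
  have D: "((\<lambda>x. integral (cbox a c) (\<lambda>t. \<rho> (t - x) * w t)) has_derivative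
      blinfun_apply (integral (cbox a c) (F x))) (at x)" for x
  proof (rule leibniz_rule[where U=UNIV, simplified])
    show "((\<lambda>x. \<rho> (t - x) * w t) has_derivative blinfun_apply (F x t)) (at x)" for x t
    proof -
      have lin: "linear (frechet_derivative \<rho> (at (t - x)))"
        using Ck_SucD(1)[OF Suc.prems] by (rule has_derivative_linear)
      have "((\<lambda>x. t - x) has_derivative (\<lambda>h. - h)) (at x)"
        by (auto intro!: derivative_eq_intros)
      from has_derivative_compose[OF this Ck_SucD(1)[OF Suc.prems]]
      have "((\<lambda>x. \<rho> (t - x) * w t) has_derivative
          (\<lambda>h. frechet_derivative \<rho> (at (t - x)) (- h) * w t)) (at x)"
        by (rule has_derivative_mult_left)
      moreover have "frechet_derivative \<rho> (at (t - x)) (- h) * w t = blinfun_apply (F x t) h" for h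
      proof -
        have "blinfun_apply (F x t) h = (\<Sum>b\<in>Basis. \<rho>' b (t - x) * w t * inner h b)"
          by (simp add: F_def blinfun.sum_left blinfun.scaleR_left blinfun_inner_left.rep_eq)
        also have "\<dots> = - (\<Sum>b\<in>Basis. inner h b * frechet_derivative \<rho> (at (t - x)) b) * w t"
          by (simp add: \<rho>'_def sum_distrib_left sum_negf[symmetric] algebra_simps)
        finally show ?thesis
          by (simp add: linear_neg[OF lin] linear_sum_Basis[OF lin, of h])
      qed
      ultimately show ?thesis
        by simp
    qed
    show "(\<lambda>t. \<rho> (t - x) * w t) integrable_on cbox a c" for x
      by (intro integrable_continuous continuous_intros continuous_on_compose2[OF \<rho>C]
        continuous_on_compose2[OF assms(2)]) auto
  qed (use FC in auto)
  show ?case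
  proof (rule Ck_SucI[OF D])
    fix b :: "real^2" assume b: "b \<in> Basis"
    have "blinfun_apply (F x t) b = \<rho>' b (t - x) * w t" for x t
    proof -
      have "blinfun_apply (F x t) b = (\<Sum>b'\<in>Basis. \<rho>' b' (t - x) * w t * inner b b')"
        by (simp add: F_def blinfun.sum_left blinfun.scaleR_left blinfun_inner_left.rep_eq)
      also have "\<dots> = (\<Sum>b'\<in>Basis. if b' = b then \<rho>' b (t - x) * w t else 0)"
        using b by (intro sum.cong) (auto simp: inner_Basis)
      finally show ?thesis
        using b by simp
    qed
    then show "Ck k (\<lambda>x. blinfun_apply (integral (cbox a c) (F x)) b)"
      using Suc.IH[OF \<rho>'k[OF b]] by (simp add: blinfun_apply_integral[OF Fi])
  qed
qed

definition mollifier :: "real \<Rightarrow> (real^2 \<Rightarrow> real) \<Rightarrow> bool" where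
  "mollifier \<delta> \<rho> \<longleftrightarrow> (\<forall>k. Ck k \<rho>) \<and> (\<forall>s. \<rho> s \<ge> 0) \<and> (\<forall>s. norm s > \<delta> \<longrightarrow> \<rho> s = 0) \<and> (\<integral>s. \<rho> s \<partial>lborel) = 1"

lemma mollifier_exists:
  assumes "\<delta> > 0"
  shows "\<exists>\<rho>. mollifier \<delta> \<rho>"
proof -
  \<comment> \<open>In the plane the norm is at most the sum of two coordinates, so half-sides
    \<open>\<delta> / 2\<close> keep the box inside the ball of radius
    \<open>\<delta>\<close>.\<close>
  define e :: "real^2" where "e = (\<delta> / 2) *\<^sub>R One"
  define \<beta> where "\<beta> = bump (- e) e 1"
  have \<beta>k: "Ck k \<beta>" for k
    unfolding \<beta>_def by (rule Ck_bump)
  have nonneg: "\<beta> s \<ge> 0" for s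
    unfolding \<beta>_def by (rule bump_nonneg)
  have zero: "\<beta> s = 0" if "norm s > \<delta>" for s
  proof -
    have "s \<notin> box (- e) e"
    proof
      assume "s \<in> box (- e) e"
      then have "\<bar>inner s b\<bar> \<le> \<delta> / 2" if "b \<in> Basis" for b
        using that by (force simp: mem_box e_def)
      then have "(\<Sum>b\<in>Basis. \<bar>inner s b\<bar>) \<le> (\<Sum>b\<in>(Basis :: (real^2) set). \<delta> / 2)"
        by (rule sum_mono)
      then show False
        using norm_le_l1[of s] that by simp
    qed
    then show ?thesis
      by (simp add: \<beta>_def bump_eq_0)
  qed
  have int: "integrable lborel \<beta>"
    by (rule integrable_lborel_compact_support[of _ "cball 0 \<delta>"])
      (use zero Ck_imp_continuous[OF \<beta>k[of 0]] in auto)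
  \<comment> \<open>A nonnegative continuous function with integral zero vanishes everywhere, but
    the bump is positive at the centre \<open>0\<close>.\<close>
  have "(\<integral>s. \<beta> s \<partial>lborel) \<noteq> 0"
  proof
    assume "(\<integral>s. \<beta> s \<partial>lborel) = 0"
    then have "AE s in lborel. \<beta> s = 0"
      using integral_nonneg_eq_0_iff_AE[OF int] nonneg by simp
    then have "AE s in lebesgue. s \<in> {s. \<beta> s = 0}"
      by (simp add: AE_completion)
    moreover have "closed {s. \<beta> s = 0}"
      by (intro closed_Collect_eq continuous_on_const Ck_imp_continuous[OF \<beta>k[of 0]])
    ultimately have "\<beta> 0 = 0"
      using mem_closed_if_AE_lebesgue by blast
    moreover have "\<beta> 0 > 0"
      unfolding \<beta>_def using assms by (intro bump_pos) (auto simp: mem_box e_def)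
    ultimately show False
      by simp
  qed
  moreover have "(\<integral>s. \<beta> s \<partial>lborel) \<ge> 0"
    by (simp add: nonneg)
  ultimately have pos: "(\<integral>s. \<beta> s \<partial>lborel) > 0"
    by simp
  have "mollifier \<delta> (\<lambda>s. inverse (\<integral>s. \<beta> s \<partial>lborel) * \<beta> s)"
    using pos Ck_mult[OF Ck_const \<beta>k] nonneg zero
    unfolding mollifier_def by (auto intro: less_imp_le)
  then show ?thesis
    by blast
qed

text \<open>An average against a probability density stays as close to \<open>k\<close> as the
  averaged values do. It is used with \<open>k = 0\<close> for Lipschitz bounds, with a point value
  as \<open>k\<close> for closeness and integrability, and with \<open>C = 0\<close> for exact
  evaluation.\<close>

lemma mollifier_average_bound:
  assumes "mollifier \<delta> \<rho>" "continuous_on UNIV F" "\<And>s. norm s \<le> \<delta> \<Longrightarrow> \<bar>F s - k\<bar> \<le> C"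
  shows "integrable lborel (\<lambda>s. \<rho> s * F s)" "\<bar>(\<integral>s. \<rho> s * F s \<partial>lborel) - k\<bar> \<le> C"
proof -
  have \<rho>: "continuous_on UNIV \<rho>" "\<And>s. \<rho> s \<ge> 0" "\<And>s. s \<notin> cball 0 \<delta> \<Longrightarrow> \<rho> s = 0" "(\<integral>s. \<rho> s \<partial>lborel) = 1"
    using assms(1) Ck_imp_continuous[of 0 \<rho>] by (auto simp: mollifier_def)
  show i1: "integrable lborel (\<lambda>s. \<rho> s * F s)"
    by (rule integrable_lborel_compact_support[of _ "cball 0 \<delta>"])
      (use \<rho> in \<open>auto intro!: continuous_intros assms(2)\<close>)
  have i0: "integrable lborel \<rho>"
    by (rule integrable_lborel_compact_support[of _ "cball 0 \<delta>"]) (use \<rho> in auto)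
  have i2: "integrable lborel (\<lambda>s. \<rho> s * (F s - k))"
    using i0 i1 by (simp add: right_diff_distrib)
  have "(\<integral>s. \<rho> s * F s \<partial>lborel) - k = (\<integral>s. \<rho> s * (F s - k) \<partial>lborel)"
    using i0 i1 \<rho>(4) by (simp add: right_diff_distrib)
  also have "\<bar>\<dots>\<bar> \<le> (\<integral>s. \<bar>\<rho> s * (F s - k)\<bar> \<partial>lborel)"
    by (rule integral_abs_bound)
  also have "\<dots> \<le> (\<integral>s. \<rho> s * C \<partial>lborel)"
  proof (rule integral_mono)
    show "integrable lborel (\<lambda>s. \<bar>\<rho> s * (F s - k)\<bar>)"
      using i2 by (rule integrable_abs)
    show "integrable lborel (\<lambda>s. \<rho> s * C)"
      using i0 by simp
    show "\<bar>\<rho> s * (F s - k)\<bar> \<le> \<rho> s * C" for s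
      using \<rho>(2)[of s] \<rho>(3)[of s] assms(3)[of s]
      by (cases "norm s \<le> \<delta>") (auto simp: abs_mult intro: mult_left_mono)
  qed
  also have "\<dots> = C"
    using \<rho>(4) by simp
  finally show "\<bar>(\<integral>s. \<rho> s * F s \<partial>lborel) - k\<bar> \<le> C" .
qed

lemma mollifier_average_eq:
  assumes "mollifier \<delta> \<rho>" "continuous_on UNIV F" "\<And>s. norm s \<le> \<delta> \<Longrightarrow> F s = k"
  shows "(\<integral>s. \<rho> s * F s \<partial>lborel) = k"
  using mollifier_average_bound(2)[OF assms(1,2), of k 0] assms(3) by simp

text \<open>The left side shows smoothness in \<open>x\<close>; the right side is an average of
  translates of \<open>w\<close>, which passes on Lipschitz bounds and local affinity.\<close>

lemma convolution_eq_average: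
  fixes \<rho> w :: "'a::euclidean_space \<Rightarrow> real"
  assumes \<rho>: "continuous_on UNIV \<rho>" and w: "continuous_on UNIV w" "\<And>t. t \<notin> cbox a c \<Longrightarrow> w t = 0"
  shows "integral (cbox a c) (\<lambda>t. \<rho> (t - x) * w t) = (\<integral>s. \<rho> s * w (s + x) \<partial>lborel)"
proof -
  have cont: "continuous_on UNIV (\<lambda>t. \<rho> (t - x) * w t)"
    by (intro continuous_intros w(1) continuous_on_compose2[OF \<rho>]) auto
  have "integral (cbox a c) (\<lambda>t. \<rho> (t - x) * w t) =
      integral UNIV (\<lambda>t. if t \<in> cbox a c then \<rho> (t - x) * w t else 0)"
    by (rule Henstock_Kurzweil_Integration.integral_restrict_UNIV[symmetric])
  also have "(\<lambda>t. if t \<in> cbox a c then \<rho> (t - x) * w t else 0) = (\<lambda>t. \<rho> (t - x) * w t)"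
    using w(2) by auto
  also have "integral UNIV (\<lambda>t. \<rho> (t - x) * w t) = (\<integral>t. \<rho> (t - x) * w t \<partial>lborel)"
    by (rule integral_lborel, rule integrable_lborel_compact_support[OF cont, of "cbox a c"])
      (use w(2) in auto)
  also have "\<dots> = (\<integral>s. \<rho> s * w (s + x) \<partial>lborel)"
    using integral_lborel_translation[of "\<lambda>t. \<rho> (t - x) * w t" x]
      borel_measurable_continuous_onI[OF cont] by simp
  finally show ?thesis .
qed

section \<open>Approximation by test functions\<close>

lemma has_derivative_affine:
  "((\<lambda>y. k + inner g (y - x)) has_derivative (\<lambda>h. inner g h)) (at (x :: 'a::real_inner))"
proof -
  have "((\<lambda>y. inner g y + (k - inner g x)) has_derivative (\<lambda>h. inner g h)) (at x)"
    by (intro has_derivative_add_const bounded_linear_imp_has_derivative bounded_linear_inner_right)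
  then show ?thesis
    by (simp add: inner_diff_right algebra_simps)
qed

text \<open>The number \<open>e\<close> serves both as cut-off level and as length scale. Since
  \<open>v\<close> vanishes off \<Omega>, the set where \<open>v \<ge> e\<close> is a compact part
  of \<Omega>, and a fine enough mollification of the cut-off function keeps its support in
  \<Omega>. The last two clauses say where the gradient survives exactly: near zeros of
  \<open>v\<close> the cut-off function is zero, and where \<open>v \<ge> e\<close> only a constant
  has been subtracted.\<close>

lemma smooth_approximation:
  assumes \<Omega>: "open \<Omega>" "bounded \<Omega>" and v: "L-lipschitz_on UNIV v" "\<And>x. v x \<ge> 0" "\<And>x. x \<notin> \<Omega> \<Longrightarrow> v x = 0"
    and e: "e > 0"
  shows "\<exists>\<phi>\<in>test_functions \<Omega>. L-lipschitz_on UNIV \<phi> \<and> (\<forall>x. \<bar>v x - \<phi> x\<bar> \<le> (L + 1) * e) \<and>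
    (\<forall>x. (\<forall>y\<in>ball x (2 * e). v y = 0) \<longrightarrow> (\<phi> has_derivative (\<lambda>h. 0)) (at x)) \<and>
    (\<forall>x g. (\<forall>y\<in>ball x (2 * e). v y \<ge> e \<and> v y = v x + inner g (y - x)) \<longrightarrow>
       (\<phi> has_derivative (\<lambda>h. inner g h)) (at x))"
proof -
  have L0: "L \<ge> 0"
    using v(1) by (rule lipschitz_on_nonneg)
  have vC: "continuous_on UNIV v"
    by (rule lipschitz_on_continuous_on[OF v(1)])
  define w where "w x = max (v x - e) 0" for x
  have wl: "L-lipschitz_on UNIV w"
  proof (rule lipschitz_onI[OF _ L0])
    fix x y
    have "\<bar>w x - w y\<bar> \<le> \<bar>v x - v y\<bar>"
      by (auto simp: w_def max_def)
    then show "dist (w x) (w y) \<le> L * dist x y"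
      using lipschitz_onD[OF v(1), of x y] by (simp add: dist_real_def)
  qed
  have wC: "continuous_on UNIV w"
    by (rule lipschitz_on_continuous_on[OF wl])
  define C where "C = {x. v x \<ge> e}"
  have w0: "w x = 0" if "x \<notin> C" for x
    using that by (simp add: w_def C_def)
  have C\<Omega>: "C \<subseteq> \<Omega>"
    using v(3) e by (force simp: C_def)
  have "closed C"
    unfolding C_def by (intro closed_Collect_le continuous_on_const vC)
  then have C: "compact C"
    using C\<Omega> \<Omega>(2) bounded_subset compact_eq_bounded_closed by blast
  obtain d where d: "d > 0" "\<forall>x\<in>C. \<forall>y\<in>- \<Omega>. d \<le> dist x y"
    using separate_compact_closed[OF C closed_Compl[OF \<Omega>(1)]] C\<Omega> by blast
  \<comment> \<open>Below \<open>d\<close>, the smoothing radius keeps the support inside \<Omega>;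
    below \<open>e\<close>, it yields the error bound and the balls of radius
    \<open>2 * e\<close>.\<close>
  define \<delta> where "\<delta> = min (d / 2) (e / 2)"
  have \<delta>: "\<delta> > 0" "\<delta> < d" "\<delta> < e"
    using d(1) e by (auto simp: \<delta>_def)
  obtain \<rho> where \<rho>: "mollifier \<delta> \<rho>"
    using mollifier_exists[OF \<delta>(1)] by blast
  obtain a where a: "\<Omega> \<subseteq> cbox (- a) a"
    using bounded_subset_cbox_symmetric[OF \<Omega>(2)] by blast
  define \<phi> where "\<phi> x = integral (cbox (- a) a) (\<lambda>t. \<rho> (t - x) * w t)" for x
  have \<rho>C: "continuous_on UNIV \<rho>"
    using \<rho> by (intro Ck_imp_continuous[of 0]) (auto simp: mollifier_def)
  have \<phi>_eq: "\<phi> x = (\<integral>s. \<rho> s * w (s + x) \<partial>lborel)" for x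
    unfolding \<phi>_def using a C\<Omega> w0 by (intro convolution_eq_average \<rho>C wC) blast
  have w_shift: "continuous_on UNIV (\<lambda>s. w (s + x))" for x
    by (intro continuous_on_compose2[OF wC] continuous_intros) auto
  have diff_eq: "\<phi> x - \<phi> y = (\<integral>s. \<rho> s * (w (s + x) - w (s + y)) \<partial>lborel)" for x y
  proof -
    have "integrable lborel (\<lambda>s. \<rho> s * w (s + z))" for z
    proof (rule mollifier_average_bound(1)[OF \<rho> w_shift])
      show "\<bar>w (s + z) - w z\<bar> \<le> L * \<delta>" if "norm s \<le> \<delta>" for s
        using lipschitz_onD[OF wl, of "s + z" z] mult_left_mono[OF that L0] by (simp add: dist_norm)
    qed
    then show ?thesis
      by (simp add: \<phi>_eq right_diff_distrib)
  qed
  have diff_C: "continuous_on UNIV (\<lambda>s. w (s + x) - w (s + y))" for x y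
    by (intro continuous_intros w_shift)
  have tf: "\<phi> \<in> test_functions \<Omega>"
  proof -
    define S where "S = (\<Union>x\<in>C. \<Union>y\<in>cball 0 \<delta>. {x + y})"
    have S: "compact S"
      unfolding S_def by (intro compact_sums' C compact_cball)
    have "\<phi> x = 0" if "x \<notin> S" for x
      unfolding \<phi>_eq
    proof (rule mollifier_average_eq[OF \<rho> w_shift])
      fix s :: "real^2" assume s: "norm s \<le> \<delta>"
      show "w (s + x) = 0"
      proof (rule w0, rule)
        assume "s + x \<in> C"
        moreover have "x = (s + x) + (- s)" "- s \<in> cball 0 \<delta>"
          using s by auto
        ultimately show False
          using that unfolding S_def by blast
      qed
    qed
    then have "{x. \<phi> x \<noteq> 0} \<subseteq> S"
      by blast
    then have cl: "closure {x. \<phi> x \<noteq> 0} \<subseteq> S"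
      by (intro closure_minimal compact_imp_closed S)
    have "S \<subseteq> \<Omega>"
    proof
      fix z assume "z \<in> S"
      then obtain x y where xy: "x \<in> C" "norm y \<le> \<delta>" "z = x + y"
        by (auto simp: S_def)
      show "z \<in> \<Omega>"
      proof (rule ccontr)
        assume "z \<notin> \<Omega>"
        then have "d \<le> dist x z"
          using d(2) xy(1) by blast
        then show False
          using xy \<delta> by (simp add: dist_norm)
      qed
    qed
    moreover have "compact (closure {x. \<phi> x \<noteq> 0})"
      using cl S by (meson bounded_subset closed_closure compact_eq_bounded_closed)
    moreover have "Ck k \<phi>" for k
      unfolding \<phi>_def[abs_def] using \<rho> by (intro Ck_convolution wC) (simp add: mollifier_def)
    ultimately show ?thesis
      using cl by (simp add: test_functions_def)
  qed
  have lip: "L-lipschitz_on UNIV \<phi>"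
  proof (rule lipschitz_onI[OF _ L0])
    fix x y
    have "\<bar>(\<integral>s. \<rho> s * (w (s + x) - w (s + y)) \<partial>lborel) - 0\<bar> \<le> L * dist x y"
    proof (rule mollifier_average_bound(2)[OF \<rho> diff_C])
      show "\<bar>w (s + x) - w (s + y) - 0\<bar> \<le> L * dist x y" for s
        using lipschitz_onD[OF wl, of "s + x" "s + y"] by (simp add: dist_norm)
    qed
    then show "dist (\<phi> x) (\<phi> y) \<le> L * dist x y"
      by (simp add: dist_real_def diff_eq)
  qed
  \<comment> \<open>Averaging costs \<open>L * e\<close> and cutting off costs
    \<open>e\<close>.\<close>
  have close: "\<bar>v x - \<phi> x\<bar> \<le> (L + 1) * e" for x
  proof -
    have "\<bar>\<phi> x - v x\<bar> \<le> (L + 1) * e"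
      unfolding \<phi>_eq
    proof (rule mollifier_average_bound(2)[OF \<rho> w_shift])
      fix s :: "real^2" assume "norm s \<le> \<delta>"
      then have "\<bar>w (s + x) - w x\<bar> \<le> L * e"
        using lipschitz_onD[OF wl, of "s + x" x] mult_left_mono[of "norm s" e L] L0 \<delta>(3)
        by (simp add: dist_norm)
      moreover have "\<bar>w x - v x\<bar> \<le> e"
        using v(2)[of x] e by (auto simp: w_def max_def)
      ultimately show "\<bar>w (s + x) - v x\<bar> \<le> (L + 1) * e"
        by (simp add: algebra_simps)
    qed
    then show ?thesis
      by (simp add: abs_minus_commute)
  qed
  have der: "(\<phi> has_derivative (\<lambda>h. inner g h)) (at x)"
    if w: "\<And>y. y \<in> ball x (2 * e) \<Longrightarrow> w y = w x + inner g (y - x)" for x g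
  proof -
    \<comment> \<open>The smoothing radius is below \<open>e\<close>, so averages at points of
      \<open>ball x e\<close> only see \<open>ball x (2 * e)\<close>. In the difference of the
      averages at \<open>y\<close> and \<open>x\<close> the translates of \<open>w\<close> differ by
      a constant, so no symmetry of \<open>\<rho>\<close> enters.\<close>
    have eq: "\<phi> y = \<phi> x + inner g (y - x)" if y: "y \<in> ball x e" for y
    proof -
      have "(\<integral>s. \<rho> s * (w (s + y) - w (s + x)) \<partial>lborel) = inner g (y - x)"
      proof (rule mollifier_average_eq[OF \<rho> diff_C])
        fix s :: "real^2" assume s: "norm s \<le> \<delta>"
        have "norm (s + y - x) \<le> norm s + norm (y - x)"
          using norm_triangle_ineq[of s "y - x"] by (simp add: algebra_simps)
        then have "s + y \<in> ball x (2 * e)" "s + x \<in> ball x (2 * e)"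
          using s y \<delta>(3) e by (auto simp: dist_norm norm_minus_commute algebra_simps)
        then show "w (s + y) - w (s + x) = inner g (y - x)"
          by (simp add: w inner_simps)
      qed
      then show ?thesis
        using diff_eq[of y x] by simp
    qed
    show ?thesis
      by (rule has_derivative_transform_within_open[OF has_derivative_affine open_ball[of x e] _ eq[symmetric]])
        (use e in \<open>simp only: centre_in_ball\<close>)
  qed
  have der0: "(\<phi> has_derivative (\<lambda>h. 0)) (at x)" if "\<forall>y\<in>ball x (2 * e). v y = 0" for x
  proof -
    have "w y = w x + inner 0 (y - x)" if "y \<in> ball x (2 * e)" for y
      using that \<open>\<forall>y\<in>ball x (2 * e). v y = 0\<close> e by (simp add: w_def)
    from der[OF this] show ?thesis
      by simp
  qed
  have der1: "(\<phi> has_derivative (\<lambda>h. inner g h)) (at x)"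
    if "\<forall>y\<in>ball x (2 * e). v y \<ge> e \<and> v y = v x + inner g (y - x)" for x g
  proof (rule der)
    have x: "v x \<ge> e"
      using bspec[OF that, of x] e by simp
    fix y assume y: "y \<in> ball x (2 * e)"
    have "v y \<ge> e" "v y = v x + inner g (y - x)"
      using bspec[OF that y] by blast+
    then show "w y = w x + inner g (y - x)"
      using x by (simp add: w_def)
  qed
  show ?thesis
  proof (intro bexI[OF _ tf] conjI allI impI)
    show "L-lipschitz_on UNIV \<phi>"
      by (rule lip)
    show "\<bar>v x - \<phi> x\<bar> \<le> (L + 1) * e" for x
      by (rule close)
    show "(\<phi> has_derivative (\<lambda>h. 0)) (at x)" if "\<forall>y\<in>ball x (2 * e). v y = 0" for x
      using that by (rule der0)
    show "(\<phi> has_derivative (\<lambda>h. inner g h)) (at x)"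
      if "\<forall>y\<in>ball x (2 * e). v y \<ge> e \<and> v y = v x + inner g (y - x)" for x g
      using that by (rule der1)
  qed
qed

section \<open>Nonnegative locally affine functions and membership in H^1_0\<close>

definition locally_affine_at :: "(real^2 \<Rightarrow> real) \<Rightarrow> real^2 \<Rightarrow> bool" where
  "locally_affine_at v x \<longleftrightarrow> (\<exists>g r. r > 0 \<and> (\<forall>y\<in>ball x r. v y = v x + inner g (y - x)))"

lemma locally_affine_at_has_derivative:
  assumes "r > 0" "\<forall>y\<in>ball x r. v y = v x + inner g (y - x)"
  shows "(v has_derivative (\<lambda>h. inner g h)) (at x)"
  by (rule has_derivative_transform_within_open[OF has_derivative_affine open_ball[of x r] _ assms(2)[rule_format, symmetric]])
    (use assms(1) in \<open>simp only: centre_in_ball\<close>)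

lemma locally_affine_at_differentiable: "locally_affine_at v x \<Longrightarrow> v differentiable (at x)"
  unfolding locally_affine_at_def using locally_affine_at_has_derivative differentiableI by blast

text \<open>A nonnegative affine function that vanishes at the centre of a ball has slope zero,
  since it would become negative against its gradient; a positive one stays above half of its
  central value nearby. The two alternatives match the derivative clauses of
  \<open>smooth_approximation\<close>.\<close>

lemma locally_affine_nonneg_dichotomy:
  assumes "locally_affine_at v x" "\<And>y. v y \<ge> 0"
  shows "\<exists>g r. r > 0 \<and> ((\<forall>y\<in>ball x r. v y = 0) \<or>
    (\<forall>y\<in>ball x r. v y \<ge> r \<and> v y = v x + inner g (y - x)))"
proof -
  obtain g r where r: "r > 0" "\<forall>y\<in>ball x r. v y = v x + inner g (y - x)"
    using assms(1) by (auto simp: locally_affine_at_def)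
  show ?thesis
  proof (cases "v x = 0")
    case True
    have "g = 0"
    proof (rule ccontr)
      assume g: "g \<noteq> 0"
      define y where "y = x - (r / (2 * norm g)) *\<^sub>R g"
      have "y \<in> ball x r"
        using r(1) g by (simp add: y_def dist_norm)
      then have "v y = - (r / (2 * norm g)) * inner g g"
        using r(2) True by (simp add: y_def)
      moreover have "(r / (2 * norm g)) * inner g g > 0"
        using r(1) g by simp
      ultimately show False
        using assms(2)[of y] by simp
    qed
    then show ?thesis
      using r True by auto
  next
    case False
    then have pos: "v x > 0"
      using assms(2)[of x] by simp
    define K where "K = norm g + 1"
    have K: "K > 0" "norm g \<le> K"
      by (auto simp: K_def intro: add_nonneg_pos)
    \<comment> \<open>The bound \<open>r\<close> keeps the affine formula valid,
      \<open>v x / (2 * K)\<close> limits the loss to half of \<open>v x\<close>, and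
      \<open>v x / 2\<close> lets the radius itself be the lower bound. The summand \<open>1\<close>
      in \<open>K\<close> covers the slope zero.\<close>
    define t where "t = Min {r, v x / (2 * K), v x / 2}"
    have "t \<in> {r, v x / (2 * K), v x / 2}"
      unfolding t_def by (rule Min_in) auto
    then have st: "t > 0"
      using pos r(1) K(1) by auto
    have tle: "t \<le> r" "t \<le> v x / (2 * K)" "t \<le> v x / 2"
      unfolding t_def by (rule Min_le; simp)+
    have aff: "v y = v x + inner g (y - x)" if "y \<in> ball x t" for y
      using bspec[OF r(2), of y] that tle(1) by simp
    have "v y \<ge> t" if y: "y \<in> ball x t" for y
    proof -
      have "\<bar>inner g (y - x)\<bar> \<le> norm g * norm (y - x)"
        by (rule Cauchy_Schwarz_ineq2)
      also have "\<dots> \<le> K * (v x / (2 * K))"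
        using y tle(2) K by (intro mult_mono) (auto simp: dist_norm norm_minus_commute)
      also have "\<dots> = v x / 2"
        using K(1) by simp
      finally have "inner g (y - x) \<ge> - (v x / 2)"
        by simp
      then show ?thesis
        using aff[OF y] tle(3) by simp
    qed
    with st aff show ?thesis
      by blast
  qed
qed

lemma norm_sq_grad_bound:
  assumes "L-lipschitz_on UNIV u" "u differentiable (at x)"
  shows "(norm (grad u x))\<^sup>2 \<le> (2 * L)\<^sup>2"
proof -
  have "norm (grad u x) \<le> (\<Sum>b\<in>(Basis :: (real^2) set). L)"
    by (rule order_trans[OF norm_le_l1 sum_mono]) (rule inner_grad_bound[OF assms])
  then show ?thesis
    by (intro power_mono) auto
qed

lemma norm_sq_eq_sum_Basis: "(norm (g :: 'a::euclidean_space))\<^sup>2 = (\<Sum>b\<in>Basis. (inner g b)\<^sup>2)"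
  unfolding power2_norm_eq_inner by (subst euclidean_inner) (simp add: power2_eq_square)

lemma weak_gradient_measurable:
  assumes "has_weak_gradient \<Omega> u g"
  shows "b \<in> Basis \<Longrightarrow> (\<lambda>x. inner (g x) b) \<in> borel_measurable (lebesgue_on \<Omega>)"
    and "(\<lambda>x. (norm (g x))\<^sup>2) \<in> borel_measurable (lebesgue_on \<Omega>)"
proof -
  show *: "(\<lambda>x. inner (g x) b) \<in> borel_measurable (lebesgue_on \<Omega>)" if "b \<in> Basis" for b
    using assms that by (auto simp: has_weak_gradient_def L2_def)
  show "(\<lambda>x. (norm (g x))\<^sup>2) \<in> borel_measurable (lebesgue_on \<Omega>)"
    unfolding norm_sq_eq_sum_Basis by (intro borel_measurable_sum borel_measurable_power *)
qed

text \<open>Neither cut-off nor mollification enlarges the Lipschitz constant, so the gradients of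
  the errors are uniformly bounded, and pointwise convergence almost everywhere suffices for
  convergence in \<open>H1_norm\<close>.\<close>

lemma lipschitz_in_H10:
  assumes \<Omega>: "open \<Omega>" "bounded \<Omega>" and v: "L-lipschitz_on UNIV v" "\<And>x. v x \<ge> 0" "\<And>x. x \<notin> \<Omega> \<Longrightarrow> v x = 0"
    and N: "negligible N" "\<And>x. x \<notin> N \<Longrightarrow> locally_affine_at v x"
  shows "v \<in> H10 \<Omega>"
proof -
  note m = open_bounded_lmeasurable[OF \<Omega>]
  have vC: "continuous_on UNIV v"
    by (rule lipschitz_on_continuous_on[OF v(1)])
  have L0: "L \<ge> 0"
    using v(1) by (rule lipschitz_on_nonneg)
  have vd: "v differentiable (at x)" if "x \<notin> N" for x
    using N(2)[OF that] by (rule locally_affine_at_differentiable)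
  have "compact (closure \<Omega>)" "\<And>x. x \<notin> closure \<Omega> \<Longrightarrow> v x = 0"
    using \<Omega>(2) v(3) closure_subset[of \<Omega>] by auto
  from bounded_if_compact_support[OF vC this] obtain B where "\<forall>x. \<bar>v x\<bar> \<le> B"
    by blast
  then have "v \<in> L2 \<Omega>"
    by (intro L2_bounded[OF m(1)] borel_measurable_lebesgue_on borel_measurable_continuous_onI vC AE_I2) auto
  then have H1: "v \<in> H1 \<Omega>"
    using lipschitz_has_weak_gradient[OF \<Omega> v(1) N(1) vd] by (auto simp: H1_def)
  define e where "e n = inverse (real (Suc n))" for n
  have e: "e n > 0" "e n \<le> 1" for n
    by (auto simp: e_def field_simps)
  have e0: "e \<longlonglongrightarrow> 0"
    unfolding e_def[abs_def] by (rule LIMSEQ_inverse_real_of_nat)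
  have "\<forall>n. \<exists>\<phi>. \<phi> \<in> test_functions \<Omega> \<and> L-lipschitz_on UNIV \<phi> \<and> (\<forall>x. \<bar>v x - \<phi> x\<bar> \<le> (L + 1) * e n) \<and>
    (\<forall>x. (\<forall>y\<in>ball x (2 * e n). v y = 0) \<longrightarrow> (\<phi> has_derivative (\<lambda>h. 0)) (at x)) \<and>
    (\<forall>x g. (\<forall>y\<in>ball x (2 * e n). v y \<ge> e n \<and> v y = v x + inner g (y - x)) \<longrightarrow>
       (\<phi> has_derivative (\<lambda>h. inner g h)) (at x))"
    using smooth_approximation[OF \<Omega> v e(1)] unfolding Bex_def by (rule allI)
  from choice[OF this] obtain \<phi> where \<phi>_all: "\<forall>n. \<phi> n \<in> test_functions \<Omega> \<and> L-lipschitz_on UNIV (\<phi> n) \<and>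
    (\<forall>x. \<bar>v x - \<phi> n x\<bar> \<le> (L + 1) * e n) \<and>
    (\<forall>x. (\<forall>y\<in>ball x (2 * e n). v y = 0) \<longrightarrow> (\<phi> n has_derivative (\<lambda>h. 0)) (at x)) \<and>
    (\<forall>x g. (\<forall>y\<in>ball x (2 * e n). v y \<ge> e n \<and> v y = v x + inner g (y - x)) \<longrightarrow>
       (\<phi> n has_derivative (\<lambda>h. inner g h)) (at x))" ..
  note \<phi> = \<phi>_all[rule_format, THEN conjunct1]
    \<phi>_all[rule_format, THEN conjunct2, THEN conjunct1]
    \<phi>_all[rule_format, THEN conjunct2, THEN conjunct2, THEN conjunct1, rule_format]
    \<phi>_all[rule_format, THEN conjunct2, THEN conjunct2, THEN conjunct2, THEN conjunct1, THEN spec, THEN mp]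
    \<phi>_all[rule_format, THEN conjunct2, THEN conjunct2, THEN conjunct2, THEN conjunct2, THEN spec, THEN spec, THEN mp]
  define u where "u n x = v x - \<phi> n x" for n x
  have ul: "(L + L)-lipschitz_on UNIV (u n)" for n
    unfolding u_def[abs_def] by (intro lipschitz_on_diff v(1) \<phi>(2))
  have ud: "u n differentiable (at x)" if "x \<notin> N" for n x
    unfolding u_def[abs_def]
    by (rule differentiable_diff[OF vd[OF that] differentiableI[OF test_functions_deriv(1)[OF \<phi>(1)]]])
  have ug: "has_weak_gradient \<Omega> (u n) (grad (u n))" for n
    by (rule lipschitz_has_weak_gradient[OF \<Omega> ul N(1) ud])
  have meas: "u n \<in> borel_measurable (lebesgue_on \<Omega>)" for n
    by (rule borel_measurable_lebesgue_on[OF lipschitz_imp_borel_measurable[OF ul]])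
  interpret finite_measure "lebesgue_on \<Omega>"
    by (rule finite_measure_lebesgue_on[OF m(1)])
  have "(\<lambda>n. \<integral>x. (u n x)\<^sup>2 \<partial>lebesgue_on \<Omega>) \<longlonglongrightarrow> (\<integral>x. 0 \<partial>lebesgue_on \<Omega>)"
  proof (rule integral_dominated_convergence[where w="\<lambda>x. (L + 1)\<^sup>2"])
    have bound: "(u n x)\<^sup>2 \<le> ((L + 1) * e n)\<^sup>2" for n x
      using \<phi>(3)[of x n] by (metis abs_ge_zero power2_abs power_mono u_def)
    show "AE x in lebesgue_on \<Omega>. (\<lambda>n. (u n x)\<^sup>2) \<longlonglongrightarrow> 0"
    proof (rule AE_I2)
      fix x
      have "(\<lambda>n. ((L + 1) * e n)\<^sup>2) \<longlonglongrightarrow> ((L + 1) * 0)\<^sup>2"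
        by (intro tendsto_intros e0)
      then have "(\<lambda>n. ((L + 1) * e n)\<^sup>2) \<longlonglongrightarrow> 0"
        by simp
      moreover have "\<forall>n. norm ((u n x)\<^sup>2) \<le> ((L + 1) * e n)\<^sup>2"
        using bound[of _ x] by simp
      then have "\<forall>\<^sub>F n in sequentially. norm ((u n x)\<^sup>2) \<le> ((L + 1) * e n)\<^sup>2"
        by (rule always_eventually)
      ultimately show "(\<lambda>n. (u n x)\<^sup>2) \<longlonglongrightarrow> 0"
        by (rule Lim_null_comparison[rotated])
    qed
    show "AE x in lebesgue_on \<Omega>. norm ((u n x)\<^sup>2) \<le> (L + 1)\<^sup>2" for n
    proof (rule AE_I2)
      fix x
      have "((L + 1) * e n)\<^sup>2 \<le> (L + 1)\<^sup>2"
        using e[of n] L0 by (intro power_mono) (auto simp: mult_left_le)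
      then show "norm ((u n x)\<^sup>2) \<le> (L + 1)\<^sup>2"
        using bound[of n x] by simp
    qed
  qed (use meas in auto)
  moreover have "(\<lambda>n. \<integral>x. (norm (grad (u n) x))\<^sup>2 \<partial>lebesgue_on \<Omega>) \<longlonglongrightarrow> (\<integral>x. 0 \<partial>lebesgue_on \<Omega>)"
  proof (rule integral_dominated_convergence[where w="\<lambda>x. (2 * (L + L))\<^sup>2"])
    show "AE x in lebesgue_on \<Omega>. (\<lambda>n. (norm (grad (u n) x))\<^sup>2) \<longlonglongrightarrow> 0"
    proof (rule AE_lebesgue_onI[OF m(2) N(1)])
      fix x assume "x \<notin> N"
      from locally_affine_nonneg_dichotomy[OF N(2)[OF this] v(2)]
      obtain g r where r: "r > 0" "(\<forall>y\<in>ball x r. v y = 0) \<or>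
          (\<forall>y\<in>ball x r. v y \<ge> r \<and> v y = v x + inner g (y - x))"
        by (elim exE conjE)
      have "\<forall>\<^sub>F n in sequentially. e n < r / 2"
        using order_tendstoD(2)[OF e0, of "r / 2"] r(1) by simp
      then have "\<forall>\<^sub>F n in sequentially. (norm (grad (u n) x))\<^sup>2 = 0"
      proof (rule eventually_mono)
        \<comment> \<open>Half of \<open>r\<close> fits the radius \<open>2 * e n\<close> into
          \<open>ball x r\<close>, and it puts the level \<open>e n\<close> below the lower bound
          \<open>r\<close> for \<open>v\<close>.\<close>
        fix n assume n: "e n < r / 2"
        then have ball: "ball x (2 * e n) \<subseteq> ball x r"
          by (intro subset_ball) simp
        have x: "x \<in> ball x r"
          using r(1) by simp
        have "(u n has_derivative (\<lambda>h. inner 0 h)) (at x)"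
          using r(2)
        proof
          assume z: "\<forall>y\<in>ball x r. v y = 0"
          then have "v y = v x + inner 0 (y - x)" if "y \<in> ball x r" for y
            using x that by simp
          then have "(v has_derivative (\<lambda>h. inner 0 h)) (at x)"
            by (intro locally_affine_at_has_derivative[OF r(1)] ballI)
          moreover have "(\<phi> n has_derivative (\<lambda>h. 0)) (at x)"
            using z ball by (intro \<phi>(4)) blast
          ultimately have "(u n has_derivative (\<lambda>h. inner 0 h - 0)) (at x)"
            unfolding u_def[abs_def] by (rule has_derivative_diff)
          then show ?thesis
            by simp
        next
          assume z: "\<forall>y\<in>ball x r. v y \<ge> r \<and> v y = v x + inner g (y - x)"
          then have "(v has_derivative (\<lambda>h. inner g h)) (at x)"
            by (intro locally_affine_at_has_derivative[OF r(1)] ballI) blast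
          moreover have "(\<phi> n has_derivative (\<lambda>h. inner g h)) (at x)"
          proof (intro \<phi>(5) ballI conjI)
            fix y assume "y \<in> ball x (2 * e n)"
            then have y: "y \<in> ball x r"
              using ball by blast
            show "e n \<le> v y"
              using bspec[OF z y] n r(1) by linarith
            show "v y = v x + inner g (y - x)"
              using bspec[OF z y] by (rule conjunct2)
          qed
          ultimately have "(u n has_derivative (\<lambda>h. inner g h - inner g h)) (at x)"
            unfolding u_def[abs_def] by (rule has_derivative_diff)
          then show ?thesis
            by simp
        qed
        then show "(norm (grad (u n) x))\<^sup>2 = 0"
          by (simp add: grad_eqI)
      qed
      then show "(\<lambda>n. (norm (grad (u n) x))\<^sup>2) \<longlonglongrightarrow> 0"
        by (rule tendsto_eventually)
    qed
    show "AE x in lebesgue_on \<Omega>. norm ((norm (grad (u n) x))\<^sup>2) \<le> (2 * (L + L))\<^sup>2" for n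
    proof (rule AE_lebesgue_onI[OF m(2) N(1)])
      fix x assume "x \<notin> N"
      from norm_sq_grad_bound[OF ul ud[OF this]]
      show "norm ((norm (grad (u n) x))\<^sup>2) \<le> (2 * (L + L))\<^sup>2"
        by simp
    qed
  qed (use weak_gradient_measurable(2)[OF ug] in auto)
  \<comment> \<open>\<open>H1_norm\<close> refers to the chosen weak gradient, the limit above to
    the explicit one.\<close>
  moreover have "(\<integral>x. (norm (weak_gradient \<Omega> (u n) x))\<^sup>2 \<partial>lebesgue_on \<Omega>) =
      (\<integral>x. (norm (grad (u n) x))\<^sup>2 \<partial>lebesgue_on \<Omega>)" for n
    using weak_gradient_AE_eq[OF \<Omega> ug[of n]]
    by (intro integral_cong_AE weak_gradient_measurable(2)[where g="grad (u n)", OF ug]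
        weak_gradient_measurable(2)) (auto elim: eventually_mono)
  ultimately have "(\<lambda>n. H1_norm \<Omega> (u n)) \<longlonglongrightarrow> sqrt (0 + 0)"
    unfolding H1_norm_def by (intro tendsto_intros) simp_all
  then have lim: "(\<lambda>n. H1_norm \<Omega> (u n)) \<longlonglongrightarrow> 0"
    by simp
  have "\<exists>\<phi>\<in>test_functions \<Omega>. H1_norm \<Omega> (\<lambda>x. v x - \<phi> x) < \<epsilon>" if \<epsilon>: "\<epsilon> > 0" for \<epsilon>
  proof -
    from order_tendstoD(2)[OF lim \<epsilon>] obtain n where "H1_norm \<Omega> (u n) < \<epsilon>"
      unfolding eventually_sequentially by blast
    then have "H1_norm \<Omega> (\<lambda>x. v x - \<phi> n x) < \<epsilon>"
      by (simp add: u_def[abs_def])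
    then show ?thesis
      using \<phi>(1) by (rule bexI)
  qed
  then show ?thesis
    using H1 by (simp add: H10_def)
qed

section \<open>Continuous piecewise linear functions\<close>

lemma linear_real_eq_inner:
  assumes "linear (f :: 'a::euclidean_space \<Rightarrow> real)"
  shows "\<exists>g. \<forall>x. f x = inner g x"
proof (intro exI allI)
  fix x
  show "f x = inner (\<Sum>b\<in>Basis. f b *\<^sub>R b) x"
    unfolding linear_sum_Basis[OF assms, of x]
    by (simp add: inner_sum_left mult.commute inner_commute[of x])
qed

text \<open>Moving one vertex to the origin makes the others linearly independent, so a linear map
  can be prescribed on them. Every extreme point of the simplex is one of these vertices.\<close>

lemma simplex_affine_interpolation:
  fixes p :: "'a::euclidean_space \<Rightarrow> real"
  assumes "n simplex t" "n \<ge> 0"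
  shows "\<exists>g c. \<forall>x. x extreme_point_of t \<longrightarrow> inner g x + c = p x"
proof -
  obtain C where C: "finite C" "\<not> affine_dependent C" "int (card C) = n + 1" "t = convex hull C"
    using assms(1) unfolding simplex by blast
  then have "C \<noteq> {}"
    using assms(2) by auto
  then obtain a where a: "a \<in> C"
    by blast
  have "independent ((\<lambda>x. - a + x) ` (C - {a}))"
    using affine_dependent_iff_dependent[of a "C - {a}"] a C(2) by (simp add: insert_absorb)
  from linear_independent_extend[OF this, of "\<lambda>y. p (a + y) - p a"]
  obtain l where l: "linear l" "\<forall>y\<in>(\<lambda>x. - a + x) ` (C - {a}). l y = p (a + y) - p a"
    by blast
  obtain g where g: "\<forall>x. l x = inner g x"
    using linear_real_eq_inner[OF l(1)] by blast
  have "inner g x + (p a - inner g a) = p x" if "x \<in> C" for x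
  proof (cases "x = a")
    case False
    then have "inner g (- a + x) = p x - p a"
      using l(2) g that by auto
    then show ?thesis
      by (simp add: inner_simps)
  qed simp
  moreover have "x \<in> C" if "x extreme_point_of t" for x
    using that C(4) extreme_point_of_convex_hull by blast
  ultimately show ?thesis
    by blast
qed

text \<open>Minkowski's theorem on extreme points. With half-planes and lines as \<open>H\<close>,
  affine equations and inequalities need to be checked at vertices only.\<close>

lemma extreme_points_subset_convex:
  fixes S :: "'a::euclidean_space set"
  assumes "compact S" "convex S" "convex H" "\<And>x. x extreme_point_of S \<Longrightarrow> x \<in> H"
  shows "S \<subseteq> H"
proof -
  have "S = convex hull {x. x extreme_point_of S}"
    using Krein_Milman_Minkowski assms(1,2) by blast
  also have "\<dots> \<subseteq> H"
    using assms(3,4) by (intro hull_minimal) auto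
  finally show ?thesis .
qed

lemma convex_affine_eq: "convex {x. inner g x + c = inner g' x + c'}"
proof -
  have "{x. inner g x + c = inner g' x + c'} = {x. inner (g - g') x = c' - c}"
    by (auto simp: inner_simps)
  then show ?thesis
    by (simp add: convex_hyperplane)
qed

lemma convex_affine_ge: "convex {x. inner g x + c \<ge> 0}"
proof -
  have "{x. inner g x + c \<ge> 0} = {x. inner g x \<ge> - c}"
    by auto
  then show ?thesis
    by (simp add: convex_halfspace_ge)
qed

locale mesh =
  fixes \<Omega> :: "(real^2) set" and \<T> :: "(real^2) set set"
  assumes bounded_dom: "bounded \<Omega>" and open_dom: "open \<Omega>"
    and conforming: "conforming_triangulation \<Omega> \<T>"
begin

lemma finite_mesh: "finite \<T>"
  and simplex_mesh: "t \<in> \<T> \<Longrightarrow> 2 simplex t"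
  and Union_mesh: "\<Union>\<T> = closure \<Omega>"
  and face_mesh: "t \<in> \<T> \<Longrightarrow> t' \<in> \<T> \<Longrightarrow> (t \<inter> t') face_of t"
  and edges_mesh: "\<exists>E. (\<forall>e\<in>E. \<exists>t\<in>\<T>. e edge_of t) \<and> frontier \<Omega> = \<Union>E"
  using conforming unfolding conforming_triangulation_def triangulation_def by blast+

lemma mesh_compact: "t \<in> \<T> \<Longrightarrow> compact t"
  and mesh_convex: "t \<in> \<T> \<Longrightarrow> convex t"
  using simplex_mesh compact_simplex convex_simplex by blast+

text \<open>This is where conformity enters: the intersection is a face of both triangles, and
  extreme points of a face are extreme points of the whole set.\<close>

lemma extreme_point_Int:
  assumes "t \<in> \<T>" "t' \<in> \<T>" "x extreme_point_of (t \<inter> t')"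
  shows "x extreme_point_of t" "x extreme_point_of t'"
  using extreme_point_of_face[OF face_mesh[OF assms(1,2)]]
    extreme_point_of_face[OF face_mesh[OF assms(2,1)]] assms(3) by (auto simp: Int_commute)

lemma edge_of_frontier:
  assumes "x \<in> frontier \<Omega>"
  shows "\<exists>t\<in>\<T>. \<exists>e. e face_of t \<and> x \<in> e \<and> e \<subseteq> frontier \<Omega>"
proof -
  obtain E where E: "\<forall>e\<in>E. \<exists>t\<in>\<T>. e edge_of t" "frontier \<Omega> = \<Union>E"
    using edges_mesh by (elim exE conjE)
  then obtain e where e: "e \<in> E" "x \<in> e" "e \<subseteq> frontier \<Omega>"
    using assms by auto
  then obtain t where "t \<in> \<T>" "e face_of t"
    using E(1) unfolding edge_of_def by auto
  then show ?thesis
    using e by auto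
qed

section \<open>Nodal interpolation and the hat basis\<close>

lemma Vh_eq_0: "v \<in> Vh \<Omega> \<T> \<Longrightarrow> x \<notin> \<Omega> \<Longrightarrow> v x = 0"
  by (simp add: Vh_def)

lemma Vh_affine: "v \<in> Vh \<Omega> \<T> \<Longrightarrow> t \<in> \<T> \<Longrightarrow> \<exists>g c. \<forall>x\<in>t. v x = inner g x + c"
  by (simp add: Vh_def)

lemma VhI:
  assumes "continuous_on (closure \<Omega>) v" "\<And>t. t \<in> \<T> \<Longrightarrow> \<exists>g c. \<forall>x\<in>t. v x = inner g x + c"
    "\<And>x. x \<notin> \<Omega> \<Longrightarrow> v x = 0"
  shows "v \<in> Vh \<Omega> \<T>"
  using assms by (simp add: Vh_def)

text \<open>On each triangle the vertex values fix an affine function, with zero prescribed at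
  boundary vertices. Two of them agree on the common face because they agree at its vertices, and
  they vanish on the frontier because it consists of edges whose endpoints are boundary vertices. So
  they glue to a continuous function.\<close>

lemma Vh_interpolation:
  shows "\<exists>v\<in>Vh \<Omega> \<T>. \<forall>y\<in>interior_nodes \<Omega> \<T>. v y = p y"
proof -
  define val where "val y = (if y \<in> \<Omega> then p y else 0)" for y
  have "\<forall>t\<in>\<T>. \<exists>gc :: (real^2) \<times> real. \<forall>x. x extreme_point_of t \<longrightarrow> inner (fst gc) x + snd gc = val x"
    using simplex_affine_interpolation[OF simplex_mesh, of _ val] by simp
  from bchoice[OF this] obtain gc :: "(real^2) set \<Rightarrow> (real^2) \<times> real"
    where gc: "\<forall>t\<in>\<T>. \<forall>x. x extreme_point_of t \<longrightarrow> inner (fst (gc t)) x + snd (gc t) = val x" ..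
  define l where "l t x = inner (fst (gc t)) x + snd (gc t)" for t x
  have l: "l t x = val x" if "t \<in> \<T>" "x extreme_point_of t" for t x
    using gc that by (simp add: l_def)
  have cons: "l t x = l t' x" if t: "t \<in> \<T>" "t' \<in> \<T>" "x \<in> t" "x \<in> t'" for t t' x
  proof -
    have "t \<inter> t' \<subseteq> {x. l t x = l t' x}"
      unfolding l_def
    proof (rule extreme_points_subset_convex)
      show "compact (t \<inter> t')" "convex (t \<inter> t')"
        using t mesh_compact mesh_convex by (auto intro: compact_Int convex_Int)
      show "convex {x. inner (fst (gc t)) x + snd (gc t) = inner (fst (gc t')) x + snd (gc t')}"
        by (rule convex_affine_eq)
      show "x \<in> {x. inner (fst (gc t)) x + snd (gc t) = inner (fst (gc t')) x + snd (gc t')}"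
        if "x extreme_point_of (t \<inter> t')" for x
        using gc t extreme_point_Int[OF t(1,2) that] by simp
    qed
    then show ?thesis
      using t by blast
  qed
  have front: "l t x = 0" if t: "t \<in> \<T>" "x \<in> t" "x \<in> frontier \<Omega>" for t x
  proof -
    \<comment> \<open>The triangle that carries the boundary edge through \<open>x\<close> may
      differ from \<open>t\<close>; \<open>cons\<close> transfers the value zero.\<close>
    obtain t' e where e: "t' \<in> \<T>" "e face_of t'" "x \<in> e" "e \<subseteq> frontier \<Omega>"
      using edge_of_frontier[OF t(3)] by blast
    have "e \<subseteq> {x. inner (fst (gc t')) x + snd (gc t') = inner 0 x + 0}"
    proof (rule extreme_points_subset_convex)
      show "compact e"
        by (rule face_of_imp_compact[OF mesh_convex[OF e(1)] mesh_compact[OF e(1)] e(2)])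
      show "convex e"
        by (rule face_of_imp_convex[OF e(2)])
      show "convex {x. inner (fst (gc t')) x + snd (gc t') = inner 0 x + 0}"
        by (rule convex_affine_eq)
      fix y assume "y extreme_point_of e"
      then have "y extreme_point_of t'" "y \<in> frontier \<Omega>"
        using extreme_point_of_face[OF e(2)] e(4) by auto
      then show "y \<in> {x. inner (fst (gc t')) x + snd (gc t') = inner 0 x + 0}"
        using gc e(1) open_dom by (auto simp: val_def frontier_def interior_open)
    qed
    then have "l t' x = 0"
      using e(3) by (auto simp: l_def)
    moreover have "x \<in> t'"
      using e(2,3) face_of_imp_subset by blast
    ultimately show ?thesis
      using cons[OF t(1) e(1) t(2)] by simp
  qed
  \<comment> \<open>The choice of the triangle is immaterial by \<open>cons\<close>, and the value
    zero off \<Omega> is consistent with the triangles by \<open>front\<close>.\<close>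
  define v where "v x = (if x \<in> \<Omega> then l (SOME t. t \<in> \<T> \<and> x \<in> t) x else 0)" for x
  have v: "v x = l t x" if t: "t \<in> \<T>" "x \<in> t" for t x
  proof (cases "x \<in> \<Omega>")
    case True
    have some: "(SOME t. t \<in> \<T> \<and> x \<in> t) \<in> \<T> \<and> x \<in> (SOME t. t \<in> \<T> \<and> x \<in> t)"
      by (rule someI[of "\<lambda>t. t \<in> \<T> \<and> x \<in> t" t]) (use t in blast)
    have "l (SOME t. t \<in> \<T> \<and> x \<in> t) x = l t x"
      by (rule cons[OF conjunct1[OF some] t(1) conjunct2[OF some] t(2)])
    then show ?thesis
      using True by (simp add: v_def)
  next
    case False
    have "x \<in> closure \<Omega>"
      using t Union_mesh by blast
    then have "x \<in> frontier \<Omega>"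
      using False open_dom by (simp add: frontier_def interior_open)
    then show ?thesis
      using False front[OF t] by (simp add: v_def)
  qed
  have "continuous_on t v" if "t \<in> \<T>" for t
  proof (rule continuous_on_eq)
    show "continuous_on t (l t)"
      unfolding l_def[abs_def] by (intro continuous_intros)
    show "l t x = v x" if "x \<in> t" for x
      using v \<open>t \<in> \<T>\<close> that by simp
  qed
  then have "continuous_on (\<Union>\<T>) v"
    using continuous_on_closed_Union[OF finite_mesh, of "\<lambda>t. t" v] compact_imp_closed[OF mesh_compact]
    by simp
  moreover have "\<exists>g c. \<forall>x\<in>t. v x = inner g x + c" if "t \<in> \<T>" for t
    by (intro exI[of _ "fst (gc t)"] exI[of _ "snd (gc t)"] ballI) (simp add: v[OF that] l_def)
  moreover have "v x = 0" if "x \<notin> \<Omega>" for x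
    using that by (simp add: v_def)
  ultimately have "v \<in> Vh \<Omega> \<T>"
    unfolding Vh_def Union_mesh by blast
  moreover have "v y = p y" if y: "y \<in> interior_nodes \<Omega> \<T>" for y
  proof -
    obtain t where t: "y \<in> \<Omega>" "t \<in> \<T>" "y extreme_point_of t"
      using y unfolding interior_nodes_def by blast
    then have "y \<in> t"
      by (simp add: extreme_point_of_def)
    then show ?thesis
      using v l t by (simp add: val_def)
  qed
  ultimately show ?thesis
    by (intro bexI[of _ v]) simp_all
qed

lemma Vh_affine_rep:
  assumes "v \<in> Vh \<Omega> \<T>"
  shows "\<exists>g c. \<forall>t\<in>\<T>. \<forall>x\<in>t. v x = inner (g t) x + c t"
proof -
  have "\<forall>t\<in>\<T>. \<exists>gc :: (real^2) \<times> real. \<forall>x\<in>t. v x = inner (fst gc) x + snd gc"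
    using assms by (simp add: Vh_def)
  from bchoice[OF this] obtain gc :: "(real^2) set \<Rightarrow> (real^2) \<times> real"
    where "\<forall>t\<in>\<T>. \<forall>x\<in>t. v x = inner (fst (gc t)) x + snd (gc t)" ..
  then show ?thesis
    by (rule exI[where x="\<lambda>t. fst (gc t)", OF exI[where x="\<lambda>t. snd (gc t)"]])
qed

lemma Vh_zero: "(\<lambda>x. 0) \<in> Vh \<Omega> \<T>"
  by (auto simp: Vh_def intro!: exI[of _ 0])

lemma Vh_lincomb:
  assumes "u \<in> Vh \<Omega> \<T>" "v \<in> Vh \<Omega> \<T>"
  shows "(\<lambda>x. a * u x + b * v x) \<in> Vh \<Omega> \<T>"
proof -
  have "\<exists>g c. \<forall>x\<in>t. a * u x + b * v x = inner g x + c" if t: "t \<in> \<T>" for t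
  proof -
    obtain g c where "\<forall>x\<in>t. u x = inner g x + c"
      using Vh_affine[OF assms(1) t] by (elim exE)
    moreover obtain g' c' where "\<forall>x\<in>t. v x = inner g' x + c'"
      using Vh_affine[OF assms(2) t] by (elim exE)
    ultimately have "\<forall>x\<in>t. a * u x + b * v x = inner (a *\<^sub>R g + b *\<^sub>R g') x + (a * c + b * c')"
      by (simp add: inner_simps algebra_simps)
    then show ?thesis
      by (intro exI)
  qed
  moreover have "continuous_on (closure \<Omega>) (\<lambda>x. a * u x + b * v x)"
    using assms by (intro continuous_intros) (simp_all add: Vh_def)
  ultimately show ?thesis
    using assms by (intro VhI) (simp_all add: Vh_eq_0)
qed

lemma Vh_sum:
  assumes "finite I" "\<And>i. i \<in> I \<Longrightarrow> v i \<in> Vh \<Omega> \<T>"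
  shows "(\<lambda>x. \<Sum>i\<in>I. a i * v i x) \<in> Vh \<Omega> \<T>"
  using assms
proof (induction I rule: finite_induct)
  case (insert i I)
  then show ?case
    using Vh_lincomb[of "v i" "\<lambda>x. \<Sum>i\<in>I. a i * v i x" "a i" 1] by simp
qed (simp add: Vh_zero)

text \<open>An affine function is nonnegative on a triangle once it is so at the vertices, and a
  vertex is an interior node or a point where \<open>v\<close> vanishes.\<close>

lemma Vh_nonneg:
  assumes v: "v \<in> Vh \<Omega> \<T>" and nodes: "\<And>y. y \<in> interior_nodes \<Omega> \<T> \<Longrightarrow> v y \<ge> 0"
  shows "v x \<ge> 0"
proof (cases "x \<in> \<Omega>")
  case True
  then obtain t where t: "t \<in> \<T>" "x \<in> t"
    using Union_mesh closure_subset by blast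
  obtain g c where gc: "\<forall>x\<in>t. v x = inner g x + c"
    using Vh_affine[OF v t(1)] by (elim exE)
  have "t \<subseteq> {x. inner g x + c \<ge> 0}"
  proof (rule extreme_points_subset_convex[OF mesh_compact[OF t(1)] mesh_convex[OF t(1)] convex_affine_ge])
    fix y assume y: "y extreme_point_of t"
    then have "y \<in> t"
      by (simp add: extreme_point_of_def)
    moreover have "v y \<ge> 0"
      using y t(1) nodes[of y] Vh_eq_0[OF v, of y] by (cases "y \<in> \<Omega>") (auto simp: interior_nodes_def)
    ultimately show "y \<in> {x. inner g x + c \<ge> 0}"
      using gc by simp
  qed
  then show ?thesis
    using gc t(2) by auto
qed (simp add: Vh_eq_0[OF v])

text \<open>Both differences are nonnegative at the nodes and hence everywhere.\<close>

lemma Vh_eqI: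
  assumes "u \<in> Vh \<Omega> \<T>" "v \<in> Vh \<Omega> \<T>" "\<And>y. y \<in> interior_nodes \<Omega> \<T> \<Longrightarrow> u y = v y"
  shows "u = v"
proof
  fix x
  show "u x = v x"
    using Vh_nonneg[OF Vh_lincomb[OF assms(1,2), of 1 "- 1"], of x]
      Vh_nonneg[OF Vh_lincomb[OF assms(1,2), of "- 1" 1], of x] assms(3) by simp
qed

text \<open>Existence by \<open>Vh_interpolation\<close> and uniqueness by \<open>Vh_eqI\<close>
  justify the \<open>THE\<close> in \<open>hat\<close>.\<close>

lemma hat_props:
  assumes "z \<in> interior_nodes \<Omega> \<T>"
  shows "hat \<Omega> \<T> z \<in> Vh \<Omega> \<T>"
    and "y \<in> interior_nodes \<Omega> \<T> \<Longrightarrow> hat \<Omega> \<T> z y = (if y = z then 1 else 0)"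
proof -
  obtain v where v: "v \<in> Vh \<Omega> \<T>" "\<forall>y\<in>interior_nodes \<Omega> \<T>. v y = (if y = z then 1 else 0)"
    using Vh_interpolation[of "\<lambda>y. if y = z then 1 else 0"] by blast
  have "hat \<Omega> \<T> z = v"
    unfolding hat_def using v by (intro the_equality) (auto intro: Vh_eqI)
  then show "hat \<Omega> \<T> z \<in> Vh \<Omega> \<T>"
    "y \<in> interior_nodes \<Omega> \<T> \<Longrightarrow> hat \<Omega> \<T> z y = (if y = z then 1 else 0)"
    using v by auto
qed

text \<open>Along a segment the function is \<open>L\<close>-Lipschitz on each of the finitely many closed pieces cut
  out by the triangles and by the complement of \<open>\<Omega>\<close>.\<close>

lemma Vh_lipschitz_on:
  assumes v: "v \<in> Vh \<Omega> \<T>" "\<And>t x. t \<in> \<T> \<Longrightarrow> x \<in> t \<Longrightarrow> v x = inner (g t) x + c t"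
    and L: "L \<ge> 0" "\<And>t. t \<in> \<T> \<Longrightarrow> norm (g t) \<le> L"
  shows "L-lipschitz_on UNIV v"
proof (rule lipschitz_onI[OF _ L(1)])
  fix x y :: "real^2"
  define \<gamma> where "\<gamma> s = x + s *\<^sub>R (y - x)" for s :: real
  have "(L * norm (y - x))-lipschitz_on {0..1} (\<lambda>s. v (\<gamma> s))"
  proof (rule lipschitz_on_closed_Union[where I="insert (- \<Omega>) \<T>" and U="\<lambda>i. \<gamma> -` i"])
    have "continuous_on UNIV \<gamma>"
      unfolding \<gamma>_def[abs_def] by (intro continuous_intros)
    moreover have "closed i" if "i \<in> insert (- \<Omega>) \<T>" for i
      using that
    proof
      assume "i = - \<Omega>"
      then show ?thesis
        using closed_Compl[OF open_dom] by simp
    qed (rule compact_imp_closed[OF mesh_compact])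
    ultimately show "closed (\<gamma> -` i)" if "i \<in> insert (- \<Omega>) \<T>" for i
      using that by (intro closed_vimage)
    show "finite (insert (- \<Omega>) \<T>)" "L * norm (y - x) \<ge> 0"
      using finite_mesh L(1) by auto
    show "{0..1} \<subseteq> (\<Union>i\<in>insert (- \<Omega>) \<T>. \<gamma> -` i)"
    proof
      fix s
      have "\<gamma> s \<in> - \<Omega> \<or> \<gamma> s \<in> \<Union>\<T>"
        using Union_mesh closure_subset[of \<Omega>] by auto
      then show "s \<in> (\<Union>i\<in>insert (- \<Omega>) \<T>. \<gamma> -` i)"
        by simp
    qed
    fix i assume i: "i \<in> insert (- \<Omega>) \<T>"
    show "(L * norm (y - x))-lipschitz_on (\<gamma> -` i) (\<lambda>s. v (\<gamma> s))"
    proof (rule lipschitz_onI)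
      fix s s' assume s: "s \<in> \<gamma> -` i" "s' \<in> \<gamma> -` i"
      have "\<bar>v (\<gamma> s) - v (\<gamma> s')\<bar> \<le> L * norm (\<gamma> s - \<gamma> s')"
      proof (cases "i = - \<Omega>")
        case True
        then show ?thesis
          using s Vh_eq_0[OF v(1)] L(1) by simp
      next
        case False
        then have "v (\<gamma> s) - v (\<gamma> s') = inner (g i) (\<gamma> s - \<gamma> s')"
          using s i v(2)[of i] by (simp add: inner_diff_right)
        also have "\<bar>\<dots>\<bar> \<le> norm (g i) * norm (\<gamma> s - \<gamma> s')"
          by (rule Cauchy_Schwarz_ineq2)
        also have "\<dots> \<le> L * norm (\<gamma> s - \<gamma> s')"
          using L(2)[of i] i False by (intro mult_right_mono) auto
        finally show ?thesis .
      qed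
      moreover have "\<gamma> s - \<gamma> s' = (s - s') *\<^sub>R (y - x)"
        by (simp add: \<gamma>_def algebra_simps)
      ultimately show "dist (v (\<gamma> s)) (v (\<gamma> s')) \<le> L * norm (y - x) * dist s s'"
        by (simp add: dist_real_def mult.commute mult.left_commute)
    qed (use L(1) in simp)
  qed
  from lipschitz_onD[OF this, of 0 1] show "dist (v x) (v y) \<le> L * dist x y"
    by (simp add: \<gamma>_def dist_norm norm_minus_commute)
qed

lemma Vh_lipschitz:
  assumes "v \<in> Vh \<Omega> \<T>"
  shows "\<exists>L. L-lipschitz_on UNIV v"
proof -
  obtain g c where gc: "\<forall>t\<in>\<T>. \<forall>x\<in>t. v x = inner (g t) x + c t"
    using Vh_affine_rep[OF assms] by (elim exE)
  have "(\<Sum>t\<in>\<T>. norm (g t))-lipschitz_on UNIV v"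
  proof (rule Vh_lipschitz_on[OF assms])
    show "v x = inner (g t) x + c t" if "t \<in> \<T>" "x \<in> t" for t x
      by (rule gc[rule_format, OF that])
    show "norm (g t) \<le> (\<Sum>t\<in>\<T>. norm (g t))" if "t \<in> \<T>" for t
      using that finite_mesh by (intro member_le_sum) auto
  qed (simp add: sum_nonneg)
  then show ?thesis
    by blast
qed

section \<open>Differentiability off the triangle boundaries\<close>

definition mesh_frontier :: "(real^2) set" where
  "mesh_frontier = (\<Union>t\<in>\<T>. frontier t)"

lemma negligible_mesh_frontier: "negligible mesh_frontier"
  unfolding mesh_frontier_def using finite_mesh mesh_convex
  by (intro negligible_Union) (auto intro: negligible_convex_frontier)

lemma Vh_affine_on_interior:
  assumes "\<And>y. y \<in> t \<Longrightarrow> v y = inner g y + c" "x \<in> interior t"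
  shows "\<exists>r>0. \<forall>y\<in>ball x r. v y = v x + inner g (y - x)"
proof -
  obtain r where r: "r > 0" "ball x r \<subseteq> t"
    using assms(2) mem_interior by blast
  have "v y = v x + inner g (y - x)" if "y \<in> ball x r" for y
  proof -
    have "y \<in> t" "x \<in> t"
      using r(2) that interior_subset assms(2) by blast+
    then show ?thesis
      using assms(1) by (simp add: inner_diff_right)
  qed
  then show ?thesis
    using r(1) by blast
qed

text \<open>The triangles cover the closure of \<Omega>, so a point off their boundaries is interior
  to a triangle or has a neighbourhood outside \<Omega>, on which \<open>v\<close> is zero.\<close>

lemma Vh_locally_affine_at:
  assumes v: "v \<in> Vh \<Omega> \<T>" and x: "x \<notin> mesh_frontier"
  shows "locally_affine_at v x"
proof (cases "x \<in> closure \<Omega>")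
  case True
  then obtain t where t: "t \<in> \<T>" "x \<in> t"
    using Union_mesh by blast
  then have "x \<in> interior t"
    using x closure_subset[of t] by (auto simp: mesh_frontier_def frontier_def)
  moreover obtain g c where "\<forall>x\<in>t. v x = inner g x + c"
    using Vh_affine[OF v t(1)] by (elim exE)
  ultimately have "\<exists>r>0. \<forall>y\<in>ball x r. v y = v x + inner g (y - x)"
    by (intro Vh_affine_on_interior[of t v g c x]) (erule bspec)
  then show ?thesis
    unfolding locally_affine_at_def by (rule exI)
next
  case False
  then have "x \<in> - closure \<Omega>"
    by simp
  moreover have "open (- closure \<Omega>)"
    by (rule open_Compl[OF closed_closure])
  ultimately obtain r where r: "r > 0" "ball x r \<subseteq> - closure \<Omega>"
    using openE by blast
  have out: "v y = 0" if "y \<in> ball x r" for y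
    using that r(2) closure_subset[of \<Omega>] by (intro Vh_eq_0[OF v]) auto
  have "v y = v x + inner 0 (y - x)" if "y \<in> ball x r" for y
    using out[OF that] out[of x] r(1) by simp
  then show ?thesis
    unfolding locally_affine_at_def using r(1)
    by (intro exI[of _ 0] exI[of _ r] conjI ballI)
qed

lemma Vh_differentiable: "v \<in> Vh \<Omega> \<T> \<Longrightarrow> x \<notin> mesh_frontier \<Longrightarrow> v differentiable (at x)"
  by (rule locally_affine_at_differentiable[OF Vh_locally_affine_at])

lemma Vh_has_weak_gradient:
  assumes "v \<in> Vh \<Omega> \<T>"
  shows "has_weak_gradient \<Omega> v (grad v)"
proof -
  obtain L where "L-lipschitz_on UNIV v"
    using Vh_lipschitz[OF assms] by blast
  then show ?thesis
    by (rule lipschitz_has_weak_gradient[OF open_dom bounded_dom _ negligible_mesh_frontier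
          Vh_differentiable[OF assms]])
qed

lemma Kh_subset_K_cone: "Kh \<Omega> \<T> \<subseteq> K_cone \<Omega>"
proof
  fix v assume "v \<in> Kh \<Omega> \<T>"
  then have v: "v \<in> Vh \<Omega> \<T>" "\<And>x. x \<in> \<Omega> \<Longrightarrow> v x \<ge> 0"
    by (auto simp: Kh_def)
  then have nonneg: "v x \<ge> 0" for x
    using Vh_eq_0[OF v(1), of x] by (cases "x \<in> \<Omega>") auto
  obtain L where L: "L-lipschitz_on UNIV v"
    using Vh_lipschitz[OF v(1)] by blast
  have "v \<in> H10 \<Omega>"
    by (rule lipschitz_in_H10[OF open_dom bounded_dom L nonneg Vh_eq_0[OF v(1)]
          negligible_mesh_frontier Vh_locally_affine_at[OF v(1)]])
  then show "v \<in> K_cone \<Omega>"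
    using nonneg by (simp add: K_cone_def)
qed

text \<open>Each triangle meets \<Omega> in a set of positive measure, so it contains an interior
  point with gradient zero; there the gradient is the slope of the affine piece.\<close>

lemma Vh_grad_eq_0_imp:
  assumes v: "v \<in> Vh \<Omega> \<T>" and zero: "AE x in lebesgue_on \<Omega>. grad v x = 0"
  shows "v = (\<lambda>x. 0)"
proof -
  obtain g c where gc: "\<forall>t\<in>\<T>. \<forall>x\<in>t. v x = inner (g t) x + c t"
    using Vh_affine_rep[OF v] by (elim exE)
  have "g t = 0" if t: "t \<in> \<T>" for t
  proof -
    have dim: "aff_dim t = 2"
      using aff_dim_simplex[OF simplex_mesh[OF t]] .
    then have "t \<noteq> {}"
      by auto
    with dim have "interior t \<noteq> {}"
      using interior_rel_interior_gen[of t] rel_interior_eq_empty[OF mesh_convex[OF t]] by simp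
    moreover have "interior t \<subseteq> closure \<Omega>"
      using t Union_mesh interior_subset by blast
    \<comment> \<open>Only inclusion in the closure is known here; an open set disjoint from
      \<Omega> is disjoint from its closure.\<close>
    ultimately have "interior t \<inter> \<Omega> \<noteq> {}"
      using open_Int_closure_eq_empty[of "interior t" \<Omega>] by blast
    then have nn: "\<not> negligible (interior t \<inter> \<Omega>)"
      using open_dom by (intro open_not_negligible) auto
    have "AE x in lebesgue. x \<in> \<Omega> \<longrightarrow> grad v x = 0"
      using zero open_dom by (simp add: AE_restrict_space_iff)
    then obtain N where N: "N \<in> null_sets lebesgue" "{x. \<not> (x \<in> \<Omega> \<longrightarrow> grad v x = 0)} \<subseteq> N"
      unfolding eventually_ae_filter by auto
    then have "\<not> interior t \<inter> \<Omega> \<subseteq> N"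
      using nn negligible_subset negligible_iff_null_sets by blast
    then obtain x where x: "x \<in> interior t" "grad v x = 0"
      using N(2) by blast
    have "\<exists>r>0. \<forall>y\<in>ball x r. v y = v x + inner (g t) (y - x)"
      by (rule Vh_affine_on_interior[OF gc[rule_format, OF t] x(1)])
    then obtain r where "r > 0" "\<forall>y\<in>ball x r. v y = v x + inner (g t) (y - x)"
      by (elim exE conjE)
    from grad_eqI[OF locally_affine_at_has_derivative[OF this]] show ?thesis
      using x(2) by simp
  qed
  then have lip: "0-lipschitz_on UNIV v"
    by (intro Vh_lipschitz_on[OF v gc[rule_format]]) simp_all
  \<comment> \<open>A point outside the bounded set \<Omega> anchors the constant function at
    zero.\<close>
  have "\<Omega> \<noteq> UNIV"
    using bounded_dom by auto
  then obtain x0 where x0: "x0 \<notin> \<Omega>"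
    by blast
  show ?thesis
  proof
    fix x
    show "v x = 0"
      using lipschitz_onD[OF lip, of x x0] Vh_eq_0[OF v x0] by simp
  qed
qed

end

section \<open>The energy form on the finite element space\<close>

locale weighted_mesh = mesh +
  fixes d :: "real^2 \<Rightarrow> real" and d0 :: real
  assumes weight_Linf: "(\<lambda>x. (d x)^3) \<in> Linf \<Omega>" and weight_pos: "d0^3 > 0"
    and weight_ge: "AE x in lebesgue_on \<Omega>. (d x)^3 \<ge> d0^3"
begin

lemmas dom_measurable = open_bounded_lmeasurable[OF open_dom bounded_dom]

lemma Vh_measurable:
  assumes "v \<in> Vh \<Omega> \<T>"
  shows "v \<in> borel_measurable borel"
  using Vh_lipschitz[OF assms] lipschitz_imp_borel_measurable by blast

lemma Vh_bounded:
  assumes "v \<in> Vh \<Omega> \<T>"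
  shows "\<exists>B\<ge>0. \<forall>x. \<bar>v x\<bar> \<le> B"
proof (rule bounded_if_compact_support)
  obtain L where "L-lipschitz_on UNIV v"
    using Vh_lipschitz[OF assms] by (elim exE)
  then show "continuous_on UNIV v"
    by (rule lipschitz_on_continuous_on)
  show "compact (closure \<Omega>)"
    using bounded_dom by simp
  show "v x = 0" if "x \<notin> closure \<Omega>" for x
    using that closure_subset[of \<Omega>] by (intro Vh_eq_0[OF assms]) auto
qed

lemma integrable_L2_mult_Vh:
  assumes "f \<in> L2 \<Omega>" "v \<in> Vh \<Omega> \<T>"
  shows "integrable (lebesgue_on \<Omega>) (\<lambda>x. f x * v x)"
proof -
  obtain B where "\<forall>x. \<bar>v x\<bar> \<le> B"
    using Vh_bounded[OF assms(2)] by blast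
  then have "AE x in lebesgue_on \<Omega>. \<bar>v x\<bar> \<le> B"
    by simp
  then show ?thesis
    by (rule integrable_L2_mult_bounded[OF dom_measurable(1) assms(1)
          borel_measurable_lebesgue_on[OF Vh_measurable[OF assms(2)]]])
qed

lemma L2_prod_lincomb:
  assumes "f \<in> L2 \<Omega>" "u \<in> Vh \<Omega> \<T>" "v \<in> Vh \<Omega> \<T>"
  shows "L2_prod \<Omega> f (\<lambda>x. a * u x + b * v x) = a * L2_prod \<Omega> f u + b * L2_prod \<Omega> f v"
proof -
  note i = integrable_L2_mult_Vh[OF assms(1,2)] integrable_L2_mult_Vh[OF assms(1,3)]
  have "L2_prod \<Omega> f (\<lambda>x. a * u x + b * v x) =
      (\<integral>x. a * (f x * u x) + b * (f x * v x) \<partial>lebesgue_on \<Omega>)"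
    unfolding L2_prod_def by (simp add: algebra_simps)
  also have "\<dots> = a * L2_prod \<Omega> f u + b * L2_prod \<Omega> f v"
    using i unfolding L2_prod_def by simp
  finally show ?thesis .
qed

lemma weight_measurable: "(\<lambda>x. (d x)^3) \<in> borel_measurable (lebesgue_on \<Omega>)"
  using weight_Linf by (simp add: Linf_def)

lemma inner_measurable:
  assumes "has_weak_gradient \<Omega> u g" "has_weak_gradient \<Omega> v g'"
  shows "(\<lambda>x. (d x)^3 * inner (g x) (g' x)) \<in> borel_measurable (lebesgue_on \<Omega>)"
proof -
  have "(\<lambda>x. (d x)^3 * (\<Sum>b\<in>Basis. inner (g x) b * inner (g' x) b)) \<in> borel_measurable (lebesgue_on \<Omega>)"
    by (intro borel_measurable_times borel_measurable_sum weight_measurable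
        weak_gradient_measurable(1)[OF assms(1)] weak_gradient_measurable(1)[OF assms(2)])
  moreover have "inner (g x) (g' x) = (\<Sum>b\<in>Basis. inner (g x) b * inner (g' x) b)" for x
    by (rule euclidean_inner)
  ultimately show ?thesis
    by simp
qed

lemma energy_form_integrable:
  assumes "u \<in> Vh \<Omega> \<T>" "v \<in> Vh \<Omega> \<T>"
  shows "integrable (lebesgue_on \<Omega>) (\<lambda>x. (d x)^3 * inner (grad u x) (grad v x))"
proof -
  obtain C where C: "AE x in lebesgue_on \<Omega>. \<bar>(d x)^3\<bar> \<le> C"
    using weight_Linf unfolding Linf_def by blast
  obtain L where L: "L-lipschitz_on UNIV u"
    using Vh_lipschitz[OF assms(1)] by (elim exE)
  obtain M where M: "M-lipschitz_on UNIV v"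
    using Vh_lipschitz[OF assms(2)] by (elim exE)
  \<comment> \<open>The factor \<open>2\<close> counts the coordinates, each of which contributes at
    most \<open>L * M\<close>.\<close>
  have "AE x in lebesgue_on \<Omega>. \<bar>inner (grad u x) (grad v x)\<bar> \<le> 2 * L * M"
  proof (rule AE_lebesgue_onI[OF dom_measurable(2) negligible_mesh_frontier])
    fix x assume x: "x \<notin> mesh_frontier"
    have "\<bar>inner (grad u x) (grad v x)\<bar> \<le> (\<Sum>b\<in>Basis. \<bar>inner (grad u x) b * inner (grad v x) b\<bar>)"
      by (subst euclidean_inner) (rule sum_abs)
    also have "\<dots> \<le> (\<Sum>b\<in>(Basis :: (real^2) set). L * M)"
      using inner_grad_bound[OF L Vh_differentiable[OF assms(1) x]]
        inner_grad_bound[OF M Vh_differentiable[OF assms(2) x]] lipschitz_on_nonneg[OF L]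
      by (intro sum_mono) (simp add: abs_mult mult_mono)
    finally show "\<bar>inner (grad u x) (grad v x)\<bar> \<le> 2 * L * M"
      by simp
  qed
  with C have "AE x in lebesgue_on \<Omega>. \<bar>(d x)^3 * inner (grad u x) (grad v x)\<bar> \<le> C * (2 * L * M)"
  proof eventually_elim
    case (elim x)
    then show ?case
      unfolding abs_mult by (intro mult_mono) linarith+
  qed
  then show ?thesis
    by (rule integrable_lebesgue_on_bounded[OF dom_measurable(1)
          inner_measurable[OF Vh_has_weak_gradient[OF assms(1)] Vh_has_weak_gradient[OF assms(2)]]])
qed

text \<open>Replaces chosen weak gradients by explicit ones, for which linear combinations can be
  computed point by point.\<close>

lemma energy_form_eq:
  assumes "u \<in> Vh \<Omega> \<T>" "v \<in> Vh \<Omega> \<T>"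
  shows "energy_form \<Omega> d u v = (\<integral>x. (d x)^3 * inner (grad u x) (grad v x) \<partial>lebesgue_on \<Omega>)"
proof -
  note g = Vh_has_weak_gradient[OF assms(1)] Vh_has_weak_gradient[OF assms(2)]
  note wu = weak_gradient_AE_eq[OF open_dom bounded_dom g(1)]
  note wv = weak_gradient_AE_eq[OF open_dom bounded_dom g(2)]
  show ?thesis
    unfolding energy_form_def
  proof (rule integral_cong_AE[OF inner_measurable[OF wu(2) wv(2)] inner_measurable[OF g]])
    show "AE x in lebesgue_on \<Omega>. (d x)^3 * inner (weak_gradient \<Omega> u x) (weak_gradient \<Omega> v x) =
        (d x)^3 * inner (grad u x) (grad v x)"
      using wu(1) wv(1) by eventually_elim simp
  qed
qed

lemma energy_form_commute: "energy_form \<Omega> d u v = energy_form \<Omega> d v u"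
  by (simp add: energy_form_def inner_commute)

lemma grad_lincomb:
  assumes "u differentiable (at x)" "v differentiable (at x)"
  shows "grad (\<lambda>x. a * u x + b * v x) x = a *\<^sub>R grad u x + b *\<^sub>R grad v x"
proof (rule euclidean_eqI)
  fix e :: "real^2" assume e: "e \<in> Basis"
  obtain u' v' where u': "(u has_derivative u') (at x)" and v': "(v has_derivative v') (at x)"
    using assms by (auto simp: differentiable_def)
  have "((\<lambda>x. a * u x + b * v x) has_derivative (\<lambda>h. a * u' h + b * v' h)) (at x)"
    by (intro derivative_intros u' v')
  from inner_grad_eq[OF this e]
  show "inner (grad (\<lambda>x. a * u x + b * v x) x) e = inner (a *\<^sub>R grad u x + b *\<^sub>R grad v x) e"
    using inner_grad_eq[OF u' e] inner_grad_eq[OF v' e] by (simp add: inner_simps)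
qed

text \<open>\<open>grad\<close> is additive only where both functions are differentiable, since its
  limits may be junk elsewhere; the exceptional points lie in the null set
  \<open>mesh_frontier\<close>.\<close>

lemma energy_form_lincomb:
  assumes "u \<in> Vh \<Omega> \<T>" "v \<in> Vh \<Omega> \<T>" "w \<in> Vh \<Omega> \<T>"
  shows "energy_form \<Omega> d (\<lambda>x. a * u x + b * v x) w = a * energy_form \<Omega> d u w + b * energy_form \<Omega> d v w"
proof -
  let ?I = "\<lambda>u x. (d x)^3 * inner (grad u x) (grad w x)"
  note uv = Vh_lincomb[OF assms(1,2), of a b]
  have "energy_form \<Omega> d (\<lambda>x. a * u x + b * v x) w =
      (\<integral>x. a * ?I u x + b * ?I v x \<partial>lebesgue_on \<Omega>)"
    unfolding energy_form_eq[OF uv assms(3)]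
  proof (rule integral_cong_AE)
    show "?I (\<lambda>x. a * u x + b * v x) \<in> borel_measurable (lebesgue_on \<Omega>)"
      by (rule inner_measurable[OF Vh_has_weak_gradient[OF uv] Vh_has_weak_gradient[OF assms(3)]])
    show "(\<lambda>x. a * ?I u x + b * ?I v x) \<in> borel_measurable (lebesgue_on \<Omega>)"
      using energy_form_integrable[OF assms(1,3)] energy_form_integrable[OF assms(2,3)] by measurable
    show "AE x in lebesgue_on \<Omega>. ?I (\<lambda>x. a * u x + b * v x) x = a * ?I u x + b * ?I v x"
    proof (rule AE_lebesgue_onI[OF dom_measurable(2) negligible_mesh_frontier])
      fix x assume "x \<notin> mesh_frontier"
      then show "?I (\<lambda>x. a * u x + b * v x) x = a * ?I u x + b * ?I v x"
        using grad_lincomb[OF Vh_differentiable[OF assms(1)] Vh_differentiable[OF assms(2)], of x a b]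
        by (simp add: inner_simps algebra_simps)
    qed
  qed
  also have "\<dots> = a * energy_form \<Omega> d u w + b * energy_form \<Omega> d v w"
    using energy_form_integrable[OF assms(1,3)] energy_form_integrable[OF assms(2,3)]
    by (simp add: energy_form_eq assms)
  finally show ?thesis .
qed

lemma energy_form_pos:
  assumes v: "v \<in> Vh \<Omega> \<T>" "v \<noteq> (\<lambda>x. 0)"
  shows "energy_form \<Omega> d v v > 0"
proof -
  let ?I = "\<lambda>x. (d x)^3 * inner (grad v x) (grad v x)"
  note i = energy_form_integrable[OF v(1,1)]
  have nonneg: "AE x in lebesgue_on \<Omega>. 0 \<le> ?I x"
    using weight_ge
  proof eventually_elim
    case (elim x)
    then show ?case
      using weight_pos by (intro mult_nonneg_nonneg inner_ge_zero) linarith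
  qed
  have "(\<integral>x. ?I x \<partial>lebesgue_on \<Omega>) \<noteq> 0"
  proof
    assume "(\<integral>x. ?I x \<partial>lebesgue_on \<Omega>) = 0"
    then have "AE x in lebesgue_on \<Omega>. ?I x = 0"
      using integral_nonneg_eq_0_iff_AE[OF i nonneg] by simp
    then have "AE x in lebesgue_on \<Omega>. grad v x = 0"
      using weight_ge
    proof eventually_elim
      case (elim x)
      then show ?case
        using weight_pos by auto
    qed
    then show False
      using Vh_grad_eq_0_imp[OF v(1)] v(2) by simp
  qed
  moreover have "(\<integral>x. ?I x \<partial>lebesgue_on \<Omega>) \<ge> 0"
    by (rule integral_nonneg_AE[OF nonneg])
  ultimately show ?thesis
    by (simp add: energy_form_eq[OF v(1,1)])
qed

text \<open>The hat function is continuous, nonnegative and equal to one at a point of the open set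
  \<Omega>. Integral zero would make it vanish almost everywhere on \<Omega>, hence by continuity at
  \<open>z\<close>.\<close>

lemma mass_pos:
  assumes z: "z \<in> interior_nodes \<Omega> \<T>"
  shows "mass \<Omega> \<T> z > 0"
proof -
  let ?h = "hat \<Omega> \<T> z"
  have h: "?h \<in> Vh \<Omega> \<T>"
    by (rule hat_props(1)[OF z])
  have nonneg: "?h x \<ge> 0" for x
    by (rule Vh_nonneg[OF h]) (simp add: hat_props(2)[OF z])
  obtain B where "\<forall>x. \<bar>?h x\<bar> \<le> B"
    using Vh_bounded[OF h] by blast
  then have "AE x in lebesgue_on \<Omega>. \<bar>?h x\<bar> \<le> B"
    by simp
  then have i: "integrable (lebesgue_on \<Omega>) ?h"
    by (rule integrable_lebesgue_on_bounded[OF dom_measurable(1)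
          borel_measurable_lebesgue_on[OF Vh_measurable[OF h]]])
  have "mass \<Omega> \<T> z \<noteq> 0"
  proof
    assume "mass \<Omega> \<T> z = 0"
    then have "AE x in lebesgue_on \<Omega>. ?h x = 0"
      using integral_nonneg_eq_0_iff_AE[OF i] nonneg by (simp add: mass_def)
    then have "AE x\<in>\<Omega> in lebesgue. x \<in> {x. ?h x = 0}"
      using dom_measurable(2) by (simp add: AE_restrict_space_iff)
    moreover have "closed {x. ?h x = 0}"
    proof -
      obtain L where "L-lipschitz_on UNIV ?h"
        using Vh_lipschitz[OF h] by (elim exE)
      then show ?thesis
        by (intro closed_Collect_eq continuous_on_const lipschitz_on_continuous_on)
    qed
    moreover have "z \<in> \<Omega>"
      using z by (simp add: interior_nodes_def)
    ultimately have "z \<in> {x. ?h x = 0}"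
      using mem_closed_if_AE_lebesgue_open[OF open_dom] by blast
    then show False
      using hat_props(2)[OF z z] by simp
  qed
  moreover have "mass \<Omega> \<T> z \<ge> 0"
    unfolding mass_def using nonneg by simp
  ultimately show ?thesis
    by simp
qed

end

section \<open>Coordinates with respect to the numbered hat functions\<close>

locale numbered_mesh = weighted_mesh +
  fixes n :: nat and z :: "nat \<Rightarrow> real^2"
  assumes numbering: "bij_betw z {..<n} (interior_nodes \<Omega> \<T>)"
begin

definition comb :: "(nat \<Rightarrow> real) \<Rightarrow> real^2 \<Rightarrow> real" where
  "comb c x = (\<Sum>i<n. c i * hat \<Omega> \<T> (z i) x)"

lemma node: "i < n \<Longrightarrow> z i \<in> interior_nodes \<Omega> \<T>"
  using numbering by (auto simp: bij_betw_def)

lemma node_eq_iff: "i < n \<Longrightarrow> j < n \<Longrightarrow> z i = z j \<longleftrightarrow> i = j"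
  using numbering by (auto simp: bij_betw_def inj_on_def)

lemma hat_in_Vh: "i < n \<Longrightarrow> hat \<Omega> \<T> (z i) \<in> Vh \<Omega> \<T>"
  by (rule hat_props(1)[OF node])

lemma comb_in_Vh: "comb c \<in> Vh \<Omega> \<T>"
  unfolding comb_def[abs_def] by (rule Vh_sum) (simp_all add: hat_in_Vh)

lemma comb_node:
  assumes "j < n"
  shows "comb c (z j) = c j"
proof -
  have "comb c (z j) = (\<Sum>i<n. if i = j then c j else 0)"
    unfolding comb_def using assms
    by (intro sum.cong) (auto simp: hat_props(2)[OF node node] node_eq_iff)
  then show ?thesis
    using assms by simp
qed

lemma Vh_eq_numbered:
  assumes "u \<in> Vh \<Omega> \<T>" "v \<in> Vh \<Omega> \<T>" "\<And>i. i < n \<Longrightarrow> u (z i) = v (z i)"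
  shows "u = v"
proof (rule Vh_eqI[OF assms(1,2)])
  fix y assume "y \<in> interior_nodes \<Omega> \<T>"
  then obtain i where "i < n" "y = z i"
    using numbering by (auto simp: bij_betw_def)
  then show "u y = v y"
    using assms(3) by simp
qed

lemma Vh_eq_comb: "v \<in> Vh \<Omega> \<T> \<Longrightarrow> v = comb (\<lambda>i. v (z i))"
  by (rule Vh_eq_numbered) (simp_all add: comb_in_Vh comb_node)

lemma Kh_iff:
  assumes "v \<in> Vh \<Omega> \<T>"
  shows "v \<in> Kh \<Omega> \<T> \<longleftrightarrow> (\<forall>i<n. v (z i) \<ge> 0)"
proof
  assume "v \<in> Kh \<Omega> \<T>"
  then show "\<forall>i<n. v (z i) \<ge> 0"
    using node by (auto simp: Kh_def interior_nodes_def)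
next
  assume *: "\<forall>i<n. v (z i) \<ge> 0"
  have "v y \<ge> 0" if y: "y \<in> interior_nodes \<Omega> \<T>" for y
  proof -
    obtain i where "i < n" "y = z i"
      using numbering y by (auto simp: bij_betw_def)
    then show ?thesis
      using * by simp
  qed
  then show "v \<in> Kh \<Omega> \<T>"
    using assms Vh_nonneg[OF assms] by (simp add: Kh_def)
qed

lemma energy_form_zero: "w \<in> Vh \<Omega> \<T> \<Longrightarrow> energy_form \<Omega> d (\<lambda>x. 0) w = 0"
  using energy_form_lincomb[OF Vh_zero Vh_zero, of w 0 0] by simp

lemma energy_form_sum:
  assumes "finite I" "\<And>i. i \<in> I \<Longrightarrow> v i \<in> Vh \<Omega> \<T>" "w \<in> Vh \<Omega> \<T>"
  shows "energy_form \<Omega> d (\<lambda>x. \<Sum>i\<in>I. c i * v i x) w = (\<Sum>i\<in>I. c i * energy_form \<Omega> d (v i) w)"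
  using assms(1,2)
proof (induction I rule: finite_induct)
  case empty
  then show ?case
    by (simp add: energy_form_zero assms(3))
next
  case (insert i I)
  then show ?case
    using energy_form_lincomb[OF _ Vh_sum assms(3), of "v i" I v "c i" 1 c] by simp
qed

lemma energy_form_comb:
  assumes "w \<in> Vh \<Omega> \<T>"
  shows "energy_form \<Omega> d (comb c) w = (\<Sum>i<n. c i * energy_form \<Omega> d (hat \<Omega> \<T> (z i)) w)"
  unfolding comb_def[abs_def] by (rule energy_form_sum[OF _ _ assms]) (simp_all add: hat_in_Vh)

lemma L2_prod_comb:
  assumes f: "f \<in> L2 \<Omega>"
  shows "L2_prod \<Omega> f (comb c) = (\<Sum>i<n. c i * L2_prod \<Omega> f (hat \<Omega> \<T> (z i)))"
proof -
  have "L2_prod \<Omega> f (\<lambda>x. \<Sum>i\<in>I. c i * hat \<Omega> \<T> (z i) x) = (\<Sum>i\<in>I. c i * L2_prod \<Omega> f (hat \<Omega> \<T> (z i)))"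
    if "finite I" "I \<subseteq> {..<n}" for I
    using that
  proof (induction I rule: finite_induct)
    case empty
    then show ?case
      by (simp add: L2_prod_def)
  next
    case (insert i I)
    then have I: "hat \<Omega> \<T> (z j) \<in> Vh \<Omega> \<T>" if "j \<in> insert i I" for j
      using that by (intro hat_in_Vh) auto
    moreover have "(\<lambda>x. \<Sum>i\<in>I. c i * hat \<Omega> \<T> (z i) x) \<in> Vh \<Omega> \<T>"
      using insert.hyps(1) I by (intro Vh_sum) auto
    ultimately show ?case
      using L2_prod_lincomb[OF f, of "hat \<Omega> \<T> (z i)" "\<lambda>x. \<Sum>i\<in>I. c i * hat \<Omega> \<T> (z i) x" "c i" 1]
        insert by simp
  qed
  then show ?thesis
    unfolding comb_def[abs_def] by simp
qed

text \<open>Exact second-order expansion of the quadratic functional at \<open>p\<close>: the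
  bracket is the first variation in the direction \<open>w\<close>.\<close>

lemma energy_diff:
  assumes f: "f \<in> L2 \<Omega>" and p: "p \<in> Vh \<Omega> \<T>" and q: "q \<in> Vh \<Omega> \<T>"
  \<comment> \<open>The explicit coefficients give \<open>w\<close> the shape that
    \<open>Vh_lincomb\<close> and \<open>energy_form_lincomb\<close> expect.\<close>
  defines "w \<equiv> \<lambda>x. 1 * q x + (- 1) * p x"
  shows "energy \<Omega> d f q - energy \<Omega> d f p =
    1/2 * energy_form \<Omega> d w w + (energy_form \<Omega> d p w - L2_prod \<Omega> f w)"
proof -
  have w: "w \<in> Vh \<Omega> \<T>"
    unfolding w_def by (rule Vh_lincomb[OF q p])
  note l = energy_form_lincomb[OF q p, of _ 1 "- 1", folded w_def]
  have "energy_form \<Omega> d w w = energy_form \<Omega> d q w - energy_form \<Omega> d p w"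
    using l[OF w] by simp
  moreover have "energy_form \<Omega> d q w = energy_form \<Omega> d q q - energy_form \<Omega> d p q"
    using l[OF q] by (simp add: energy_form_commute[of q w])
  moreover have "energy_form \<Omega> d p w = energy_form \<Omega> d q p - energy_form \<Omega> d p p"
    using l[OF p] by (simp add: energy_form_commute[of p w])
  moreover have "energy_form \<Omega> d q p = energy_form \<Omega> d p q"
    by (rule energy_form_commute)
  moreover have "L2_prod \<Omega> f w = L2_prod \<Omega> f q - L2_prod \<Omega> f p"
    using L2_prod_lincomb[OF f q p, of 1 "- 1"] by (simp add: w_def)
  ultimately show ?thesis
    unfolding energy_def by linarith
qed

end

section \<open>The frozen system\<close>

definition diag_on :: "nat \<Rightarrow> (nat \<Rightarrow> real) \<Rightarrow> nat set \<Rightarrow> real mat" where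
  "diag_on n m S = mat n n (\<lambda>(i, j). if i = j \<and> i \<in> S then m i else 0)"

lemma diag_on_carrier [simp]: "diag_on n m S \<in> carrier_mat n n"
  by (simp add: diag_on_def)

lemma mult_mat_vec_index_sum:
  assumes "A \<in> carrier_mat n n" "x \<in> carrier_vec n" "i < n"
  shows "vec_index (A *\<^sub>v x) i = (\<Sum>j<n. A $$ (i, j) * vec_index x j)"
  using assms by (simp add: scalar_prod_def atLeast0LessThan)

lemma diag_on_mult_index:
  assumes "x \<in> carrier_vec n" "i < n"
  shows "vec_index (diag_on n m S *\<^sub>v x) i = (if i \<in> S then m i * vec_index x i else 0)"
proof -
  have "vec_index (diag_on n m S *\<^sub>v x) i =
      (\<Sum>j<n. if j = i then (if i \<in> S then m i * vec_index x i else 0) else 0)"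
    unfolding mult_mat_vec_index_sum[OF diag_on_carrier assms]
    by (rule sum.cong) (use assms(2) in \<open>auto simp: diag_on_def\<close>)
  then show ?thesis
    using assms(2) by simp
qed

lemma smult_diag_on: "k \<cdot>\<^sub>m diag_on n m S = diag_on n (\<lambda>i. k * m i) S"
  by (rule eq_matI) (auto simp: diag_on_def)

lemma uminus_diag_on: "- diag_on n m S = diag_on n (\<lambda>i. - m i) S"
  by (rule eq_matI) (auto simp: diag_on_def)

lemma vec_eq_iff_index:
  assumes "x \<in> carrier_vec n" "y \<in> carrier_vec n"
  shows "x = y \<longleftrightarrow> (\<forall>i<n. vec_index x i = vec_index y i)"
  using assms by (auto intro: eq_vecI)

text \<open>The second block row is diagonal: division by \<open>m i\<close> or
  \<open>\<gamma> * m i\<close> leaves \<open>P = 0\<close> on \<open>S\<close> and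
  \<open>l = 0\<close> off \<open>S\<close>. These facts remove the penalty term from the first
  block row and allow \<open>l\<close> to be weighted at all nodes instead of on \<open>S\<close>
  only.\<close>

lemma frozen_solution_iff:
  assumes A: "A \<in> carrier_mat n n" and F: "F \<in> carrier_vec n" and \<gamma>: "\<gamma> > 0"
    and m: "\<forall>i<n. m i > 0" and S: "S \<subseteq> {..<n}"
  shows "frozen_solution n A (diag_on n m) F \<gamma> S P l \<longleftrightarrow> P \<in> carrier_vec n \<and> l \<in> carrier_vec n \<and>
    (\<forall>i\<in>S. vec_index P i = 0) \<and> (\<forall>i\<in>{..<n} - S. vec_index l i = 0) \<and>
    (\<forall>i<n. vec_index (A *\<^sub>v P) i - m i * vec_index l i = vec_index F i)"
proof (cases "P \<in> carrier_vec n \<and> l \<in> carrier_vec n")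
  case True
  then have P: "P \<in> carrier_vec n" and l: "l \<in> carrier_vec n"
    by auto
  let ?a = "diag_on n (\<lambda>i. inverse \<gamma> * m i) S" and ?b = "diag_on n (\<lambda>i. - m i) S"
    and ?c = "diag_on n (\<lambda>i. - (\<gamma> * m i)) ({..<n} - S)"
  have AP: "A *\<^sub>v P \<in> carrier_vec n" and diag: "diag_on n k T *\<^sub>v x \<in> carrier_vec n" for k T x
    using A by (auto intro!: carrier_vecI simp: diag_on_def)
  have "frozen_matrix n A (diag_on n m) \<gamma> S *\<^sub>v (P @\<^sub>v l) =
      ((A + ?a) *\<^sub>v P + ?b *\<^sub>v l) @\<^sub>v (?b *\<^sub>v P + ?c *\<^sub>v l)"
    unfolding frozen_matrix_def smult_diag_on uminus_diag_on using A P l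
    by (intro four_block_mat_mult_vec[where ?nr1.0=n and ?nr2.0=n]) simp_all
  also have "(A + ?a) *\<^sub>v P = A *\<^sub>v P + ?a *\<^sub>v P"
    by (rule add_mult_distrib_mat_vec[OF A diag_on_carrier P])
  finally have M: "frozen_matrix n A (diag_on n m) \<gamma> S *\<^sub>v (P @\<^sub>v l) =
      (A *\<^sub>v P + ?a *\<^sub>v P + ?b *\<^sub>v l) @\<^sub>v (?b *\<^sub>v P + ?c *\<^sub>v l)" .
  have carrier1: "A *\<^sub>v P + ?a *\<^sub>v P + ?b *\<^sub>v l \<in> carrier_vec n"
    by (intro add_carrier_vec AP diag)
  have carrier2: "?b *\<^sub>v P + ?c *\<^sub>v l \<in> carrier_vec n"
    by (intro add_carrier_vec diag)
  have dim: "dim_vec (diag_on n k T *\<^sub>v x) = n" for k T x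
    using diag by (rule carrier_vecD)
  have "frozen_solution n A (diag_on n m) F \<gamma> S P l \<longleftrightarrow>
      A *\<^sub>v P + ?a *\<^sub>v P + ?b *\<^sub>v l = F \<and> ?b *\<^sub>v P + ?c *\<^sub>v l = 0\<^sub>v n"
    unfolding frozen_solution_def M append_vec_eq[OF carrier1 F] using P l by blast
  also have "A *\<^sub>v P + ?a *\<^sub>v P + ?b *\<^sub>v l = F \<longleftrightarrow> (\<forall>i<n. vec_index (A *\<^sub>v P) i +
      (if i \<in> S then inverse \<gamma> * m i * vec_index P i else 0) +
      (if i \<in> S then - m i * vec_index l i else 0) = vec_index F i)"
    unfolding vec_eq_iff_index[OF carrier1 F]
    by (intro all_cong1 imp_cong refl)
      (simp only: index_add_vec(1) dim diag_on_mult_index[OF P] diag_on_mult_index[OF l])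
  also have "?b *\<^sub>v P + ?c *\<^sub>v l = 0\<^sub>v n \<longleftrightarrow> (\<forall>i<n. (if i \<in> S then - m i * vec_index P i else 0) +
      (if i \<in> {..<n} - S then - (\<gamma> * m i) * vec_index l i else 0) = 0)"
    unfolding vec_eq_iff_index[OF carrier2 zero_carrier_vec]
    by (intro all_cong1 imp_cong refl)
      (simp only: index_add_vec(1) index_zero_vec(1) dim diag_on_mult_index[OF P] diag_on_mult_index[OF l])
  also have "\<dots> \<longleftrightarrow> (\<forall>i<n. if i \<in> S then vec_index P i = 0 else vec_index l i = 0)"
  proof (intro all_cong1 imp_cong refl)
    fix i assume "i < n"
    then show "((if i \<in> S then - m i * vec_index P i else 0) +
      (if i \<in> {..<n} - S then - (\<gamma> * m i) * vec_index l i else 0) = 0) =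
      (if i \<in> S then vec_index P i = 0 else vec_index l i = 0)"
      using m[rule_format, of i] \<gamma> by simp
  qed
  \<comment> \<open>The rows of the first block simplify only in the presence of those of the
    second, so the conjunction is rewritten as a whole.\<close>
  also have "(\<forall>i<n. vec_index (A *\<^sub>v P) i +
      (if i \<in> S then inverse \<gamma> * m i * vec_index P i else 0) +
      (if i \<in> S then - m i * vec_index l i else 0) = vec_index F i) \<and>
      (\<forall>i<n. if i \<in> S then vec_index P i = 0 else vec_index l i = 0) \<longleftrightarrow>
      (\<forall>i<n. vec_index (A *\<^sub>v P) i - m i * vec_index l i = vec_index F i) \<and>
      (\<forall>i<n. if i \<in> S then vec_index P i = 0 else vec_index l i = 0)"
    unfolding all_conj_distrib[symmetric]
  proof (rule all_cong1)
    fix i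
    show "(i < n \<longrightarrow> vec_index (A *\<^sub>v P) i +
      (if i \<in> S then inverse \<gamma> * m i * vec_index P i else 0) +
      (if i \<in> S then - m i * vec_index l i else 0) = vec_index F i) \<and>
      (i < n \<longrightarrow> (if i \<in> S then vec_index P i = 0 else vec_index l i = 0)) \<longleftrightarrow>
      (i < n \<longrightarrow> vec_index (A *\<^sub>v P) i - m i * vec_index l i = vec_index F i) \<and>
      (i < n \<longrightarrow> (if i \<in> S then vec_index P i = 0 else vec_index l i = 0))"
      by (cases "i \<in> S"; cases "i < n") (auto simp del: index_mult_mat_vec)
  qed
  also have "(\<forall>i<n. if i \<in> S then vec_index P i = 0 else vec_index l i = 0) \<longleftrightarrow>
      (\<forall>i\<in>S. vec_index P i = 0) \<and> (\<forall>i\<in>{..<n} - S. vec_index l i = 0)"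
    using S by auto
  finally show ?thesis
    using P l by blast
next
  case False
  then show ?thesis
    unfolding frozen_solution_def by blast
qed

lemma invertible_mat_if_trivial_kernel:
  assumes M: "M \<in> carrier_mat k k" "\<And>v. v \<in> carrier_vec k \<Longrightarrow> M *\<^sub>v v = 0\<^sub>v k \<Longrightarrow> v = 0\<^sub>v k"
  shows "invertible_mat (M :: real mat)"
proof -
  have "det M \<noteq> 0"
    using det_0_iff_vec_prod_zero_field[OF M(1)] M(2) by blast
  then have "M \<in> Units (ring_mat TYPE(real) k ())"
    by (rule det_non_zero_imp_unit[OF M(1)])
  then obtain B where "B \<in> carrier_mat k k" "B * M = 1\<^sub>m k" "M * B = 1\<^sub>m k"
    by (auto simp: Units_def ring_mat_def)
  then show ?thesis
    using M(1) unfolding invertible_mat_def inverts_mat_def by auto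
qed

lemma frozen_matrix_invertible:
  assumes A: "A \<in> carrier_mat n n"
    and pd: "\<And>u. u \<in> carrier_vec n \<Longrightarrow> u \<noteq> 0\<^sub>v n \<Longrightarrow> scalar_prod u (A *\<^sub>v u) > 0"
    and \<gamma>: "\<gamma> > 0" and m: "\<forall>i<n. m i > 0" and S: "S \<subseteq> {..<n}"
  shows "invertible_mat (frozen_matrix n A (diag_on n m) \<gamma> S)"
proof (rule invertible_mat_if_trivial_kernel[where k="n + n"])
  let ?M = "frozen_matrix n A (diag_on n m) \<gamma> S"
  show "?M \<in> carrier_mat (n + n) (n + n)"
    unfolding frozen_matrix_def using A by (intro four_block_carrier_mat) auto
  fix v :: "real Matrix.vec"
  assume v: "v \<in> carrier_vec (n + n)" "?M *\<^sub>v v = 0\<^sub>v (n + n)"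
  define P l where "P = vec_first v n" and "l = vec_last v n"
  have v_eq: "v = P @\<^sub>v l"
    using v(1) by (simp add: P_def l_def)
  have carrier: "P \<in> carrier_vec n" "l \<in> carrier_vec n"
    by (simp_all add: P_def l_def)
  have "0\<^sub>v (n + n) = 0\<^sub>v n @\<^sub>v (0\<^sub>v n :: real Matrix.vec)"
    by (rule eq_vecI) auto
  then have "frozen_solution n A (diag_on n m) (0\<^sub>v n) \<gamma> S P l"
    using v(2) carrier by (simp add: frozen_solution_def v_eq)
  then have s: "\<forall>i\<in>S. vec_index P i = 0" "\<forall>i\<in>{..<n} - S. vec_index l i = 0"
    "\<forall>i<n. vec_index (A *\<^sub>v P) i - m i * vec_index l i = vec_index (0\<^sub>v n) i"
    by (simp_all add: frozen_solution_iff[OF A _ \<gamma> m S] del: index_mult_mat_vec)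
  \<comment> \<open>Every summand is zero: on \<open>S\<close> the factor \<open>P\<close> vanishes;
    off \<open>S\<close> the load and \<open>l\<close> are zero, hence so is that entry of
    \<open>A *\<^sub>v P\<close>.\<close>
  have "scalar_prod P (A *\<^sub>v P) = (\<Sum>i<n. vec_index P i * vec_index (A *\<^sub>v P) i)"
    using A by (simp add: scalar_prod_def atLeast0LessThan)
  also have "\<dots> = 0"
  proof (rule sum.neutral, rule ballI)
    fix i assume "i \<in> {..<n}"
    then show "vec_index P i * vec_index (A *\<^sub>v P) i = 0"
      using s by (cases "i \<in> S") (auto simp del: index_mult_mat_vec)
  qed
  finally have P0: "P = 0\<^sub>v n"
    using pd[OF carrier(1)] by fastforce
  \<comment> \<open>With \<open>P\<close> gone, the first block row reads
    \<open>m i * l i = 0\<close> at every node.\<close>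
  have "A *\<^sub>v 0\<^sub>v n = 0\<^sub>v n"
    using A by (intro eq_vecI) auto
  then have "vec_index l i = 0" if "i < n" for i
    using s(3) m[rule_format, OF that] that by (auto simp: P0 simp del: index_mult_mat_vec)
  then have "l = 0\<^sub>v n"
    using carrier(2) by (intro eq_vecI) auto
  then show "v = 0\<^sub>v (n + n)"
    using P0 by (simp add: v_eq \<open>0\<^sub>v (n + n) = 0\<^sub>v n @\<^sub>v 0\<^sub>v n\<close>)
qed

text \<open>On frozen solutions the update test only reads the sign of \<open>l\<close> on
  \<open>S\<close> and of \<open>P\<close> off \<open>S\<close>. Ties go to \<open>S\<close>, whence
  the strict inequality off \<open>S\<close>.\<close>

lemma fixed_point_iff:
  assumes A: "A \<in> carrier_mat n n" and F: "F \<in> carrier_vec n" and \<gamma>: "\<gamma> > 0"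
    and m: "\<forall>i<n. m i > 0" and S: "S \<subseteq> {..<n}"
  shows "fixed_point n A (diag_on n m) F \<gamma> S P l \<longleftrightarrow> frozen_solution n A (diag_on n m) F \<gamma> S P l \<and>
    (\<forall>i\<in>S. vec_index l i \<ge> 0) \<and> (\<forall>i\<in>{..<n} - S. vec_index P i > 0)"
proof (cases "frozen_solution n A (diag_on n m) F \<gamma> S P l")
  case True
  then have s: "\<forall>i\<in>S. vec_index P i = 0" "\<forall>i\<in>{..<n} - S. vec_index l i = 0"
    by (simp_all add: frozen_solution_iff[OF A F \<gamma> m S])
  have "S = {i \<in> {..<n}. \<gamma> * vec_index l i - vec_index P i \<ge> 0} \<longleftrightarrow>
      (\<forall>i<n. i \<in> S \<longleftrightarrow> \<gamma> * vec_index l i - vec_index P i \<ge> 0)"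
    using S by auto
  also have "\<dots> \<longleftrightarrow> (\<forall>i<n. if i \<in> S then vec_index l i \<ge> 0 else vec_index P i > 0)"
  proof (intro all_cong1 imp_cong refl)
    fix i assume "i < n"
    then show "(i \<in> S \<longleftrightarrow> \<gamma> * vec_index l i - vec_index P i \<ge> 0) =
        (if i \<in> S then vec_index l i \<ge> 0 else vec_index P i > 0)"
      using s \<gamma> by (auto simp: zero_le_mult_iff)
  qed
  also have "\<dots> \<longleftrightarrow> (\<forall>i\<in>S. vec_index l i \<ge> 0) \<and> (\<forall>i\<in>{..<n} - S. vec_index P i > 0)"
    using S by auto
  finally show ?thesis
    using True by (simp add: fixed_point_def)
qed (simp add: fixed_point_def)

section \<open>The stiffness matrix and the obstacle problem\<close>

context numbered_mesh
begin

abbreviation "stiff \<equiv> stiffness \<Omega> \<T> d n z"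

lemma stiffness_carrier: "stiff \<in> carrier_mat n n"
  by (simp add: stiffness_def)

lemma load_carrier: "load \<Omega> \<T> f n z \<in> carrier_vec n"
  by (simp add: load_def)

lemma mass_diag_eq: "mass_diag \<Omega> \<T> n z = diag_on n (\<lambda>i. mass \<Omega> \<T> (z i))"
  by (rule ext) (simp add: mass_diag_def diag_on_def)

lemma mass_node_pos: "i < n \<Longrightarrow> mass \<Omega> \<T> (z i) > 0"
  by (rule mass_pos[OF node])

lemma stiffness_symmetric: "transpose_mat stiff = stiff"
  by (rule eq_matI) (auto simp: stiffness_def energy_form_commute)

text \<open>Links matrix rows with the variational form: the row index belongs to the test
  function.\<close>

lemma stiffness_mult_index:
  assumes "u \<in> carrier_vec n" "i < n"
  shows "vec_index (stiff *\<^sub>v u) i = energy_form \<Omega> d (comb (vec_index u)) (hat \<Omega> \<T> (z i))"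
  unfolding mult_mat_vec_index_sum[OF stiffness_carrier assms] energy_form_comb[OF hat_in_Vh[OF assms(2)]]
  by (rule sum.cong) (use assms(2) in \<open>simp_all add: stiffness_def mult.commute\<close>)

lemma energy_form_comb_comb:
  assumes "u \<in> carrier_vec n"
  shows "energy_form \<Omega> d (comb (vec_index u)) (comb c) = (\<Sum>i<n. c i * vec_index (stiff *\<^sub>v u) i)"
proof -
  have "energy_form \<Omega> d (comb (vec_index u)) (comb c) =
      (\<Sum>i<n. c i * energy_form \<Omega> d (hat \<Omega> \<T> (z i)) (comb (vec_index u)))"
    unfolding energy_form_commute[of _ "comb c"] by (rule energy_form_comb[OF comb_in_Vh])
  also have "\<dots> = (\<Sum>i<n. c i * vec_index (stiff *\<^sub>v u) i)"
    by (rule sum.cong)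
      (simp_all add: stiffness_mult_index[OF assms] energy_form_commute[of _ "comb (vec_index u)"]
        del: index_mult_mat_vec)
  finally show ?thesis .
qed

lemma stiffness_positive_definite:
  assumes u: "u \<in> carrier_vec n" "u \<noteq> 0\<^sub>v n"
  shows "scalar_prod u (stiff *\<^sub>v u) > 0"
proof -
  have "scalar_prod u (stiff *\<^sub>v u) = (\<Sum>i<n. vec_index u i * vec_index (stiff *\<^sub>v u) i)"
    using stiffness_carrier by (simp add: scalar_prod_def atLeast0LessThan)
  also have "\<dots> = energy_form \<Omega> d (comb (vec_index u)) (comb (vec_index u))"
    by (simp only: energy_form_comb_comb[OF u(1)])
  also have "\<dots> > 0"
  proof (rule energy_form_pos[OF comb_in_Vh])
    obtain i where i: "i < n" "vec_index u i \<noteq> 0"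
      using u vec_eq_iff_index[OF u(1) zero_carrier_vec] by auto
    show "comb (vec_index u) \<noteq> (\<lambda>x. 0)"
    proof
      assume "comb (vec_index u) = (\<lambda>x. 0)"
      then have "comb (vec_index u) (z i) = 0"
        by simp
      then show False
        using i comb_node[OF i(1), of "vec_index u"] by simp
    qed
  qed
  finally show ?thesis .
qed

lemma interpolant_unique: "\<exists>!p. p \<in> Vh \<Omega> \<T> \<and> (\<forall>i<n. p (z i) = c i)"
proof (rule ex1I[of _ "comb c"])
  show "comb c \<in> Vh \<Omega> \<T> \<and> (\<forall>i<n. comb c (z i) = c i)"
    by (simp add: comb_in_Vh comb_node)
  show "p = comb c" if "p \<in> Vh \<Omega> \<T> \<and> (\<forall>i<n. p (z i) = c i)" for p
    using that by (intro Vh_eq_numbered) (simp_all add: comb_in_Vh comb_node)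
qed

text \<open>By the Kuhn--Tucker conditions the linear part of the energy increment from \<open>p\<close> to \<open>q\<close> is
  \<open>\<Sum>i. m i * \<lambda> i * q (z i) \<ge> 0\<close>, so the increment is at least its quadratic part, which is positive.\<close>

lemma Kuhn_Tucker_energy_less:
  assumes f: "f \<in> L2 \<Omega>" and P: "P \<in> carrier_vec n"
    and eq: "\<And>i. i < n \<Longrightarrow> vec_index (stiff *\<^sub>v P) i - mass \<Omega> \<T> (z i) * vec_index l i =
      vec_index (load \<Omega> \<T> f n z) i"
    and KT: "\<And>i. i < n \<Longrightarrow> vec_index l i \<ge> 0" "\<And>i. i < n \<Longrightarrow> vec_index l i * vec_index P i = 0"
    and p: "p \<in> Vh \<Omega> \<T>" "\<And>i. i < n \<Longrightarrow> p (z i) = vec_index P i"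
    and q: "q \<in> Kh \<Omega> \<T>" "q \<noteq> p"
  shows "energy \<Omega> d f p < energy \<Omega> d f q"
proof -
  have qV: "q \<in> Vh \<Omega> \<T>"
    using q(1) by (simp add: Kh_def)
  have q0: "q (z i) \<ge> 0" if "i < n" for i
    using q(1) that Kh_iff[OF qV] by blast
  define w where "w = (\<lambda>x. 1 * q x + (- 1) * p x)"
  have w: "w \<in> Vh \<Omega> \<T>"
    unfolding w_def by (rule Vh_lincomb[OF qV p(1)])
  have pc: "p = comb (vec_index P)"
    by (rule Vh_eq_numbered[OF p(1) comb_in_Vh]) (simp add: p(2) comb_node)
  define c where "c i = w (z i)" for i
  have wc: "w = comb c"
    unfolding c_def by (rule Vh_eq_comb[OF w])
  have "energy_form \<Omega> d p w - L2_prod \<Omega> f w =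
      (\<Sum>i<n. c i * vec_index (stiff *\<^sub>v P) i) - (\<Sum>i<n. c i * vec_index (load \<Omega> \<T> f n z) i)"
    unfolding pc wc energy_form_comb_comb[OF P] L2_prod_comb[OF f] by (simp add: load_def)
  also have "\<dots> = (\<Sum>i<n. mass \<Omega> \<T> (z i) * vec_index l i * q (z i))"
    unfolding sum_subtractf[symmetric]
  proof (rule sum.cong)
    fix i assume "i \<in> {..<n}"
    then have i: "i < n"
      by simp
    have "c i * vec_index (stiff *\<^sub>v P) i - c i * vec_index (load \<Omega> \<T> f n z) i =
        c i * (mass \<Omega> \<T> (z i) * vec_index l i)"
      unfolding eq[OF i, symmetric] by (simp only: algebra_simps)
    \<comment> \<open>Here \<open>c i\<close> is the increment \<open>q (z i) - P i\<close>; its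
      \<open>P\<close> part drops out by complementarity.\<close>
    also have "\<dots> = mass \<Omega> \<T> (z i) * vec_index l i * q (z i) -
        mass \<Omega> \<T> (z i) * (vec_index l i * vec_index P i)"
      by (simp add: c_def w_def p(2)[OF i] algebra_simps)
    finally show "c i * vec_index (stiff *\<^sub>v P) i - c i * vec_index (load \<Omega> \<T> f n z) i =
        mass \<Omega> \<T> (z i) * vec_index l i * q (z i)"
      by (simp only: KT(2)[OF i] mult_zero_right diff_zero)
  qed simp
  also have "\<dots> \<ge> 0"
    using mass_node_pos KT(1) q0 by (intro sum_nonneg mult_nonneg_nonneg) (auto intro: less_imp_le)
  finally have "energy_form \<Omega> d p w - L2_prod \<Omega> f w \<ge> 0" .
  moreover have "energy_form \<Omega> d w w > 0"
  proof (rule energy_form_pos[OF w])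
    show "w \<noteq> (\<lambda>x. 0)"
    proof
      assume w0: "w = (\<lambda>x. 0)"
      have "q x = p x" for x
        using fun_cong[OF w0, of x] by (simp add: w_def)
      then show False
        using q(2) by blast
    qed
  qed
  ultimately show ?thesis
    using energy_diff[OF f p(1) qV, folded w_def] by linarith
qed

end

theorem theorem2p3:
  fixes \<Omega> :: "(real^2) set" and \<T> :: "(real^2) set set"
    and d f :: "real^2 \<Rightarrow> real" and d0 \<gamma> :: real
    and n :: nat and z :: "nat \<Rightarrow> real^2"
    and A :: "real mat" and D :: "nat set \<Rightarrow> real mat" and F :: "real Matrix.vec"
  assumes "bounded \<Omega>" and "polygonal_domain \<Omega>" and "conforming_triangulation \<Omega> \<T>"
    and "(\<lambda>x. (d x)^3) \<in> Linf \<Omega>" and "d0^3 > 0" and "AE x in lebesgue_on \<Omega>. (d x)^3 \<ge> d0^3"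
    and "f \<in> L2 \<Omega>"
    and "bij_betw z {..<n} (interior_nodes \<Omega> \<T>)"
    and "A = stiffness \<Omega> \<T> d n z" and "F = load \<Omega> \<T> f n z" and "D = mass_diag \<Omega> \<T> n z"
    and "\<gamma> > 0"
  shows
   "\<comment> \<open>the stiffness matrix is symmetric and positive definite\<close>
    (transpose_mat A = A \<and>
     (\<forall>u\<in>carrier_vec n. u \<noteq> 0\<^sub>v n \<longrightarrow> scalar_prod u (A *\<^sub>v u) > 0)) \<and>
    \<comment> \<open>(i)\<close>
    (\<forall>\<A>\<subseteq>{..<n}. invertible_mat (frozen_matrix n A D \<gamma> \<A>)) \<and>
    \<comment> \<open>(ii), (iii)\<close>
    (\<forall>\<A>\<subseteq>{..<n}. \<forall>P l. frozen_solution n A D F \<gamma> \<A> P l \<longrightarrow>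
       (\<forall>i\<in>\<A>. vec_index P i = 0) \<and>
       (\<forall>i\<in>{..<n} - \<A>. vec_index l i = 0) \<and>
       (\<forall>i<n. vec_index l i * vec_index P i = 0) \<and>
       (\<forall>i\<in>\<A>. \<gamma> * vec_index l i - vec_index P i = \<gamma> * vec_index l i) \<and>
       (\<forall>i\<in>{..<n} - \<A>. \<gamma> * vec_index l i - vec_index P i = - vec_index P i)) \<and>
    \<comment> \<open>(iv)\<close>
    (\<forall>\<A>\<subseteq>{..<n}. \<forall>P l. fixed_point n A D F \<gamma> \<A> P l \<longrightarrow>
       (\<forall>i\<in>\<A>. vec_index l i \<ge> 0) \<and> (\<forall>i\<in>{..<n} - \<A>. vec_index P i > 0)) \<and>
    \<comment> \<open>(v)\<close>
    (\<forall>\<gamma>'>0. \<forall>\<A>\<subseteq>{..<n}. \<forall>P l.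
       (frozen_solution n A D F \<gamma> \<A> P l \<longleftrightarrow> frozen_solution n A D F \<gamma>' \<A> P l) \<and>
       (fixed_point n A D F \<gamma> \<A> P l \<longleftrightarrow> fixed_point n A D F \<gamma>' \<A> P l)) \<and>
    (\<forall>\<A>\<subseteq>{..<n}. \<forall>P l. fixed_point n A D F \<gamma> \<A> P l \<longrightarrow>
       A *\<^sub>v P - D {..<n} *\<^sub>v l = F \<and>
       (\<forall>i<n. vec_index P i \<ge> 0 \<and> vec_index l i \<ge> 0 \<and> vec_index l i * vec_index P i = 0)) \<and>
    \<comment> \<open>(vi)\<close>
    (\<forall>\<A>\<subseteq>{..<n}. \<forall>P l. fixed_point n A D F \<gamma> \<A> P l \<longrightarrow>
       (\<exists>!p. p \<in> Vh \<Omega> \<T> \<and> (\<forall>i<n. p (z i) = vec_index P i)) \<and>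
       (\<forall>p\<in>Vh \<Omega> \<T>. (\<forall>i<n. p (z i) = vec_index P i) \<longrightarrow>
          (\<forall>q. is_arg_min (energy \<Omega> d f) (\<lambda>v. v \<in> Kh \<Omega> \<T>) q \<longleftrightarrow> q = p))) \<and>
    Kh \<Omega> \<T> \<subseteq> K_cone \<Omega>"
proof -
  interpret numbered_mesh \<Omega> \<T> d d0 n z
    using assms by unfold_locales (auto simp: polygonal_domain_def)
  define m where "m i = mass \<Omega> \<T> (z i)" for i
  have m: "\<forall>i<n. m i > 0"
    unfolding m_def using mass_node_pos by blast
  have D: "D = diag_on n m"
    unfolding assms(11) mass_diag_eq m_def[abs_def] ..
  have A: "A \<in> carrier_mat n n"
    unfolding assms(9) by (rule stiffness_carrier)
  have F: "F \<in> carrier_vec n"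
    unfolding assms(10) by (rule load_carrier)
  have pd: "scalar_prod u (A *\<^sub>v u) > 0" if "u \<in> carrier_vec n" "u \<noteq> 0\<^sub>v n" for u
    unfolding assms(9) by (rule stiffness_positive_definite[OF that])
  \<comment> \<open>The positivity premise on the parameter stays open, so both facts apply to
    \<open>\<gamma>\<close> and to \<open>\<gamma>'\<close>.\<close>
  note frozen = frozen_solution_iff[where m=m, OF A F _ m, folded D]
  note fixed = fixed_point_iff[where m=m, OF A F _ m, folded D]
  have frozenD: "\<forall>i\<in>\<A>. vec_index P i = 0" "\<forall>i\<in>{..<n} - \<A>. vec_index l i = 0"
      "\<forall>i<n. vec_index l i * vec_index P i = 0"
    if "\<A> \<subseteq> {..<n}" "frozen_solution n A D F \<gamma> \<A> P l" for \<A> P l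
  proof -
    show *: "\<forall>i\<in>\<A>. vec_index P i = 0" "\<forall>i\<in>{..<n} - \<A>. vec_index l i = 0"
      using that frozen[OF assms(12)] by blast+
    show "\<forall>i<n. vec_index l i * vec_index P i = 0"
    proof (intro allI impI)
      fix i assume "i < n"
      then show "vec_index l i * vec_index P i = 0"
        using * by (cases "i \<in> \<A>") auto
    qed
  qed
  have fixedD: "P \<in> carrier_vec n" "l \<in> carrier_vec n"
      "\<forall>i\<in>\<A>. vec_index l i \<ge> 0" "\<forall>i\<in>{..<n} - \<A>. vec_index P i > 0"
      "\<forall>i<n. vec_index (A *\<^sub>v P) i - m i * vec_index l i = vec_index F i"
      "\<forall>i<n. vec_index P i \<ge> 0 \<and> vec_index l i \<ge> 0 \<and> vec_index l i * vec_index P i = 0"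
    if \<A>: "\<A> \<subseteq> {..<n}" and fp: "fixed_point n A D F \<gamma> \<A> P l" for \<A> P l
  proof -
    have fs: "frozen_solution n A D F \<gamma> \<A> P l"
      and *: "\<forall>i\<in>\<A>. vec_index l i \<ge> 0" "\<forall>i\<in>{..<n} - \<A>. vec_index P i > 0"
      using fp fixed[OF assms(12) \<A>] by blast+
    show "\<forall>i\<in>\<A>. vec_index l i \<ge> 0" "\<forall>i\<in>{..<n} - \<A>. vec_index P i > 0"
      by (rule *)+
    show "P \<in> carrier_vec n" "l \<in> carrier_vec n"
      "\<forall>i<n. vec_index (A *\<^sub>v P) i - m i * vec_index l i = vec_index F i"
      using fs frozen[OF assms(12) \<A>] by blast+
    show "\<forall>i<n. vec_index P i \<ge> 0 \<and> vec_index l i \<ge> 0 \<and> vec_index l i * vec_index P i = 0"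
    proof (intro allI impI)
      fix i assume "i < n"
      then show "vec_index P i \<ge> 0 \<and> vec_index l i \<ge> 0 \<and> vec_index l i * vec_index P i = 0"
        using * frozenD[OF \<A> fs] by (cases "i \<in> \<A>") (auto intro: less_imp_le)
    qed
  qed
  show ?thesis
  proof (intro conjI)
    show "transpose_mat A = A"
      unfolding assms(9) by (rule stiffness_symmetric)
    show "\<forall>u\<in>carrier_vec n. u \<noteq> 0\<^sub>v n \<longrightarrow> scalar_prod u (A *\<^sub>v u) > 0"
      using pd by blast
    show "\<forall>\<A>\<subseteq>{..<n}. invertible_mat (frozen_matrix n A D \<gamma> \<A>)"
      unfolding D by (intro allI impI frozen_matrix_invertible[OF A pd assms(12) m])
    show "Kh \<Omega> \<T> \<subseteq> K_cone \<Omega>"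
      by (rule Kh_subset_K_cone)
    show "\<forall>\<A>\<subseteq>{..<n}. \<forall>P l. frozen_solution n A D F \<gamma> \<A> P l \<longrightarrow>
       (\<forall>i\<in>\<A>. vec_index P i = 0) \<and>
       (\<forall>i\<in>{..<n} - \<A>. vec_index l i = 0) \<and>
       (\<forall>i<n. vec_index l i * vec_index P i = 0) \<and>
       (\<forall>i\<in>\<A>. \<gamma> * vec_index l i - vec_index P i = \<gamma> * vec_index l i) \<and>
       (\<forall>i\<in>{..<n} - \<A>. \<gamma> * vec_index l i - vec_index P i = - vec_index P i)"
      using frozenD by simp
    show "\<forall>\<A>\<subseteq>{..<n}. \<forall>P l. fixed_point n A D F \<gamma> \<A> P l \<longrightarrow>
       (\<forall>i\<in>\<A>. vec_index l i \<ge> 0) \<and> (\<forall>i\<in>{..<n} - \<A>. vec_index P i > 0)"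
      using fixedD(3,4) by blast
    show "\<forall>\<gamma>'>0. \<forall>\<A>\<subseteq>{..<n}. \<forall>P l.
       (frozen_solution n A D F \<gamma> \<A> P l \<longleftrightarrow> frozen_solution n A D F \<gamma>' \<A> P l) \<and>
       (fixed_point n A D F \<gamma> \<A> P l \<longleftrightarrow> fixed_point n A D F \<gamma>' \<A> P l)"
    proof (intro allI impI conjI)
      fix \<gamma>' :: real and \<A> P l assume *: "0 < \<gamma>'" "\<A> \<subseteq> {..<n}"
      show fs: "frozen_solution n A D F \<gamma> \<A> P l \<longleftrightarrow> frozen_solution n A D F \<gamma>' \<A> P l"
        unfolding frozen[OF assms(12) *(2)] frozen[OF *(1) *(2)] by (rule refl)
      show "fixed_point n A D F \<gamma> \<A> P l \<longleftrightarrow> fixed_point n A D F \<gamma>' \<A> P l"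
        unfolding fixed[OF assms(12) *(2)] fixed[OF *(1) *(2)] fs by (rule refl)
    qed
    show "\<forall>\<A>\<subseteq>{..<n}. \<forall>P l. fixed_point n A D F \<gamma> \<A> P l \<longrightarrow>
       A *\<^sub>v P - D {..<n} *\<^sub>v l = F \<and>
       (\<forall>i<n. vec_index P i \<ge> 0 \<and> vec_index l i \<ge> 0 \<and> vec_index l i * vec_index P i = 0)"
    proof (intro allI impI conjI)
      fix \<A> P l assume *: "\<A> \<subseteq> {..<n}" "fixed_point n A D F \<gamma> \<A> P l"
      note fpD = fixedD[OF *]
      show "vec_index P i \<ge> 0" "vec_index l i \<ge> 0" "vec_index l i * vec_index P i = 0" if "i < n" for i
        using fpD(6) that by blast+
      have Dl: "D {..<n} *\<^sub>v l \<in> carrier_vec n"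
        unfolding D by (auto intro!: carrier_vecI simp: diag_on_def)
      show "A *\<^sub>v P - D {..<n} *\<^sub>v l = F"
      proof (rule eq_vecI)
        show "dim_vec (A *\<^sub>v P - D {..<n} *\<^sub>v l) = dim_vec F"
          using carrier_vecD[OF Dl] carrier_vecD[OF F] by simp
        fix i assume "i < dim_vec F"
        then have i: "i < n"
          using F by simp
        have "vec_index (A *\<^sub>v P - D {..<n} *\<^sub>v l) i = vec_index (A *\<^sub>v P) i - vec_index (D {..<n} *\<^sub>v l) i"
          using i Dl by (intro index_minus_vec(1)) (simp only: carrier_vecD)
        also have "\<dots> = vec_index F i"
          using fpD(5) i unfolding D diag_on_mult_index[OF fpD(2) i] by simp
        finally show "vec_index (A *\<^sub>v P - D {..<n} *\<^sub>v l) i = vec_index F i" .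
      qed
    qed
    show "\<forall>\<A>\<subseteq>{..<n}. \<forall>P l. fixed_point n A D F \<gamma> \<A> P l \<longrightarrow>
       (\<exists>!p. p \<in> Vh \<Omega> \<T> \<and> (\<forall>i<n. p (z i) = vec_index P i)) \<and>
       (\<forall>p\<in>Vh \<Omega> \<T>. (\<forall>i<n. p (z i) = vec_index P i) \<longrightarrow>
          (\<forall>q. is_arg_min (energy \<Omega> d f) (\<lambda>v. v \<in> Kh \<Omega> \<T>) q \<longleftrightarrow> q = p))"
    proof (intro allI impI conjI ballI)
      fix \<A> P l assume *: "\<A> \<subseteq> {..<n}" "fixed_point n A D F \<gamma> \<A> P l"
      note fpD = fixedD[OF *]
      show "\<exists>!p. p \<in> Vh \<Omega> \<T> \<and> (\<forall>i<n. p (z i) = vec_index P i)"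
        by (rule interpolant_unique)
      fix p q assume p: "p \<in> Vh \<Omega> \<T>" "\<forall>i<n. p (z i) = vec_index P i"
      have pK: "p \<in> Kh \<Omega> \<T>"
        using Kh_iff[OF p(1)] p(2) fpD(6) by simp
      \<comment> \<open>A strict gap to every competitor settles both directions: \<open>p\<close>
        is a minimiser, and no other element of \<open>Kh\<close> can be one.\<close>
      have less: "energy \<Omega> d f p < energy \<Omega> d f q'" if "q' \<in> Kh \<Omega> \<T>" "q' \<noteq> p" for q'
      proof (rule Kuhn_Tucker_energy_less[OF assms(7) fpD(1) _ _ _ p(1) _ that, of l])
        show "vec_index (stiff *\<^sub>v P) i - mass \<Omega> \<T> (z i) * vec_index l i = vec_index (load \<Omega> \<T> f n z) i"
          if "i < n" for i
          using fpD(5) that unfolding m_def assms(9,10) by blast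
      qed (use fpD(6) p(2) in blast)+
      show "is_arg_min (energy \<Omega> d f) (\<lambda>v. v \<in> Kh \<Omega> \<T>) q \<longleftrightarrow> q = p"
        unfolding is_arg_min_def using less pK by (metis less_asym)
    qed
  qed
qed

end
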